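(* Let $G:[0,\infty)\times S^{n-1}\to[0,\infty)$ be continuous and such that $G_t=\partial G/\partial t$ is continuous and positive on $(0,\infty)\times S^{n-1}$. Assume that $G_t(t,u)=G_t(t,-u)$ for $(t,u)\in(0,\infty)\times S^{n-1}$. Suppose that $\psi:(0,\infty)\to(0,\infty)$ is continuous, that $\int_1^\infty\frac{\psi(s)}{s}\,ds=\infty$, and that $\varphi(t)=\int_0^t\frac{\psi(s)}{s}\,ds$ is finite for all $t>0$. Let $\mu$ be a finite Borel measure on $S^{n-1}$. Then the following are equivalent: (i) $\mu$ is even and is not concentrated on any closed hemisphere. (ii) There is a $K\in\mathcal{K}_{(o)s}^n$ such that $\mu=\tau\,\widetilde{C}_{G,\psi}(K,\cdot)$, with $$\tau=\frac{1}{\widetilde{C}_G(K,S^{n-1})}\int_{S^{n-1}}\psi(h_K(u))\,d\mu(u)>0.$$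
   Context: Let $n\ge2$, let $o$ be the origin of $\mathbb{R}^n$ and $S^{n-1}$ the unit sphere; $du$ denotes integration with respect to $(n-1)$-dimensional Hausdorff measure $\mathcal{H}^{n-1}$. $\mathcal{K}_{(o)}^n$ is the class of compact convex subsets of $\mathbb{R}^n$ containing $o$ in their interiors, and $\mathcal{K}_{(o)s}^n$ the class of those $K\in\mathcal{K}_{(o)}^n$ with $K=-K$ (origin symmetric). A Borel measure $\mu$ on $S^{n-1}$ is even if $\mu(E)=\mu(-E)$ for all Borel $E$. A finite Borel measure $\mu$ on $S^{n-1}$ is not concentrated on any closed hemisphere if $\int_{S^{n-1}}\langle u,v\rangle_+\,d\mu(u)>0$ for all $v\in S^{n-1}$, where $a_+=\max\{a,0\}$. For $K\in\mathcal{K}_{(o)}^n$ and $u\in S^{n-1}$, $h_K(u)=\max\{\langle u,x\rangle:x\in K\}$ and $\rho_K(u)=\max\{\lambda\ge0:\lambda u\in K\}$. For $K\in\mathcal{K}_{(o)}^n$ and a Borel set $E\subset S^{n-1}$, let $\boldsymbol{\alpha}_K^*(E)$ be the set of $u\in S^{n-1}$ such that some $v\in E$ is an outer unit normal vector of $K$ at the boundary point $\rho_K(u)u$, i.e. $\langle v,\rho_K(u)u\rangle=h_K(v)$. For $\mathcal{H}^{n-1}$-almost all $u\in S^{n-1}$ there is exactly one outer unit normal vector of $K$ at $\rho_K(u)u$, denoted by $\alpha_K(u)$. The general dual Orlicz curvature measure is $$\widetilde{C}_{G,\psi}(K,E)=\frac1n\int_{\boldsymbol{\alpha}_K^*(E)}\frac{\rho_K(u)\,G_t(\rho_K(u),u)}{\psi(h_K(\alpha_K(u)))}\,du$$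 for Borel $E\subset S^{n-1}$, and $\widetilde{C}_G(K,\cdot)$ denotes $\widetilde{C}_{G,\psi}(K,\cdot)$ with $\psi\equiv1$. *)

theory Defs
  imports "HOL-Analysis.Analysis"
begin

text \<open>
  The normalization is the one for which the \<open>m\<close>-dimensional Hausdorff measure on an
  \<open>m\<close>-dimensional Euclidean space is Lebesgue measure. The empty set is singled out because
  of \<open>0 ^ 0 = 1\<close>.
\<close>

definition hausdorff_gauge :: "nat \<Rightarrow> 'a::metric_space set \<Rightarrow> ennreal" where
  "hausdorff_gauge m C =
     (if C = {} then 0 else ennreal (unit_ball_vol (real m) * (diameter C / 2) ^ m))"

definition hausdorff_pre :: "nat \<Rightarrow> real \<Rightarrow> 'a::metric_space set \<Rightarrow> ennreal" where
  "hausdorff_pre m \<delta> E =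
     (INF C \<in> {C :: nat \<Rightarrow> 'a set. E \<subseteq> (\<Union>i. C i) \<and> (\<forall>i. bounded (C i) \<and> diameter (C i) \<le> \<delta>)}.
        \<Sum>i. hausdorff_gauge m (C i))"

definition hausdorff_outer :: "nat \<Rightarrow> 'a::metric_space set \<Rightarrow> ennreal" where
  "hausdorff_outer m E = (SUP \<delta> \<in> {0<..}. hausdorff_pre m \<delta> E)"

text \<open>
  The measure lives on all Caratheodory-measurable sets, not just on Borel sets: the
  reverse radial Gauss image of a Borel set need not be Borel.
\<close>

definition hausdorff_measure :: "nat \<Rightarrow> 'a::metric_space measure" where
  "hausdorff_measure m =
     measure_of UNIV (lambda_system UNIV UNIV (hausdorff_outer m)) (hausdorff_outer m)"

lemma hausdorff_pre_mono:
  assumes "E \<subseteq> F"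
  shows "hausdorff_pre m \<delta> E \<le> hausdorff_pre m \<delta> F"
  unfolding hausdorff_pre_def using assms by (intro INF_superset_mono) auto

lemma hausdorff_pre_empty: "0 < \<delta> \<Longrightarrow> hausdorff_pre m \<delta> {} = 0"
proof -
  assume "0 < \<delta>"
  then have "hausdorff_pre m \<delta> ({} :: 'a set) \<le> (\<Sum>i::nat. hausdorff_gauge m ({} :: 'a set))"
    unfolding hausdorff_pre_def by (intro INF_lower) auto
  then show ?thesis by (simp add: hausdorff_gauge_def)
qed

lemma hausdorff_pre_subadditive:
  fixes A :: "nat \<Rightarrow> 'a::metric_space set"
  shows "hausdorff_pre m \<delta> (\<Union>i. A i) \<le> (\<Sum>i. hausdorff_pre m \<delta> (A i))"
proof (rule ennreal_le_epsilon)
  fix e :: real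
  assume e: "0 < e" and fin: "(\<Sum>i. hausdorff_pre m \<delta> (A i)) < top"
  let ?e = "\<lambda>n. ennreal (e * (1/2) ^ Suc n)"
  have "hausdorff_pre m \<delta> (A n) < hausdorff_pre m \<delta> (A n) + ?e n" for n
    using e fin ennreal_suminf_lessD[OF fin, of n] by (auto simp: less_top[symmetric])
  then have "\<exists>C. A n \<subseteq> (\<Union>i. C i) \<and> (\<forall>i. bounded (C i) \<and> diameter (C i) \<le> \<delta>) \<and>
      (\<Sum>i. hausdorff_gauge m (C i)) < hausdorff_pre m \<delta> (A n) + ?e n" for n
    by (subst (asm) (1) hausdorff_pre_def) (auto simp: INF_less_iff)
  then obtain C where C: "\<And>n. A n \<subseteq> (\<Union>i. C n i)"
      "\<And>n i. bounded (C n i) \<and> diameter (C n i) \<le> \<delta>"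
      "\<And>n. (\<Sum>i. hausdorff_gauge m (C n i)) < hausdorff_pre m \<delta> (A n) + ?e n"
    by metis
  define D where "D k = (case prod_decode k of (n, i) \<Rightarrow> C n i)" for k
  have "(\<Union>n. A n) \<subseteq> (\<Union>k. D k)"
  proof
    fix x assume "x \<in> (\<Union>n. A n)"
    then obtain n i where "x \<in> C n i" using C(1) by blast
    then have "x \<in> D (prod_encode (n, i))" by (simp add: D_def)
    then show "x \<in> (\<Union>k. D k)" by blast
  qed
  then have "hausdorff_pre m \<delta> (\<Union>n. A n) \<le> (\<Sum>k. hausdorff_gauge m (D k))"
    unfolding hausdorff_pre_def using C(2) by (intro INF_lower) (auto simp: D_def split: prod.split)
  also have "\<dots> = (\<Sum>n i. hausdorff_gauge m (C n i))"
  proof -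
    have "(\<Sum>k. (\<lambda>(n, i). hausdorff_gauge m (C n i)) (prod_decode k))
        = (\<Sum>n i. hausdorff_gauge m (C n i))"
      by (subst suminf_ennreal_2dimen[symmetric]) auto
    then show ?thesis by (simp add: D_def case_prod_beta)
  qed
  also have "\<dots> \<le> (\<Sum>n. hausdorff_pre m \<delta> (A n) + ?e n)"
    using C(3) by (intro suminf_le) (auto intro: less_imp_le)
  also have "\<dots> = (\<Sum>n. hausdorff_pre m \<delta> (A n)) + (\<Sum>n. ?e n)"
    by (intro suminf_add[symmetric]) auto
  also have "(\<Sum>n. ?e n) = ennreal e"
    using sums_mult[OF power_half_series, of e] e by (subst suminf_ennreal_eq) auto
  finally show "hausdorff_pre m \<delta> (\<Union>i. A i) \<le> (\<Sum>i. hausdorff_pre m \<delta> (A i)) + ennreal e" .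
qed

lemma outer_measure_space_hausdorff:
  "outer_measure_space UNIV (hausdorff_outer m :: 'a::metric_space set \<Rightarrow> ennreal)"
  unfolding outer_measure_space_def
proof (intro conjI)
  show "positive UNIV (hausdorff_outer m :: 'a set \<Rightarrow> ennreal)"
    by (auto simp: positive_def hausdorff_outer_def hausdorff_pre_empty intro!: antisym SUP_least)
  show "increasing UNIV (hausdorff_outer m :: 'a set \<Rightarrow> ennreal)"
    by (auto simp: increasing_def hausdorff_outer_def intro!: SUP_mono hausdorff_pre_mono)
  show "countably_subadditive UNIV (hausdorff_outer m :: 'a set \<Rightarrow> ennreal)"
    unfolding countably_subadditive_def
  proof (intro allI impI)
    fix A :: "nat \<Rightarrow> 'a set"
    show "hausdorff_outer m (\<Union>i. A i) \<le> (\<Sum>i. hausdorff_outer m (A i))"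
      unfolding hausdorff_outer_def[of m "\<Union>i. A i"]
    proof (rule SUP_least)
      fix \<delta> :: real assume "\<delta> \<in> {0<..}"
      then have "hausdorff_pre m \<delta> (A i) \<le> hausdorff_outer m (A i)" for i
        unfolding hausdorff_outer_def by (intro SUP_upper)
      then have "(\<Sum>i. hausdorff_pre m \<delta> (A i)) \<le> (\<Sum>i. hausdorff_outer m (A i))"
        by (intro suminf_le) auto
      then show "hausdorff_pre m \<delta> (\<Union>i. A i) \<le> (\<Sum>i. hausdorff_outer m (A i))"
        using hausdorff_pre_subadditive order_trans by blast
    qed
  qed
qed

lemma measure_space_hausdorff:
  fixes m :: nat
  defines "f \<equiv> (hausdorff_outer m :: 'a::metric_space set \<Rightarrow> ennreal)"
  shows "measure_space UNIV (lambda_system UNIV UNIV f) f"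
  unfolding f_def
  using sigma_algebra.caratheodory_lemma[OF sigma_algebra_Pow[of "UNIV :: 'a set"],
      of "hausdorff_outer m"]
    outer_measure_space_hausdorff[where ?'a = 'a, of m] by simp

lemma sets_hausdorff_measure:
  "sets (hausdorff_measure m :: 'a::metric_space measure) =
     lambda_system UNIV UNIV (hausdorff_outer m)"
  using measure_space_hausdorff[where ?'a = 'a, of m]
  by (simp add: hausdorff_measure_def measure_space_def sigma_algebra.sigma_sets_eq)

lemma emeasure_hausdorff_measure:
  fixes E :: "'a::metric_space set"
  assumes "E \<in> sets (hausdorff_measure m)"
  shows "emeasure (hausdorff_measure m) E = hausdorff_outer m E"
  using measure_space_hausdorff[where ?'a = 'a, of m] assms unfolding sets_hausdorff_measure
  by (auto simp: hausdorff_measure_def measure_space_def intro!: emeasure_measure_of_sigma)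

definition convex_bodies_o :: "'a::euclidean_space set set" where
  "convex_bodies_o = {K. compact K \<and> convex K \<and> 0 \<in> interior K}"

definition convex_bodies_os :: "'a::euclidean_space set set" where
  "convex_bodies_os = {K \<in> convex_bodies_o. K = uminus ` K}"

text \<open>For the bodies above, both suprema are maxima.\<close>

definition support_fun :: "'a::euclidean_space set \<Rightarrow> 'a \<Rightarrow> real" where
  "support_fun K u = (SUP x\<in>K. u \<bullet> x)"

definition radial_fun :: "'a::euclidean_space set \<Rightarrow> 'a \<Rightarrow> real" where
  "radial_fun K u = Sup {r. 0 \<le> r \<and> r *\<^sub>R u \<in> K}"

text \<open>\<open>v\<close> is an outer unit normal vector of \<open>K\<close> at the boundary point in direction \<open>u\<close>.\<close>

definition radial_normal :: "'a::euclidean_space set \<Rightarrow> 'a \<Rightarrow> 'a \<Rightarrow> bool" where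
  "radial_normal K u v \<longleftrightarrow>
     v \<in> sphere 0 1 \<and> v \<bullet> (radial_fun K u *\<^sub>R u) = support_fun K v"

definition reverse_radial_gauss_image :: "'a::euclidean_space set \<Rightarrow> 'a set \<Rightarrow> 'a set" where
  "reverse_radial_gauss_image K E = {u \<in> sphere 0 1. \<exists>v\<in>E. radial_normal K u v}"

text \<open>
  Unspecified on the set of \<open>u\<close> without a unique normal, which has Hausdorff measure zero.
\<close>

definition radial_gauss_map :: "'a::euclidean_space set \<Rightarrow> 'a \<Rightarrow> 'a" where
  "radial_gauss_map K u = (THE v. radial_normal K u v)"

definition dual_orlicz_curvature ::
  "(real \<Rightarrow> 'a::euclidean_space \<Rightarrow> real) \<Rightarrow> (real \<Rightarrow> real) \<Rightarrow> 'a set \<Rightarrow> 'a set \<Rightarrow> real" where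
  "dual_orlicz_curvature G \<psi> K E =
     1 / DIM('a) *
     (LINT u : reverse_radial_gauss_image K E | hausdorff_measure (DIM('a) - 1).
        radial_fun K u * deriv (\<lambda>t. G t u) (radial_fun K u)
          / \<psi> (support_fun K (radial_gauss_map K u)))"

definition even_measure :: "'a::euclidean_space measure \<Rightarrow> bool" where
  "even_measure \<mu> \<longleftrightarrow> (\<forall>E\<in>sets \<mu>. emeasure \<mu> E = emeasure \<mu> (uminus ` E))"

definition not_concentrated_on_hemisphere :: "'a::euclidean_space measure \<Rightarrow> bool" where
  "not_concentrated_on_hemisphere \<mu> \<longleftrightarrow>
     (\<forall>v\<in>sphere 0 1. 0 < (LINT u|\<mu>. max 0 (u \<bullet> v)))"

end

theory Submission
  imports Defs "HOL-Complex_Analysis.Great_Picard"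
begin

text \<open>
  Write \<open>[f]\<close> for the Wulff shape of a positive continuous function \<open>f\<close> on the sphere, that is, for
  the largest convex body whose support function is at most \<open>f\<close>. A body \<open>K\<close> is the Wulff shape of its
  own support function, and the reciprocal of the radial function of \<open>[f]\<close> in direction \<open>u\<close> is
  the maximum of \<open>(u \<bullet> v) / f v\<close> over all unit vectors \<open>v\<close> (the gauge of \<open>[f]\<close>). The maximizers \<open>v\<close> are
  the outer normals at the boundary point in direction \<open>u\<close>. For almost all \<open>u\<close> there is just
  one: maximizers of linear functionals over a compact set are monotone along lines,
  so on a line in direction \<open>b\<close> only countably many functionals have maximizers that differ in
  direction \<open>b\<close> (\<open>nonunique_face\<close>); by Fubini's theorem the exceptional functionals
  form a null cone, and a null cone meets the sphere in
  a set of Hausdorff measure zero (\<open>hausdorff_null_of_cone_null\<close>). The curvature measure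
  of \<open>K\<close> is therefore the image, under the normal map, of a measure with a positive
  density on the sphere (\<open>dual_orlicz_curvature_eq\<close>).

  From (ii) to (i): for symmetric \<open>K\<close> the density is even and the normal map is odd, so the image is
  even. Normals at boundary points in directions near \<open>v\<close> have a positive inner product with
  \<open>v\<close>, so every open hemisphere is charged; that uses that caps have positive Hausdorff
  measure (\<open>hausdorff_cap_pos\<close>).

  From (i) to (ii): minimize the cost, the integral of \<open>\<phi> (f v)\<close> with respect to \<open>\<mu>\<close>, over all even
  \<open>f\<close> for which the integral of \<open>G (\<rho> u) u\<close>, where \<open>\<rho>\<close> is the radial function of \<open>[f]\<close>, is at least the
  value that it has for the unit ball. Since \<open>\<mu>\<close> is not concentrated on a closed hemisphere and \<open>\<phi>\<close> is
  unbounded, minimizing sequences are bounded; since the bodies are symmetric and \<open>G\<close> is strictly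
  increasing in its first argument, they cannot collapse (\<open>minimizer_exists\<close>). Perturbing
  the minimizer \<open>h\<close>, a support function, to \<open>h v * exp (t * g v)\<close> changes the
  logarithm of the radial function to first order by \<open>t * g\<close> at the normal
  (\<open>ln_wulff_gauge_derivative\<close>), which determines the first variations of both functionals. The
  multiplier rule (\<open>lagrange_multiplier\<close>) then identifies \<open>\<psi> (h v)\<close> times \<open>\<mu>\<close> with a multiple of
  the image measure on even continuous functions, and evenness of both sides
  extends this to all Borel sets (\<open>solution_exists\<close>).
\<close>

section \<open>Borel sets are measurable for Hausdorff measure\<close>

lemma hausdorff_pre_antimono:
  assumes "\<delta> \<le> \<delta>'"
  shows "hausdorff_pre m \<delta>' E \<le> hausdorff_pre m \<delta> E"
  unfolding hausdorff_pre_def using assms by (intro INF_superset_mono) (auto intro: order_trans)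

lemma hausdorff_outer_mono: "E \<subseteq> F \<Longrightarrow> hausdorff_outer m E \<le> hausdorff_outer m F"
  unfolding hausdorff_outer_def by (intro SUP_mono) (use hausdorff_pre_mono in blast)

text \<open>
  A covering set of diameter at most \<open>\<delta>\<close> cannot meet both sets, so every cover of the union
  splits into a cover of \<open>A\<close> and a cover of \<open>B\<close>.
\<close>

lemma hausdorff_pre_separated:
  fixes A B :: "'a::metric_space set"
  assumes sep: "\<And>x y. x \<in> A \<Longrightarrow> y \<in> B \<Longrightarrow> \<delta> < dist x y"
  shows "hausdorff_pre m \<delta> A + hausdorff_pre m \<delta> B \<le> hausdorff_pre m \<delta> (A \<union> B)"
  unfolding hausdorff_pre_def[of m \<delta> "A \<union> B"]
proof (rule INF_greatest)
  fix C :: "nat \<Rightarrow> 'a set"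
  assume "C \<in> {C. A \<union> B \<subseteq> (\<Union>i. C i) \<and> (\<forall>i. bounded (C i) \<and> diameter (C i) \<le> \<delta>)}"
  then have cov: "A \<union> B \<subseteq> (\<Union>i. C i)" and C: "\<And>i. bounded (C i)" "\<And>i. diameter (C i) \<le> \<delta>"
    by auto
  define C1 where "C1 i = (if C i \<inter> A = {} then {} else C i)" for i
  define C2 where "C2 i = (if C i \<inter> B = {} then {} else C i)" for i
  have d0: "0 \<le> \<delta>"
    using C[of 0] by (meson diameter_ge_0 order_trans)
  have excl: "C1 i = {} \<or> C2 i = {}" for i
  proof (rule ccontr)
    assume "\<not> ?thesis"
    then obtain x y where "x \<in> C i" "x \<in> A" "y \<in> C i" "y \<in> B"
      by (auto simp: C1_def C2_def split: if_splits)
    then have "dist x y \<le> \<delta>"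
      using diameter_bounded_bound[OF C(1)[of i]] C(2)[of i] by (meson order_trans)
    then show False using sep \<open>x \<in> A\<close> \<open>y \<in> B\<close> by fastforce
  qed
  have "hausdorff_pre m \<delta> A \<le> (\<Sum>i. hausdorff_gauge m (C1 i))"
    unfolding hausdorff_pre_def
  proof (rule INF_lower, safe)
    fix x assume "x \<in> A"
    then obtain i where "x \<in> C i" using cov by auto
    then show "x \<in> (\<Union>i. C1 i)" using \<open>x \<in> A\<close> by (auto simp: C1_def)
  qed (use C d0 in \<open>auto simp: C1_def\<close>)
  moreover have "hausdorff_pre m \<delta> B \<le> (\<Sum>i. hausdorff_gauge m (C2 i))"
    unfolding hausdorff_pre_def
  proof (rule INF_lower, safe)
    fix x assume "x \<in> B"
    then obtain i where "x \<in> C i" using cov by auto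
    then show "x \<in> (\<Union>i. C2 i)" using \<open>x \<in> B\<close> by (auto simp: C2_def)
  qed (use C d0 in \<open>auto simp: C2_def\<close>)
  moreover have "hausdorff_gauge m (C1 i) + hausdorff_gauge m (C2 i) \<le> hausdorff_gauge m (C i)" for i
    using excl[of i] unfolding C1_def C2_def by (cases "C i \<inter> A = {}"; cases "C i \<inter> B = {}") (auto simp: hausdorff_gauge_def)
  then have "(\<Sum>i. hausdorff_gauge m (C1 i)) + (\<Sum>i. hausdorff_gauge m (C2 i))
      \<le> (\<Sum>i. hausdorff_gauge m (C i))"
    by (subst suminf_add) (auto intro!: suminf_le)
  ultimately show "hausdorff_pre m \<delta> A + hausdorff_pre m \<delta> B \<le> (\<Sum>i. hausdorff_gauge m (C i))"
    by (meson add_mono order_trans)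
qed

lemma hausdorff_outer_separated:
  fixes A B :: "'a::metric_space set"
  assumes "0 < d" and sep: "\<And>x y. x \<in> A \<Longrightarrow> y \<in> B \<Longrightarrow> d \<le> dist x y"
  shows "hausdorff_outer m A + hausdorff_outer m B \<le> hausdorff_outer m (A \<union> B)"
proof -
  have *: "hausdorff_pre m \<delta>1 A + hausdorff_pre m \<delta>2 B \<le> hausdorff_outer m (A \<union> B)"
    if "\<delta>1 > 0" "\<delta>2 > 0" for \<delta>1 \<delta>2
  proof -
    define \<delta> where "\<delta> = min (min \<delta>1 \<delta>2) (d / 2)"
    have d: "\<delta> > 0" "\<delta> \<le> \<delta>1" "\<delta> \<le> \<delta>2" "\<delta> < d" using that \<open>0 < d\<close> by (auto simp: \<delta>_def)
    have "hausdorff_pre m \<delta>1 A + hausdorff_pre m \<delta>2 B \<le> hausdorff_pre m \<delta> A + hausdorff_pre m \<delta> B"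
      using d by (intro add_mono hausdorff_pre_antimono)
    also have "\<dots> \<le> hausdorff_pre m \<delta> (A \<union> B)"
      using sep d by (intro hausdorff_pre_separated) (meson less_le_trans)
    also have "\<dots> \<le> hausdorff_outer m (A \<union> B)"
      unfolding hausdorff_outer_def using d by (intro SUP_upper) auto
    finally show ?thesis .
  qed
  have "hausdorff_pre m \<delta>1 A + hausdorff_outer m B \<le> hausdorff_outer m (A \<union> B)" if "\<delta>1 > 0" for \<delta>1
    unfolding hausdorff_outer_def[of m B]
    using * that gt_ex[of "0::real"]
    by (subst ennreal_SUP_add_right) (auto intro!: SUP_least)
  then have "(SUP \<delta>\<in>{0<..}. hausdorff_pre m \<delta> A + hausdorff_outer m B) \<le> hausdorff_outer m (A \<union> B)"
    by (intro SUP_least) auto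
  then show ?thesis
    unfolding hausdorff_outer_def[of m A] using gt_ex[of "0::real"]
    by (subst (asm) ennreal_SUP_add_left) auto
qed

lemma outer_measure_space_subadditive:
  assumes "outer_measure_space UNIV f" "A \<inter> B = {}"
  shows "f (A \<union> B) \<le> f A + f B"
proof -
  have emp: "f {} = 0" and csub: "\<And>A :: nat \<Rightarrow> _. disjoint_family A \<Longrightarrow> f (\<Union>i. A i) \<le> (\<Sum>i. f (A i))"
    using assms by (auto simp: outer_measure_space_def positive_def countably_subadditive_def)
  have "f (A \<union> B) = f (\<Union>i. binaryset A B i)" by (simp add: UN_binaryset_eq)
  also have "\<dots> \<le> (\<Sum>i. f (binaryset A B i))"
    using assms(2) by (intro csub) (auto simp: disjoint_family_on_def binaryset_def)
  also have "\<dots> = f A + f B" by (rule suminf_binaryset_eq[where f=f, OF emp])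
  finally show ?thesis .
qed

text \<open>
  Caratheodory's criterion. Cut \<open>A - F\<close> into the layers \<open>D j\<close> on which the distance to \<open>F\<close>
  lies between \<open>1/(j+2)\<close> and \<open>1/(j+1)\<close>. Layers whose indices have the same parity are
  separated from each other, so the outer measures of all layers have a sum of at most
  \<open>2 * f A\<close>; hence the part of \<open>A - F\<close> close to \<open>F\<close> has small outer measure, and the rest is
  separated from \<open>F\<close>.
\<close>

lemma closed_in_lambda_system:
  fixes f :: "'a::metric_space set \<Rightarrow> ennreal"
  assumes om: "outer_measure_space UNIV f"
    and sep: "\<And>A B d. 0 < d \<Longrightarrow> (\<And>x y. x \<in> A \<Longrightarrow> y \<in> B \<Longrightarrow> d \<le> dist x y) \<Longrightarrow> f A + f B \<le> f (A \<union> B)"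
    and F: "closed F"
  shows "F \<in> lambda_system UNIV UNIV f"
proof -
  have mono: "A \<subseteq> B \<Longrightarrow> f A \<le> f B" for A B
    using om by (auto simp: outer_measure_space_def increasing_def)
  have emp: "f {} = 0" using om by (auto simp: outer_measure_space_def positive_def)
  have csub: "f (\<Union>i. A i) \<le> (\<Sum>i. f (A i))" if "disjoint_family A" for A :: "nat \<Rightarrow> 'a set"
    using om that by (auto simp: outer_measure_space_def countably_subadditive_def)
  note csub2 = outer_measure_space_subadditive[OF om]
  have main: "f (F \<inter> A) + f (A - F) \<le> f A" for A
  proof (cases "F = {} \<or> f A = \<infinity>")
    case True then show ?thesis using emp by auto
  next
    case False
    then have fin: "f A < \<infinity>" and ne: "F \<noteq> {}" by (auto simp: less_top)
    define w where "w x = infdist x F" for x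
    have w_lip: "w x \<le> w y + dist x y" for x y
      unfolding w_def by (rule infdist_triangle)
    have w_pos: "w x > 0 \<longleftrightarrow> x \<notin> F" for x
      unfolding w_def using F ne in_closed_iff_infdist_zero[of F x] infdist_nonneg[of x F] by auto
    define D where "D j = {x \<in> A. 1 / (real j + 2) \<le> w x \<and> w x < 1 / (real j + 1)}" for j :: nat
    define Ak where "Ak k = {x \<in> A. 1 / (real k + 1) \<le> w x}" for k :: nat
    \<comment> \<open>the summand 1/2 puts the threshold strictly between two consecutive layers of equal parity\<close>
    have chain: "(\<Sum>j<N. f (D (2 * j + c))) \<le> f {x\<in>A. 1 / (2 * real N + real c + 1/2) \<le> w x}"
      for N c :: nat
    proof (induction N)
      case 0 then show ?case by simp
    next
      case (Suc N)
      define t where "t = 2 * real N + real c + 1/2"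
      have t: "t > 0" by (simp add: t_def)
      have "f {x\<in>A. 1 / t \<le> w x} + f (D (2 * N + c))
          \<le> f ({x\<in>A. 1 / t \<le> w x} \<union> D (2 * N + c))"
      proof (rule sep[where d="1 / t - 1 / (t + 1/2)"])
        have "1 / (t + 1/2) < 1 / t" using t by (intro divide_strict_left_mono) auto
        then show "0 < 1 / t - 1 / (t + 1/2)" by simp
      next
        fix x y assume "x \<in> {x \<in> A. 1 / t \<le> w x}" "y \<in> D (2 * N + c)"
        then show "1 / t - 1 / (t + 1/2) \<le> dist x y"
          using w_lip[of x y] by (auto simp: D_def t_def algebra_simps)
      qed
      also have "\<dots> \<le> f {x\<in>A. 1 / (t + 2) \<le> w x}"
      proof (intro mono subsetI)
        fix x assume "x \<in> {x\<in>A. 1 / t \<le> w x} \<union> D (2 * N + c)"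
        then have "x \<in> A" "1 / t \<le> w x \<or> 1 / (t + 3/2) \<le> w x"
          by (auto simp: D_def t_def algebra_simps)
        moreover have "1 / (t + 2) \<le> 1 / t" "1 / (t + 2) \<le> 1 / (t + 3/2)"
          using t by (auto intro!: divide_left_mono)
        ultimately show "x \<in> {x\<in>A. 1 / (t + 2) \<le> w x}" by auto
      qed
      finally have le1: "f {x\<in>A. 1 / t \<le> w x} + f (D (2 * N + c)) \<le> f {x\<in>A. 1 / (t + 2) \<le> w x}" .
      have le2: "(\<Sum>j<Suc N. f (D (2 * j + c))) \<le> f {x\<in>A. 1 / t \<le> w x} + f (D (2 * N + c))"
        using Suc by (simp add: t_def add_right_mono)
      have t2: "2 * real (Suc N) + real c + 1/2 = t + 2" by (simp add: t_def)
      show ?case unfolding t2 by (rule order_trans[OF le2 le1])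
    qed
    have half: "(\<Sum>j. f (D (2 * j + c))) \<le> f A" for c
      by (rule suminf_le_const) (auto intro: order_trans[OF chain] mono)
    have T: "(\<Sum>j. f (D j)) < \<infinity>"
    proof -
      have "(\<Sum>j<2 * N. f (D j)) = (\<Sum>j<N. f (D (2 * j + 0))) + (\<Sum>j<N. f (D (2 * j + 1)))" for N
        by (induction N) (auto simp: algebra_simps)
      also have "\<dots> N \<le> f A + f A" for N
        by (intro add_mono order_trans[OF chain] mono) auto
      finally have 2: "(\<Sum>j<2 * N. f (D j)) \<le> f A + f A" for N .
      have "(\<Sum>j<N. f (D j)) \<le> f A + f A" for N
        by (rule order_trans[OF sum_mono2 2[of N]]) auto
      then have "(\<Sum>j. f (D j)) \<le> f A + f A"
        by (intro suminf_le_const) auto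
      also have "f A + f A < \<infinity>" using fin by (simp add: less_top[symmetric])
      finally show ?thesis .
    qed
    have Ddisj: "disjoint_family (\<lambda>j. D (j + k))" for k
    proof -
      have "D i \<inter> D j = {}" if "i < j" for i j
      proof -
        have "1 / (real j + 1) \<le> 1 / (real i + 2)" using that by (intro divide_left_mono) auto
        then show ?thesis by (auto simp: D_def)
      qed
      then show ?thesis unfolding disjoint_family_on_def
        by (metis Int_commute add_less_cancel_right nat_neq_iff)
    qed
    have split: "A - F \<subseteq> Ak k \<union> (\<Union>j. D (j + k))" for k
    proof
      fix x assume x: "x \<in> A - F"
      define i where "i = (LEAST i. 1 / (real i + 1) \<le> w x)"
      have "w x > 0" using x w_pos by auto
      then obtain i0 where "1 / (real i0 + 1) \<le> w x"
        using reals_Archimedean[of "w x"] by (auto simp: inverse_eq_divide add.commute intro: less_imp_le)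
      then have i: "1 / (real i + 1) \<le> w x" "\<And>j. j < i \<Longrightarrow> w x < 1 / (real j + 1)"
        unfolding i_def by (rule LeastI) (metis not_less_Least not_le)
      show "x \<in> Ak k \<union> (\<Union>j. D (j + k))"
      proof (cases "i \<le> k")
        case True
        then have "1 / (real k + 1) \<le> 1 / (real i + 1)" by (intro divide_left_mono) auto
        then show ?thesis using i(1) x by (auto simp: Ak_def)
      next
        case False
        then obtain j where j: "i = Suc (j + k)" by (metis add.commute less_imp_Suc_add not_le)
        have "x \<in> D (j + k)" using i(1) i(2)[of "j + k"] x by (auto simp: D_def j algebra_simps)
        then show ?thesis by auto
      qed
    qed
    \<comment> \<open>adding the first \<open>k\<close> layers on both sides avoids subtraction of extended reals\<close>
    have "f (F \<inter> A) + f (A - F) + (\<Sum>j<k. f (D j)) \<le> f A + (\<Sum>j. f (D j))" for k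
    proof -
      have "f (A - F) \<le> f (Ak k \<union> (\<Union>j. D (j + k)))" by (intro mono split)
      also have "\<dots> \<le> f (Ak k) + f (\<Union>j. D (j + k))"
      proof (rule csub2)
        have "False" if "x \<in> Ak k" "x \<in> D (j + k)" for x j
        proof -
          have "1 / (real (j + k) + 1) \<le> 1 / (real k + 1)" by (intro divide_left_mono) auto
          moreover have "1 / (real k + 1) \<le> w x" "w x < 1 / (real (j + k) + 1)"
            using that by (simp_all add: Ak_def D_def)
          ultimately show False by linarith
        qed
        then show "Ak k \<inter> (\<Union>j. D (j + k)) = {}" by blast
      qed
      also have "\<dots> \<le> f (Ak k) + (\<Sum>j. f (D (j + k)))"
        by (intro add_left_mono csub Ddisj)
      finally have 1: "f (A - F) \<le> f (Ak k) + (\<Sum>j. f (D (j + k)))" .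
      have "f (F \<inter> A) + f (Ak k) \<le> f ((F \<inter> A) \<union> Ak k)"
      proof (rule sep[where d="1 / (real k + 1)"])
        fix x y assume "x \<in> F \<inter> A" "y \<in> Ak k"
        then show "1 / (real k + 1) \<le> dist x y"
          using w_lip[of y x] w_pos[of x] by (auto simp: Ak_def dist_commute)
      qed auto
      also have "\<dots> \<le> f A" by (intro mono) (auto simp: Ak_def)
      finally have 2: "f (F \<inter> A) + f (Ak k) \<le> f A" .
      have 3: "(\<Sum>j. f (D j)) = (\<Sum>j. f (D (j + k))) + (\<Sum>j<k. f (D j))"
        by (rule suminf_offset) simp
      have "f (F \<inter> A) + f (A - F) + (\<Sum>j<k. f (D j))
          \<le> f (F \<inter> A) + (f (Ak k) + (\<Sum>j. f (D (j + k)))) + (\<Sum>j<k. f (D j))"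
        by (intro add_mono 1) auto
      also have "\<dots> = (f (F \<inter> A) + f (Ak k)) + (\<Sum>j. f (D j))"
        unfolding 3 by (simp add: add.assoc)
      also have "\<dots> \<le> f A + (\<Sum>j. f (D j))" by (intro add_right_mono 2)
      finally show ?thesis .
    qed
    then have "(SUP k. f (F \<inter> A) + f (A - F) + (\<Sum>j<k. f (D j))) \<le> f A + (\<Sum>j. f (D j))"
      by (intro SUP_least)
    then have "f (F \<inter> A) + f (A - F) + (\<Sum>j. f (D j)) \<le> f A + (\<Sum>j. f (D j))"
      by (subst (1) suminf_eq_SUP) (simp add: ennreal_SUP_add_right)
    then show ?thesis using T by (auto simp: ennreal_add_left_cancel_le add.commute[of _ "suminf _"])
  qed
  show ?thesis
    unfolding lambda_system_def
  proof (intro CollectI conjI ballI UNIV_I)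
    fix A :: "'a set"
    have "A = (F \<inter> A) \<union> (A - F)" "(F \<inter> A) \<inter> (A - F) = {}" by auto
    then have "f A \<le> f (F \<inter> A) + f (A - F)" using csub2[of "F \<inter> A" "A - F"] by simp
    moreover have "(UNIV - F) \<inter> A = A - F" by auto
    ultimately show "f (F \<inter> A) + f ((UNIV - F) \<inter> A) = f A" using main[of A] by (simp add: antisym)
  qed
qed

lemma borel_subset_hausdorff_measure:
  "sets borel \<subseteq> sets (hausdorff_measure m :: 'a::metric_space measure)"
proof -
  have "sigma_sets (space (hausdorff_measure m)) {F :: 'a set. closed F} \<subseteq> sets (hausdorff_measure m)"
  proof (rule sets.sigma_sets_subset)
    have "F \<in> lambda_system UNIV UNIV (hausdorff_outer m)" if "closed F" for F :: "'a set"
      using outer_measure_space_hausdorff hausdorff_outer_separated that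
      by (rule closed_in_lambda_system)
    then show "{F :: 'a set. closed F} \<subseteq> sets (hausdorff_measure m)"
      unfolding sets_hausdorff_measure by blast
  qed
  then show ?thesis
    by (simp add: borel_eq_closed hausdorff_measure_def)
qed

lemma hausdorff_outer_uminus:
  fixes E :: "'a::real_normed_vector set"
  shows "hausdorff_outer m (uminus ` E) = hausdorff_outer m E"
proof -
  have diam: "diameter (uminus ` C) = diameter C" for C :: "'a set"
  proof -
    have "(uminus ` C) \<times> (uminus ` C) = (\<lambda>(x, y). (- x, - y)) ` (C \<times> C)" by auto
    then show ?thesis by (auto simp: diameter_def image_image case_prod_beta dist_minus)
  qed
  have le: "hausdorff_pre m \<delta> (uminus ` E) \<le> hausdorff_pre m \<delta> E" for \<delta> and E :: "'a set"
    unfolding hausdorff_pre_def[of m \<delta> E]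
  proof (rule INF_greatest, safe)
    fix C :: "nat \<Rightarrow> 'a set"
    assume C: "E \<subseteq> \<Union> (range C)" "\<forall>i. bounded (C i) \<and> diameter (C i) \<le> \<delta>"
    have "hausdorff_pre m \<delta> (uminus ` E) \<le> (\<Sum>i. hausdorff_gauge m (uminus ` C i))"
      unfolding hausdorff_pre_def using C by (intro INF_lower) (simp add: diam image_UN[symmetric] image_mono)
    also have "\<dots> = (\<Sum>i. hausdorff_gauge m (C i))"
      by (intro suminf_cong) (auto simp: hausdorff_gauge_def diam)
    finally show "hausdorff_pre m \<delta> (uminus ` E) \<le> (\<Sum>i. hausdorff_gauge m (C i))" .
  qed
  have "hausdorff_pre m \<delta> (uminus ` E) = hausdorff_pre m \<delta> E" for \<delta>
    using le[of \<delta> E] le[of \<delta> "uminus ` E"] by (simp add: image_image antisym)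
  then show ?thesis by (simp add: hausdorff_outer_def)
qed

section \<open>Hausdorff measure on the sphere compared with the volume of cones\<close>

text \<open>
  Dyadic cubes have edges of equal length, so a power of the diameter of such a cube is at most a
  constant times its volume; that is what makes the volume of an open set control the Hausdorff
  sums of its covers. Empty positions of the sequence are filled with the degenerate
  cube \<open>{0}\<close>, which contributes nothing.
\<close>

lemma small_cubes_in_open_set:
  fixes U :: "'a::euclidean_space set"
  assumes "open U" "bounded S" "S \<subseteq> U" "0 < \<delta>"
  obtains a b :: "nat \<Rightarrow> 'a" where
    "S \<subseteq> (\<Union>i. cbox (a i) (b i))"
    "\<And>i. dist (a i) (b i) \<le> \<delta>"
    "\<And>i. cbox (a i) (b i) \<noteq> {}"
    "(\<Sum>i. ennreal (dist (a i) (b i) ^ DIM('a))) \<le> ennreal (real DIM('a) ^ DIM('a)) * emeasure lborel U"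
proof -
  let ?n = "DIM('a)"
  obtain r where r: "r > 0" "\<And>x. x \<in> S \<Longrightarrow> norm x \<le> r"
    using \<open>bounded S\<close> by (auto simp: bounded_pos)
  have "\<exists>e. e > 0 \<and> e \<le> \<delta> / 2 \<and> (x \<in> U \<longrightarrow> ball x e \<subseteq> U)" for x
  proof (cases "x \<in> U")
    case True
    then obtain e where "e > 0" "ball x e \<subseteq> U" using \<open>open U\<close> open_contains_ball by blast
    then show ?thesis using \<open>0 < \<delta>\<close> by (intro exI[of _ "min e (\<delta> / 2)"]) auto
  qed (use \<open>0 < \<delta>\<close> in \<open>auto intro!: exI[of _ "\<delta> / 2"]\<close>)
  then have "\<exists>e. \<forall>x. e x > 0 \<and> e x \<le> \<delta> / 2 \<and> (x \<in> U \<longrightarrow> ball x (e x) \<subseteq> U)"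
    by (intro choice allI)
  then obtain e where e0: "\<forall>x. e x > 0 \<and> e x \<le> \<delta> / 2 \<and> (x \<in> U \<longrightarrow> ball x (e x) \<subseteq> U)" ..
  have e: "e x > 0" "e x \<le> \<delta> / 2" "x \<in> U \<Longrightarrow> ball x (e x) \<subseteq> U" for x
    using e0[rule_format, of x] by simp_all
  have 1: "S \<subseteq> cbox (- (r *\<^sub>R One)) (r *\<^sub>R One)"
  proof
    fix x assume "x \<in> S"
    then have "\<bar>x \<bullet> i\<bar> \<le> r" if "i \<in> Basis" for i
      using r(2) Basis_le_norm[OF that, of x] by (meson order_trans)
    then show "x \<in> cbox (- (r *\<^sub>R One)) (r *\<^sub>R One)"
      by (simp add: mem_box abs_le_iff minus_le_iff)
  qed
  have 2: "box (- (r *\<^sub>R One)) (r *\<^sub>R One :: 'a) \<noteq> {}" using r by (auto simp: box_ne_empty)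
  have 3: "gauge (\<lambda>x. ball x (e x))" using e(1) by (auto simp: gauge_def)
  obtain \<D> where D: "countable \<D>"
    "\<And>K. K \<in> \<D> \<Longrightarrow> interior K \<noteq> {} \<and> (\<exists>c d. K = cbox c d)"
    "pairwise (\<lambda>A B. interior A \<inter> interior B = {}) \<D>"
    "\<And>K. K \<in> \<D> \<Longrightarrow> \<exists>x \<in> S \<inter> K. K \<subseteq> ball x (e x)"
    "\<And>u v. cbox u v \<in> \<D> \<Longrightarrow> \<exists>n. \<forall>i \<in> Basis. v \<bullet> i - u \<bullet> i = ((r *\<^sub>R One :: 'a) \<bullet> i - (- (r *\<^sub>R One)) \<bullet> i) / 2^n"
    "S \<subseteq> \<Union>\<D>"
    by (rule covering_lemma[OF 1 2 3]) blast
  obtain l u where lu: "\<And>K. K \<in> \<D> \<Longrightarrow> K = cbox (l K) (u K)" using D(2) by metis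
  have cube: "dist (l K) (u K) \<le> \<delta> \<and> cbox (l K) (u K) \<noteq> {} \<and> interior K \<subseteq> U
      \<and> ennreal (dist (l K) (u K) ^ ?n) \<le> ennreal (real ?n ^ ?n) * emeasure lborel (interior K)"
    if K: "K \<in> \<D>" for K
  proof -
    define p q where "p = l K" and "q = u K"
    have Keq: "K = cbox p q" using lu[OF K] by (simp only: p_def q_def)
    have Kne: "cbox p q \<noteq> {}" using D(2)[OF K] unfolding Keq using interior_empty by fastforce
    then have le: "\<And>i. i \<in> Basis \<Longrightarrow> p \<bullet> i \<le> q \<bullet> i" by (simp add: box_ne_empty)
    obtain x where x: "x \<in> S" "K \<subseteq> ball x (e x)" using D(4)[OF K] by blast
    have "p \<in> K" "q \<in> K" using le unfolding Keq by (simp_all add: mem_box)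
    then have "dist p x < e x" "dist q x < e x" using x by (auto simp: dist_commute)
    then have dd: "dist p q \<le> \<delta>"
      using e(2)[of x] dist_triangle_half_l[of "p" x "2 * e x" "q"] by auto
    obtain k where k: "\<And>i. i \<in> Basis \<Longrightarrow> q \<bullet> i - p \<bullet> i = 2 * r / 2 ^ k"
      using D(5)[of "p" "q"] K Keq by auto
    define s where "s = 2 * r / 2 ^ k"
    have s: "s \<ge> 0" using r by (simp add: s_def)
    have "dist p q = norm (q - p)" by (simp add: dist_norm norm_minus_commute)
    also have "\<dots> \<le> (\<Sum>i\<in>Basis. \<bar>(q - p) \<bullet> i\<bar>)" by (rule norm_le_l1)
    also have "\<dots> = (\<Sum>i\<in>(Basis::'a set). s)"
      using k s r by (intro sum.cong) (auto simp: inner_diff_left s_def)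
    finally have dist: "dist p q \<le> real ?n * s" by simp
    have "emeasure lborel (interior K) = ennreal (\<Prod>i\<in>Basis. (q - p) \<bullet> i)"
      using le by (subst Keq) (simp add: emeasure_lborel_box)
    also have "(\<Prod>i\<in>Basis. (q - p) \<bullet> i) = (\<Prod>i\<in>(Basis::'a set). s)"
      using k by (intro prod.cong) (auto simp: inner_diff_left s_def)
    finally have em: "emeasure lborel (interior K) = ennreal (s ^ ?n)" by simp
    have "dist p q ^ ?n \<le> (real ?n * s) ^ ?n" using dist by (intro power_mono) auto
    then have "ennreal (dist p q ^ ?n) \<le> ennreal (real ?n ^ ?n) * emeasure lborel (interior K)"
      unfolding em using s by (simp add: ennreal_mult'[symmetric] power_mult_distrib ennreal_leI)
    moreover have "interior K \<subseteq> U" using x e(3)[of x] \<open>S \<subseteq> U\<close> interior_subset[of K] by blast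
    ultimately show ?thesis using dd Kne unfolding p_def q_def by blast
  qed
  define J where "J = to_nat_on \<D> ` \<D>"
  define K where "K i = from_nat_into \<D> i" for i
  have KD: "K i \<in> \<D>" if "i \<in> J" for i using that D(1) by (auto simp: J_def K_def)
  define a where "a i = (if i \<in> J then l (K i) else 0)" for i
  define b where "b i = (if i \<in> J then u (K i) else 0)" for i
  define I where "I i = (if i \<in> J then interior (K i) else {})" for i
  show thesis
  proof
    show "S \<subseteq> (\<Union>i. cbox (a i) (b i))"
    proof
      fix x assume "x \<in> S"
      then obtain C where C: "C \<in> \<D>" "x \<in> C" using D(6) by auto
      then have "to_nat_on \<D> C \<in> J" "K (to_nat_on \<D> C) = C" using D(1) by (auto simp: J_def K_def)
      then have "x \<in> cbox (a (to_nat_on \<D> C)) (b (to_nat_on \<D> C))"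
        using lu[OF C(1)] C(2) by (simp add: a_def b_def)
      then show "x \<in> (\<Union>i. cbox (a i) (b i))" by blast
    qed
    show "dist (a i) (b i) \<le> \<delta>" for i
      using cube[OF KD, of i] \<open>0 < \<delta>\<close> by (cases "i \<in> J") (simp_all add: a_def b_def)
    show "cbox (a i) (b i) \<noteq> {}" for i
      using cube[OF KD, of i] by (cases "i \<in> J") (simp_all add: a_def b_def)
    have IU: "I i \<subseteq> U" for i
      using cube[OF KD, of i] by (cases "i \<in> J") (simp_all add: I_def)
    have Iop: "open (I i)" for i by (simp add: I_def)
    have disj: "disjoint_family I"
      unfolding disjoint_family_on_def
    proof (intro ballI impI)
      fix i j :: nat assume "i \<noteq> j"
      show "I i \<inter> I j = {}"
      proof (cases "i \<in> J \<and> j \<in> J")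
        case True
        then have "K i \<noteq> K j"
          using \<open>i \<noteq> j\<close> D(1) by (auto simp: J_def K_def)
        then show ?thesis using D(3) KD True by (auto simp: I_def pairwise_def)
      qed (auto simp: I_def)
    qed
    have "(\<Sum>i. ennreal (dist (a i) (b i) ^ ?n)) \<le> (\<Sum>i. ennreal (real ?n ^ ?n) * emeasure lborel (I i))"
    proof (intro suminf_le)
      fix i show "ennreal (dist (a i) (b i) ^ ?n) \<le> ennreal (real ?n ^ ?n) * emeasure lborel (I i)"
        using cube[OF KD, of i] by (cases "i \<in> J") (simp_all add: a_def b_def I_def)
    qed auto
    also have "\<dots> = ennreal (real ?n ^ ?n) * emeasure lborel (\<Union>i. I i)"
      using suminf_emeasure[of I lborel] disj Iop by (simp add: image_subset_iff)
    also have "\<dots> \<le> ennreal (real ?n ^ ?n) * emeasure lborel U"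
    proof (intro mult_left_mono emeasure_mono)
      show "(\<Union>i. I i) \<subseteq> U" using IU by (rule UN_least)
      show "U \<in> sets lborel" using \<open>open U\<close> by simp
    qed simp
    finally show "(\<Sum>i. ennreal (dist (a i) (b i) ^ ?n)) \<le> ennreal (real ?n ^ ?n) * emeasure lborel U" .
  qed
qed

text \<open>
  Cover the truncated cone over \<open>A\<close> by small cubes. For \<open>1/2 \<le> t \<le> 1\<close> the cubes that meet the
  sphere of radius \<open>t\<close>, rescaled by \<open>1/t\<close>, cover \<open>A\<close>. Integrating the resulting Hausdorff sums over
  \<open>t\<close> supplies each cube with an additional factor proportional to its diameter, because it meets
  spheres only for an interval of radii of that length; the sums turn into
  a multiple of the total volume of the cubes.
\<close>

lemma hausdorff_outer_le_lborel:
  fixes A :: "'a::euclidean_space set"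
  assumes A: "A \<subseteq> sphere 0 1"
    and U: "open U" "\<And>t x. x \<in> A \<Longrightarrow> 1/2 \<le> t \<Longrightarrow> t \<le> 1 \<Longrightarrow> t *\<^sub>R x \<in> U"
  shows "hausdorff_outer (DIM('a) - 1) A \<le> ennreal (4 * unit_ball_vol (real (DIM('a) - 1)) * real DIM('a) ^ DIM('a)) * emeasure lborel U"
  unfolding hausdorff_outer_def
proof (rule SUP_least)
  fix \<delta> :: real assume "\<delta> \<in> {0<..}"
  then have \<delta>: "\<delta> > 0" by simp
  let ?n = "DIM('a)" let ?m = "DIM('a) - 1"
  define k where "k = unit_ball_vol (real ?m)"
  have k: "k \<ge> 0" by (simp add: k_def)
  define S where "S = {t *\<^sub>R x | t x. x \<in> A \<and> 1/2 \<le> t \<and> t \<le> 1}"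
  have bS: "bounded S" unfolding bounded_iff using A by (intro exI[of _ 1]) (force simp: S_def)
  have SU: "S \<subseteq> U" using U(2) by (auto simp: S_def)
  have \<delta>2: "0 < \<delta> / 2" using \<delta> by simp
  obtain a b where ab: "S \<subseteq> (\<Union>i. cbox (a i) (b i))"
    "\<And>i. dist (a i) (b i) \<le> \<delta> / 2" "\<And>i. cbox (a i) (b i) \<noteq> {}"
    "(\<Sum>i. ennreal (dist (a i) (b i) ^ ?n)) \<le> ennreal (real ?n ^ ?n) * emeasure lborel U"
    by (rule small_cubes_in_open_set[OF \<open>open U\<close> bS SU \<delta>2]) blast
  define d where "d i = dist (a i) (b i)" for i
  have d: "d i \<ge> 0" for i by (simp add: d_def)
  have diam: "dist x y \<le> d i" if "x \<in> cbox (a i) (b i)" "y \<in> cbox (a i) (b i)" for i x y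
    using diameter_bounded_bound[OF bounded_cbox that] ab(3)[of i] diameter_cbox[of "a i" "b i"]
    by (simp add: box_ne_empty d_def)
  have aa: "a i \<in> cbox (a i) (b i)" for i using ab(3)[of i] by (simp add: box_ne_empty mem_box)
  define I where "I i = {norm (a i) - d i .. norm (a i) + d i}" for i
  define F where "F t = (\<Sum>i. ennreal (k * d i ^ ?m) * indicator (I i) t)" for t
  have pre: "hausdorff_pre ?m \<delta> A \<le> F t" if t: "t \<in> {1/2..1}" for t
  proof -
    define C where "C i = (if t \<in> I i then (\<lambda>x. (1/t) *\<^sub>R x) ` cbox (a i) (b i) else {})" for i
    have dC: "diameter (C i) \<le> 2 * d i" for i
    proof (rule diameter_le)
      fix x y assume "x \<in> C i" "y \<in> C i"
      then obtain x' y' where xy: "x = (1/t) *\<^sub>R x'" "y = (1/t) *\<^sub>R y'" "x' \<in> cbox (a i) (b i)" "y' \<in> cbox (a i) (b i)"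
        by (auto simp: C_def split: if_splits)
      have "norm (x - y) = (1/t) * dist x' y'"
        using t by (simp add: xy dist_norm scaleR_diff_right[symmetric])
      also have "\<dots> \<le> 2 * d i"
        using t diam[OF xy(3,4)] d[of i] by (intro mult_mono) (auto simp: field_simps)
      finally show "norm (x - y) \<le> 2 * d i" .
    qed (use d in auto)
    have "hausdorff_pre ?m \<delta> A \<le> (\<Sum>i. hausdorff_gauge ?m (C i))"
      unfolding hausdorff_pre_def
    proof (rule INF_lower, safe)
      fix x assume x: "x \<in> A"
      then have "t *\<^sub>R x \<in> S" using t by (auto simp: S_def)
      then obtain i where i: "t *\<^sub>R x \<in> cbox (a i) (b i)" using ab(1) by auto
      have "norm (t *\<^sub>R x) = t" using x A t by auto
      then have "\<bar>t - norm (a i)\<bar> \<le> d i"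
        using diam[OF i aa] norm_triangle_ineq3[of "t *\<^sub>R x" "a i"] by (simp add: dist_norm)
      then have "t \<in> I i" by (auto simp: I_def)
      moreover have "x = (1/t) *\<^sub>R (t *\<^sub>R x)" using t by simp
      ultimately have "x \<in> C i" unfolding C_def using i by (metis image_eqI)
      then show "x \<in> (\<Union>i. C i)" by blast
    next
      fix i show "bounded (C i)" by (auto simp: C_def intro: bounded_scaling)
      show "diameter (C i) \<le> \<delta>" using dC[of i] ab(2)[of i] by (simp add: d_def)
    qed
    also have "\<dots> \<le> F t"
      unfolding F_def
    proof (intro suminf_le)
      fix i
      have "0 \<le> diameter (C i)" by (rule diameter_ge_0) (auto simp: C_def intro: bounded_scaling)
      then have "(diameter (C i) / 2) ^ ?m \<le> d i ^ ?m" using dC[of i] by (intro power_mono) auto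
      then show "hausdorff_gauge ?m (C i) \<le> ennreal (k * d i ^ ?m) * indicator (I i) t"
        unfolding hausdorff_gauge_def k_def[symmetric] using k
        by (cases "t \<in> I i") (auto simp: C_def intro!: ennreal_leI mult_left_mono)
    qed auto
    finally show ?thesis .
  qed
  have "hausdorff_pre ?m \<delta> A * ennreal (1/2) = (\<integral>\<^sup>+t. hausdorff_pre ?m \<delta> A * indicator {1/2..1::real} t \<partial>lborel)"
    by (subst nn_integral_cmult_indicator) auto
  also have "\<dots> \<le> (\<integral>\<^sup>+t. F t \<partial>lborel)"
    using pre by (intro nn_integral_mono) (auto split: split_indicator)
  also have "\<dots> = (\<Sum>i. \<integral>\<^sup>+t. ennreal (k * d i ^ ?m) * indicator (I i) t \<partial>lborel)"
    unfolding F_def by (rule nn_integral_suminf) (auto simp: I_def)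
  also have "\<dots> = (\<Sum>i. ennreal (2 * k) * ennreal (d i ^ ?n))"
  proof (intro suminf_cong)
    fix i
    have "d i ^ ?n = d i * d i ^ ?m" using power_Suc[of "d i" ?m] by simp
    then show "(\<integral>\<^sup>+t. ennreal (k * d i ^ ?m) * indicator (I i) t \<partial>lborel) = ennreal (2 * k) * ennreal (d i ^ ?n)"
      using d[of i] k by (subst nn_integral_cmult_indicator) (auto simp: I_def ennreal_mult'[symmetric] algebra_simps)
  qed
  also have "\<dots> = ennreal (2 * k) * (\<Sum>i. ennreal (d i ^ ?n))" by simp
  also have "\<dots> \<le> ennreal (2 * k) * (ennreal (real ?n ^ ?n) * emeasure lborel U)"
    using ab(4) by (intro mult_left_mono) (auto simp: d_def)
  also have "\<dots> = ennreal (2 * k * real ?n ^ ?n) * emeasure lborel U"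
    using k by (simp add: ennreal_mult' mult.assoc)
  finally have "hausdorff_pre ?m \<delta> A * ennreal (1/2) \<le> ennreal (2 * k * real ?n ^ ?n) * emeasure lborel U" .
  then have "ennreal 2 * (hausdorff_pre ?m \<delta> A * ennreal (1/2)) \<le> ennreal 2 * (ennreal (2 * k * real ?n ^ ?n) * emeasure lborel U)"
    by (intro mult_left_mono) auto
  also have "ennreal 2 * (hausdorff_pre ?m \<delta> A * ennreal (1/2)) = (ennreal 2 * ennreal (1/2)) * hausdorff_pre ?m \<delta> A"
    by (simp only: ac_simps)
  also have "ennreal 2 * ennreal (1/2) = 1" by (subst ennreal_mult'[symmetric]) auto
  also have "ennreal 2 * (ennreal (2 * k * real ?n ^ ?n) * emeasure lborel U) = ennreal (4 * k * real ?n ^ ?n) * emeasure lborel U"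
    using k by (subst mult.assoc[symmetric], subst ennreal_mult'[symmetric]) (auto simp: mult.assoc)
  finally show "hausdorff_pre ?m \<delta> A \<le> ennreal (4 * unit_ball_vol (real ?m) * real ?n ^ ?n) * emeasure lborel U"
    unfolding k_def mult_1 .
qed

lemma hausdorff_sphere_finite:
  "hausdorff_outer (DIM('a) - 1) (sphere 0 1 :: 'a::euclidean_space set) < \<infinity>"
proof -
  have "hausdorff_outer (DIM('a) - 1) (sphere 0 1 :: 'a set)
     \<le> ennreal (4 * unit_ball_vol (real (DIM('a) - 1)) * real DIM('a) ^ DIM('a)) * emeasure lborel (ball 0 2 :: 'a set)"
    by (rule hausdorff_outer_le_lborel) simp_all
  also have "\<dots> < \<infinity>"
    using emeasure_lborel_ball_finite[of "0::'a" 2] by (simp only: ennreal_mult_less_top infinity_ennreal_def) simp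
  finally show ?thesis .
qed

text \<open>
  For a set that is Lebesgue null, outer regularity provides open neighbourhoods of small
  volume, to which the comparison with volume applies.
\<close>

lemma hausdorff_null_of_cone_null:
  fixes A N :: "'a::euclidean_space set"
  assumes A: "A \<subseteq> sphere 0 1" and N: "negligible N"
    and cone: "\<And>t x. x \<in> A \<Longrightarrow> 0 < t \<Longrightarrow> t *\<^sub>R x \<in> N"
  shows "hausdorff_outer (DIM('a) - 1) A = 0"
proof -
  define c where "c = 4 * unit_ball_vol (real (DIM('a) - 1)) * real DIM('a) ^ DIM('a)"
  have c: "c > 0" by (simp add: c_def)
  have "hausdorff_outer (DIM('a) - 1) A \<le> 0"
  proof (rule ennreal_le_epsilon)
    fix e :: real assume "0 < e"
    have N0: "N \<in> null_sets lebesgue" using N by (simp add: negligible_iff_null_sets)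
    have "N \<in> sets lebesgue" "0 < e / c" using N0 c \<open>0 < e\<close> by auto
    then obtain T where T: "open T" "N \<subseteq> T" "emeasure lebesgue (T - N) < ennreal (e / c)"
      by (rule sets_lebesgue_outer_open)
    have "emeasure lborel T = emeasure lebesgue T" using T(1) by simp
    also have "\<dots> = emeasure lebesgue (T - N)"
      using N0 T(1) by (subst emeasure_Diff_null_set) auto
    finally have TT: "emeasure lborel T \<le> ennreal (e / c)" using T(3) by simp
    have "hausdorff_outer (DIM('a) - 1) A \<le> ennreal c * emeasure lborel T"
      unfolding c_def
    proof (rule hausdorff_outer_le_lborel[OF A T(1)])
      fix t :: real and x assume "x \<in> A" "1/2 \<le> t"
      then have "t *\<^sub>R x \<in> N" by (intro cone) auto
      then show "t *\<^sub>R x \<in> T" using T(2) by blast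
    qed
    also have "\<dots> \<le> ennreal c * ennreal (e / c)" by (intro mult_left_mono TT) auto
    also have "\<dots> = ennreal e" using c \<open>0 < e\<close> by (simp add: ennreal_mult'[symmetric])
    finally show "hausdorff_outer (DIM('a) - 1) A \<le> 0 + ennreal e" by simp
  qed
  then show ?thesis by simp
qed

text \<open>
  The cone over a set of diameter less than \<open>d\<close> stays within distance \<open>d\<close> of a segment of length 1,
  which about \<open>1/d\<close> balls of radius \<open>2 * d\<close> cover.
\<close>

lemma cone_over_small_set:
  fixes C :: "'a::euclidean_space set"
  assumes C: "bounded C" "diameter C < d" "0 < d" "d \<le> 1"
  obtains Z where "Z \<in> sets lborel"
    "\<And>t x. x \<in> C \<inter> sphere 0 1 \<Longrightarrow> 0 \<le> t \<Longrightarrow> t \<le> 1 \<Longrightarrow> t *\<^sub>R x \<in> Z"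
    "emeasure lborel Z \<le> ennreal (2 ^ (DIM('a) + 1) * unit_ball_vol (real DIM('a)) * d ^ (DIM('a) - 1))"
proof (cases "C \<inter> sphere 0 1 = {}")
  case True
  then show ?thesis by (intro that[of "{}"]) auto
next
  case False
  then obtain u where u: "u \<in> C" "norm u = 1" by auto
  define I where "I = {k::nat. real k \<le> 1 / d}"
  have I: "I = {.. nat \<lfloor>1 / d\<rfloor>}" using \<open>0 < d\<close> by (auto simp: I_def le_nat_floor) (simp add: nat_le_iff le_floor_iff of_nat_nat le_nat_iff)
  have "real (card I) \<le> 1 / d + 1" unfolding I using \<open>0 < d\<close> by simp
  also have "\<dots> \<le> 2 / d" using \<open>d \<le> 1\<close> \<open>0 < d\<close> by (simp add: field_simps)
  finally have cI: "real (card I) \<le> 2 / d" .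
  define Z where "Z = (\<Union>k\<in>I. cball ((real k * d) *\<^sub>R u) (2 * d))"
  show ?thesis
  proof (rule that[of Z])
    show "Z \<in> sets lborel" unfolding Z_def I by auto
  next
    fix t :: real and x assume x: "x \<in> C \<inter> sphere 0 1" and t: "0 \<le> t" "t \<le> 1"
    define k where "k = nat \<lfloor>t / d\<rfloor>"
    have k: "real k \<le> t / d" "t / d < real k + 1"
    proof -
      have "real k = of_int \<lfloor>t / d\<rfloor>" using t \<open>0 < d\<close> by (simp add: k_def)
      then show "real k \<le> t / d" "t / d < real k + 1" by linarith+
    qed
    have "t / d \<le> 1 / d" using t \<open>0 < d\<close> by (simp add: divide_right_mono)
    then have "k \<in> I" using k by (auto simp: I_def)
    have kt: "\<bar>t - real k * d\<bar> \<le> d" using k \<open>0 < d\<close> by (simp add: field_simps abs_le_iff)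
    have "t *\<^sub>R x - (real k * d) *\<^sub>R u = t *\<^sub>R (x - u) + (t - real k * d) *\<^sub>R u"
      by (simp add: algebra_simps)
    then have "norm (t *\<^sub>R x - (real k * d) *\<^sub>R u) \<le> t * norm (x - u) + \<bar>t - real k * d\<bar> * norm u"
      using t by (metis abs_of_nonneg norm_scaleR norm_triangle_ineq)
    also have "\<dots> \<le> 1 * d + d * 1"
    proof (intro add_mono mult_mono)
      show "norm (x - u) \<le> d"
        using diameter_bounded_bound[OF C(1), of x u] x u C(2) by (auto simp: dist_norm)
    qed (use t u kt \<open>0 < d\<close> in auto)
    finally have "t *\<^sub>R x \<in> cball ((real k * d) *\<^sub>R u) (2 * d)" by (simp add: dist_norm norm_minus_commute)
    then show "t *\<^sub>R x \<in> Z" using \<open>k \<in> I\<close> by (auto simp: Z_def)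
  next
    let ?n = "DIM('a)"
    have "emeasure lborel Z \<le> (\<Sum>k\<in>I. emeasure lborel (cball ((real k * d) *\<^sub>R u) (2 * d)))"
      unfolding Z_def I by (intro emeasure_subadditive_finite) auto
    also have "\<dots> = ennreal (real (card I) * (unit_ball_vol (real ?n) * (2 * d) ^ ?n))"
      using \<open>0 < d\<close> by (subst emeasure_cball) (auto simp: ennreal_mult' ennreal_of_nat_eq_real_of_nat)
    also have "\<dots> \<le> ennreal ((2 / d) * (unit_ball_vol (real ?n) * (2 * d) ^ ?n))"
      using cI \<open>0 < d\<close> by (intro ennreal_leI mult_right_mono) auto
    also have "(2 / d) * (unit_ball_vol (real ?n) * (2 * d) ^ ?n) = 2 ^ (?n + 1) * unit_ball_vol (real ?n) * d ^ (?n - 1)"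
    proof -
      have "d ^ ?n = d * d ^ (?n - 1)" using power_Suc[of d "?n - 1"] by simp
      then show ?thesis using \<open>0 < d\<close> by (simp add: power_mult_distrib field_simps)
    qed
    finally show "emeasure lborel Z \<le> ennreal (2 ^ (?n + 1) * unit_ball_vol (real ?n) * d ^ (?n - 1))" .
  qed
qed

text \<open>
  The cone over the cap contains a ball \<open>W\<close>. Given any cover of the cap, the cones over the covering
  sets cover \<open>W\<close>, and their volumes are bounded by the terms of the Hausdorff sum; so that sum is at
  least a constant times the volume of \<open>W\<close>.
\<close>

lemma hausdorff_cap_pos:
  fixes v :: "'a::euclidean_space"
  assumes v: "norm v = 1" and r: "r > 0"
  shows "0 < hausdorff_outer (DIM('a) - 1) (sphere 0 1 \<inter> ball v r)"
proof -
  let ?n = "DIM('a)" let ?m = "DIM('a) - 1"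
  let ?A = "sphere 0 1 \<inter> ball v r :: 'a set"
  define c where "c = 2 ^ (?n + 1) * unit_ball_vol (real ?n)"
  define k where "k = unit_ball_vol (real ?m)"
  have c: "c > 0" and k: "k > 0" by (auto simp: c_def k_def)
  define s where "s = min (1/4) (r / 8)"
  have s: "s > 0" "s \<le> 1/4" "s \<le> r / 8" using r by (auto simp: s_def)
  define W where "W = ball ((3/4) *\<^sub>R v) s"
  have W: "\<exists>t x. x \<in> ?A \<and> 0 \<le> t \<and> t \<le> 1 \<and> y = t *\<^sub>R x" if y: "y \<in> W" for y
  proof -
    define t where "t = norm y"
    have d: "norm (y - (3/4) *\<^sub>R v) < s" using y by (simp add: W_def dist_norm norm_minus_commute)
    have t34: "\<bar>t - 3/4\<bar> \<le> s"
      using norm_triangle_ineq3[of y "(3/4) *\<^sub>R v"] d v by (simp add: t_def)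
    then have t: "1/2 \<le> t" "t \<le> 1" using s by auto
    have "t *\<^sub>R ((1/t) *\<^sub>R y - v) = (y - (3/4) *\<^sub>R v) + (3/4 - t) *\<^sub>R v" using t by (simp add: algebra_simps)
    then have "t * norm ((1/t) *\<^sub>R y - v) \<le> norm (y - (3/4) *\<^sub>R v) + \<bar>3/4 - t\<bar> * norm v"
      using t by (metis abs_of_nonneg norm_scaleR norm_triangle_ineq order_trans[of 0 "1/2" t] zero_le_divide_1_iff zero_le_numeral)
    also have "\<dots> < 2 * s" using d t34 v by simp
    finally have "t * norm ((1/t) *\<^sub>R y - v) < 2 * s" .
    moreover have "1/2 * norm ((1/t) *\<^sub>R y - v) \<le> t * norm ((1/t) *\<^sub>R y - v)" using t by (intro mult_right_mono) auto
    ultimately have "norm ((1/t) *\<^sub>R y - v) < r" using s r by simp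
    moreover have "norm ((1/t) *\<^sub>R y) = 1" using t by (auto simp: t_def)
    ultimately show ?thesis using t
      by (intro exI[of _ t] exI[of _ "(1/t) *\<^sub>R y"]) (auto simp: dist_norm norm_minus_commute)
  qed
  have main: "emeasure lborel W \<le> ennreal (c * 2 ^ ?m / k) * (\<Sum>i. hausdorff_gauge ?m (C i))"
    if cov: "?A \<subseteq> (\<Union>i. C i)" and C: "\<And>i. bounded (C i)" "\<And>i. diameter (C i) \<le> 1/2" for C :: "nat \<Rightarrow> 'a set"
  proof (rule ennreal_le_epsilon)
    fix e :: real assume e: "e > 0"
    \<comment> \<open>enlarging the diameters slightly makes them positive, also for singletons\<close>
    have "\<exists>d. diameter (C i) < d \<and> 0 < d \<and> d \<le> 1 \<and> c * d ^ ?m \<le> c * diameter (C i) ^ ?m + e * (1/2) ^ Suc i" for i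
    proof -
      have "continuous_on UNIV (\<lambda>d. c * d ^ ?m)" by (intro continuous_intros)
      then have "((\<lambda>d. c * d ^ ?m) \<longlongrightarrow> c * diameter (C i) ^ ?m) (at_right (diameter (C i)))"
        by (auto intro!: tendsto_eq_intros)
      then have "eventually (\<lambda>d. c * d ^ ?m < c * diameter (C i) ^ ?m + e * (1/2) ^ Suc i) (at_right (diameter (C i)))"
        using e by (intro order_tendstoD) auto
      moreover have "eventually (\<lambda>d. d < 1 \<and> d > diameter (C i)) (at_right (diameter (C i)))"
        using C(2)[of i] by (auto intro!: eventually_conj order_tendstoD(2) tendsto_ident_at simp: eventually_at_right_less)
      ultimately have "eventually (\<lambda>d. d < 1 \<and> d > diameter (C i) \<and> c * d ^ ?m < c * diameter (C i) ^ ?m + e * (1/2) ^ Suc i) (at_right (diameter (C i)))"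
        by eventually_elim auto
      then obtain d where "d < 1 \<and> d > diameter (C i) \<and> c * d ^ ?m < c * diameter (C i) ^ ?m + e * (1/2) ^ Suc i"
        using eventually_happens' trivial_limit_at_right_real by blast
      moreover have "diameter (C i) \<ge> 0" using C by (intro diameter_ge_0)
      ultimately show ?thesis by (intro exI[of _ d]) auto
    qed
    then have "\<exists>d. \<forall>i. diameter (C i) < d i \<and> 0 < d i \<and> d i \<le> 1 \<and> c * d i ^ ?m \<le> c * diameter (C i) ^ ?m + e * (1/2) ^ Suc i"
      by (intro choice allI)
    then obtain d where d0: "\<forall>i. diameter (C i) < d i \<and> 0 < d i \<and> d i \<le> 1 \<and> c * d i ^ ?m \<le> c * diameter (C i) ^ ?m + e * (1/2) ^ Suc i" ..
    have d: "diameter (C i) < d i" "0 < d i" "d i \<le> 1"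
       "c * d i ^ ?m \<le> c * diameter (C i) ^ ?m + e * (1/2) ^ Suc i" for i
      using d0[rule_format, of i] by simp_all
    have "\<exists>Z. Z \<in> sets lborel \<and> (\<forall>t x. x \<in> C i \<inter> sphere 0 1 \<longrightarrow> 0 \<le> t \<longrightarrow> t \<le> 1 \<longrightarrow> t *\<^sub>R x \<in> Z) \<and>
      emeasure lborel Z \<le> (if C i = {} then 0 else ennreal (c * d i ^ ?m))" for i
    proof (cases "C i = {}")
      case True
      then show ?thesis by (intro exI[of _ "{}"]) auto
    next
      case False
      obtain Z where "Z \<in> sets lborel"
        "\<And>t x. x \<in> C i \<inter> sphere 0 1 \<Longrightarrow> 0 \<le> t \<Longrightarrow> t \<le> 1 \<Longrightarrow> t *\<^sub>R x \<in> Z"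
        "emeasure lborel Z \<le> ennreal (2 ^ (?n + 1) * unit_ball_vol (real ?n) * d i ^ ?m)"
        by (rule cone_over_small_set[OF C(1) d(1-3), of i]) blast
      then show ?thesis
        unfolding c_def using False by (intro exI[of _ Z]) auto
    qed
    then have "\<exists>Z. \<forall>i. Z i \<in> sets lborel \<and> (\<forall>t x. x \<in> C i \<inter> sphere 0 1 \<longrightarrow> 0 \<le> t \<longrightarrow> t \<le> 1 \<longrightarrow> t *\<^sub>R x \<in> Z i) \<and>
      emeasure lborel (Z i) \<le> (if C i = {} then 0 else ennreal (c * d i ^ ?m))"
      by (intro choice allI)
    then obtain Z where Z0: "\<forall>i. Z i \<in> sets lborel \<and> (\<forall>t x. x \<in> C i \<inter> sphere 0 1 \<longrightarrow> 0 \<le> t \<longrightarrow> t \<le> 1 \<longrightarrow> t *\<^sub>R x \<in> Z i) \<and>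
      emeasure lborel (Z i) \<le> (if C i = {} then 0 else ennreal (c * d i ^ ?m))" ..
    have Z: "Z i \<in> sets lborel"
       "x \<in> C i \<inter> sphere 0 1 \<Longrightarrow> 0 \<le> t \<Longrightarrow> t \<le> 1 \<Longrightarrow> t *\<^sub>R x \<in> Z i"
       "emeasure lborel (Z i) \<le> (if C i = {} then 0 else ennreal (c * d i ^ ?m))" for i t x
      using Z0[rule_format, of i] by blast+
    have Ci: "c * diameter (C i) ^ ?m \<ge> 0" for i using c C diameter_ge_0[of "C i"] by auto
    have "W \<subseteq> (\<Union>i. Z i)"
    proof
      fix y assume "y \<in> W"
      then obtain t x where tx: "x \<in> ?A" "0 \<le> t" "t \<le> 1" "y = t *\<^sub>R x" using W by blast
      then obtain i where "x \<in> C i" using cov by auto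
      then show "y \<in> (\<Union>i. Z i)" using Z(2)[of x i t] tx by auto
    qed
    then have "emeasure lborel W \<le> emeasure lborel (\<Union>i. Z i)" using Z(1) by (intro emeasure_mono) auto
    also have "\<dots> \<le> (\<Sum>i. emeasure lborel (Z i))" using Z(1) by (intro emeasure_subadditive_countably) auto
    also have "\<dots> \<le> (\<Sum>i. ennreal (c * 2 ^ ?m / k) * hausdorff_gauge ?m (C i) + ennreal (e * (1/2) ^ Suc i))"
    proof (intro suminf_le)
      fix i
      show "emeasure lborel (Z i) \<le> ennreal (c * 2 ^ ?m / k) * hausdorff_gauge ?m (C i) + ennreal (e * (1/2) ^ Suc i)"
      proof (cases "C i = {}")
        case True
        then show ?thesis using Z(3)[of i] by auto
      next
        case False
        have "emeasure lborel (Z i) \<le> ennreal (c * diameter (C i) ^ ?m + e * (1/2) ^ Suc i)"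
          using Z(3)[of i] d(4)[of i] False by (auto intro: order_trans ennreal_leI)
        also have "\<dots> = ennreal (c * diameter (C i) ^ ?m) + ennreal (e * (1/2) ^ Suc i)"
          using Ci e by (intro ennreal_plus) auto
        also have "ennreal (c * diameter (C i) ^ ?m) = ennreal (c * 2 ^ ?m / k) * hausdorff_gauge ?m (C i)"
          using False k c unfolding hausdorff_gauge_def k_def[symmetric]
          by (simp add: ennreal_mult'[symmetric] power_divide)
        finally show ?thesis .
      qed
    qed auto
    also have "\<dots> = ennreal (c * 2 ^ ?m / k) * (\<Sum>i. hausdorff_gauge ?m (C i)) + (\<Sum>i. ennreal (e * (1/2) ^ Suc i))"
      by (subst suminf_add[symmetric]) auto
    also have "(\<Sum>i. ennreal (e * (1/2) ^ Suc i)) = ennreal e"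
      using sums_mult[OF power_half_series, of e] e by (subst suminf_ennreal_eq) auto
    finally show "emeasure lborel W \<le> ennreal (c * 2 ^ ?m / k) * (\<Sum>i. hausdorff_gauge ?m (C i)) + ennreal e" .
  qed
  have Wpos: "emeasure lborel W > 0"
    using s emeasure_ball[of s "(3/4) *\<^sub>R v"] by (simp add: W_def)
  have "0 < k / (c * 2 ^ ?m)" using c k by simp
  then have "0 < ennreal (k / (c * 2 ^ ?m)) * emeasure lborel W"
    using Wpos by (simp only: ennreal_zero_less_mult_iff ennreal_less_zero_iff)
  also have "ennreal (k / (c * 2 ^ ?m)) * emeasure lborel W \<le> hausdorff_pre ?m (1/2) ?A"
    unfolding hausdorff_pre_def
  proof (rule INF_greatest, safe)
    fix C :: "nat \<Rightarrow> 'a set"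
    assume "?A \<subseteq> \<Union> (range C)" "\<forall>i. bounded (C i) \<and> diameter (C i) \<le> 1/2"
    then have "emeasure lborel W \<le> ennreal (c * 2 ^ ?m / k) * (\<Sum>i. hausdorff_gauge ?m (C i))" using main by blast
    then have "ennreal (k / (c * 2 ^ ?m)) * emeasure lborel W \<le> ennreal (k / (c * 2 ^ ?m)) * (ennreal (c * 2 ^ ?m / k) * (\<Sum>i. hausdorff_gauge ?m (C i)))"
      by (intro mult_left_mono) auto
    also have "\<dots> = (\<Sum>i. hausdorff_gauge ?m (C i))"
      using c k by (subst mult.assoc[symmetric], subst ennreal_mult'[symmetric]) auto
    finally show "ennreal (k / (c * 2 ^ ?m)) * emeasure lborel W \<le> (\<Sum>i. hausdorff_gauge ?m (C i))" .
  qed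
  also have "\<dots> \<le> hausdorff_outer ?m ?A" unfolding hausdorff_outer_def by (rule SUP_upper) simp
  finally show ?thesis .
qed

section \<open>Almost every linear functional has a unique maximizer on a compact set\<close>

definition face :: "'a::euclidean_space set \<Rightarrow> 'a \<Rightarrow> 'a set" where
  "face P x = {p \<in> P. \<forall>q\<in>P. q \<bullet> x \<le> p \<bullet> x}"

lemma face_scaleR: "0 < t \<Longrightarrow> face P (t *\<^sub>R x) = face P x"
  by (simp add: face_def)

text \<open>
  Moving the functional in direction \<open>b\<close> can only push its maximizers in direction \<open>b\<close>.
\<close>

lemma face_monotone:
  assumes "p \<in> face P x" "q \<in> face P (x + s *\<^sub>R b)" "0 < s"
  shows "p \<bullet> b \<le> q \<bullet> b"
proof -
  have "q \<bullet> x \<le> p \<bullet> x" "p \<bullet> (x + s *\<^sub>R b) \<le> q \<bullet> (x + s *\<^sub>R b)"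
    using assms by (auto simp: face_def)
  then have "s * (p \<bullet> b) \<le> s * (q \<bullet> b)" by (simp add: inner_add_right)
  then show ?thesis using \<open>0 < s\<close> by simp
qed

lemma closed_wide_face:
  assumes P: "compact P"
  shows "closed {x. \<exists>p\<in>face P x. \<exists>q\<in>face P x. q \<bullet> b + c \<le> p \<bullet> b}"
  unfolding closed_sequential_limits
proof safe
  fix X and x assume X: "\<forall>n. X n \<in> {x. \<exists>p\<in>face P x. \<exists>q\<in>face P x. q \<bullet> b + c \<le> p \<bullet> b}" and lim: "X \<longlonglongrightarrow> x"
  then have "\<forall>n. \<exists>z. fst z \<in> face P (X n) \<and> snd z \<in> face P (X n) \<and> snd z \<bullet> b + c \<le> fst z \<bullet> b" by force
  then have "\<exists>Z. \<forall>n. fst (Z n) \<in> face P (X n) \<and> snd (Z n) \<in> face P (X n) \<and> snd (Z n) \<bullet> b + c \<le> fst (Z n) \<bullet> b"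
    by (rule choice)
  then obtain Z where Z: "\<forall>n. fst (Z n) \<in> face P (X n) \<and> snd (Z n) \<in> face P (X n) \<and> snd (Z n) \<bullet> b + c \<le> fst (Z n) \<bullet> b" ..
  have ZP: "Z n \<in> P \<times> P" for n using Z[rule_format, of n] by (auto simp: face_def mem_Times_iff)
  obtain z r where z: "z \<in> P \<times> P" "strict_mono r" "(Z \<circ> r) \<longlonglongrightarrow> z"
    using compact_Times[OF P P] ZP unfolding compact_def by metis
  have l1: "(\<lambda>n. fst (Z (r n))) \<longlonglongrightarrow> fst z" and l2: "(\<lambda>n. snd (Z (r n))) \<longlonglongrightarrow> snd z"
    using tendsto_fst[OF z(3)] tendsto_snd[OF z(3)] by (auto simp: o_def)
  have lX: "(\<lambda>n. X (r n)) \<longlonglongrightarrow> x" using LIMSEQ_subseq_LIMSEQ[OF lim z(2)] by (simp add: o_def)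
  have "fst z \<in> face P x"
    unfolding face_def
  proof (intro CollectI conjI ballI)
    fix q assume "q \<in> P"
    show "q \<bullet> x \<le> fst z \<bullet> x"
      by (rule LIMSEQ_le[OF tendsto_inner[OF tendsto_const lX] tendsto_inner[OF l1 lX]])
         (use Z \<open>q \<in> P\<close> in \<open>auto simp: face_def\<close>)
  qed (use z in auto)
  moreover have "snd z \<in> face P x"
    unfolding face_def
  proof (intro CollectI conjI ballI)
    fix q assume "q \<in> P"
    show "q \<bullet> x \<le> snd z \<bullet> x"
      by (rule LIMSEQ_le[OF tendsto_inner[OF tendsto_const lX] tendsto_inner[OF l2 lX]])
         (use Z \<open>q \<in> P\<close> in \<open>auto simp: face_def\<close>)
  qed (use z in auto)
  moreover have "snd z \<bullet> b + c \<le> fst z \<bullet> b"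
    by (rule LIMSEQ_le[OF tendsto_add[OF tendsto_inner[OF l2 tendsto_const] tendsto_const] tendsto_inner[OF l1 tendsto_const]])
       (use Z in auto)
  ultimately show "\<exists>p\<in>face P x. \<exists>q\<in>face P x. q \<bullet> b + c \<le> p \<bullet> b" by blast
qed

text \<open>
  By monotonicity the intervals between \<open>q \<bullet> b\<close> and \<open>p \<bullet> b\<close> that belong to different parameters do
  not overlap, and each of them contains a rational number.
\<close>

lemma countable_line_wide_face:
  assumes "0 < c"
  shows "countable {s::real. \<exists>p\<in>face P (x + s *\<^sub>R b). \<exists>q\<in>face P (x + s *\<^sub>R b). q \<bullet> b + c \<le> p \<bullet> b}"
    (is "countable ?T")
proof -
  have "\<forall>s\<in>?T. \<exists>w::rat. \<exists>p\<in>face P (x + s *\<^sub>R b). \<exists>q\<in>face P (x + s *\<^sub>R b). q \<bullet> b < of_rat w \<and> of_rat w < p \<bullet> b"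
  proof
    fix s assume "s \<in> ?T"
    then obtain p q where pq: "p \<in> face P (x + s *\<^sub>R b)" "q \<in> face P (x + s *\<^sub>R b)" "q \<bullet> b + c \<le> p \<bullet> b" by auto
    then have "q \<bullet> b < p \<bullet> b" using \<open>0 < c\<close> by simp
    then obtain w :: rat where "q \<bullet> b < of_rat w" "of_rat w < p \<bullet> b" using of_rat_dense by blast
    then show "\<exists>w::rat. \<exists>p\<in>face P (x + s *\<^sub>R b). \<exists>q\<in>face P (x + s *\<^sub>R b). q \<bullet> b < of_rat w \<and> of_rat w < p \<bullet> b"
      using pq by blast
  qed
  then obtain w :: "real \<Rightarrow> rat" where w: "\<forall>s\<in>?T. \<exists>p\<in>face P (x + s *\<^sub>R b). \<exists>q\<in>face P (x + s *\<^sub>R b). q \<bullet> b < of_rat (w s) \<and> of_rat (w s) < p \<bullet> b"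
    by (rule bchoice[THEN exE])
  have less: "w s < w s'" if s: "s \<in> ?T" and s': "s' \<in> ?T" and "s < s'" for s s'
  proof -
    obtain p where p: "p \<in> face P (x + s *\<^sub>R b)" "of_rat (w s) < p \<bullet> b" using w s by blast
    obtain q where q: "q \<in> face P (x + s' *\<^sub>R b)" "q \<bullet> b < of_rat (w s')" using w s' by blast
    have eq: "x + s' *\<^sub>R b = (x + s *\<^sub>R b) + (s' - s) *\<^sub>R b" by (simp add: algebra_simps)
    have "p \<bullet> b \<le> q \<bullet> b"
      by (rule face_monotone[OF p(1) q(1)[unfolded eq]]) (use \<open>s < s'\<close> in simp)
    then have "(of_rat (w s) :: real) < of_rat (w s')" using p q by linarith
    then show ?thesis by (simp add: of_rat_less)
  qed
  have "inj_on w ?T"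
  proof (rule inj_onI, rule ccontr)
    fix s s' assume *: "s \<in> ?T" "s' \<in> ?T" "w s = w s'" "s \<noteq> s'"
    then consider "s < s'" | "s' < s" by linarith
    then show False
      using less[OF *(1,2)] less[OF *(2,1)] *(3) by cases simp_all
  qed
  then show ?thesis by (rule countableI')
qed

text \<open>
  All translates of \<open>B\<close> have the same measure. Averaging it over the translations by \<open>s *\<^sub>R b\<close> with
  \<open>0 \<le> s \<le> 1\<close> and exchanging the integrals leaves inner integrals over countable sets.
\<close>

lemma lborel_null_if_lines_countable:
  fixes B :: "'a::euclidean_space set"
  assumes B: "B \<in> sets borel" and c: "\<And>x. countable {s::real. x + s *\<^sub>R b \<in> B}"
  shows "emeasure lborel B = 0"
proof -
  have [measurable]: "B \<in> sets borel" by fact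
  have trans: "(\<integral>\<^sup>+x. indicator B (x + s *\<^sub>R b) \<partial>lborel) = emeasure lborel B" for s :: real
  proof -
    have "emeasure lborel B = (\<integral>\<^sup>+x. indicator B x \<partial>distr lborel borel ((+) (s *\<^sub>R b)))"
      by (simp add: lborel_distr_plus)
    also have "\<dots> = (\<integral>\<^sup>+x. indicator B (s *\<^sub>R b + x) \<partial>lborel)"
      by (subst nn_integral_distr) auto
    finally show ?thesis by (simp add: add.commute)
  qed
  have "emeasure lborel B = (\<integral>\<^sup>+s. emeasure lborel B * indicator {0..1::real} s \<partial>lborel)"
    by (subst nn_integral_cmult_indicator) auto
  also have "\<dots> = (\<integral>\<^sup>+s. (\<integral>\<^sup>+x. indicator B (x + s *\<^sub>R b) * indicator {0..1::real} s \<partial>lborel) \<partial>lborel)"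
    by (subst nn_integral_multc) (auto simp: trans)
  also have "\<dots> = (\<integral>\<^sup>+x. (\<integral>\<^sup>+s. indicator B (x + s *\<^sub>R b) * indicator {0..1::real} s \<partial>lborel) \<partial>lborel)"
    by (rule lborel_pair.Fubini') measurable
  also have "\<dots> = nn_integral lborel (\<lambda>x::'a. 0)"
  proof (rule nn_integral_cong)
    fix x :: 'a
    have "AE s in lborel. s \<notin> {s::real. x + s *\<^sub>R b \<in> B}"
      using countable_imp_null_set_lborel[OF c[of x]] by (rule AE_not_in)
    then have "(\<integral>\<^sup>+s. indicator B (x + s *\<^sub>R b) * indicator {0..1::real} s \<partial>lborel) = nn_integral lborel (\<lambda>s::real. 0)"
      by (intro nn_integral_cong_AE) (auto elim!: eventually_mono split: split_indicator)
    then show "(\<integral>\<^sup>+s. indicator B (x + s *\<^sub>R b) * indicator {0..1::real} s \<partial>lborel) = 0" by simp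
  qed
  finally show ?thesis by simp
qed

text \<open>
  Two different maximizers differ in some coordinate by at least some \<open>1/(k+1)\<close>. For fixed \<open>b\<close> and
  \<open>k\<close> the set of functionals with such a pair is closed, and lines parallel to \<open>b\<close> meet it in a
  countable set.
\<close>

lemma nonunique_face:
  fixes P :: "'a::euclidean_space set"
  assumes P: "compact P"
  defines "B \<equiv> {x. \<exists>p\<in>face P x. \<exists>q\<in>face P x. p \<noteq> q}"
  shows "B \<in> sets borel" "B \<in> null_sets lborel"
proof -
  define W where "W b k = {x. \<exists>p\<in>face P x. \<exists>q\<in>face P x. q \<bullet> b + 1 / (real k + 1) \<le> p \<bullet> b}" for b and k :: nat
  have W: "W b k \<in> sets borel" for b k
    unfolding W_def by (intro borel_closed closed_wide_face P)
  have W0: "W b k \<in> null_sets lborel" for b k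
  proof -
    have "emeasure lborel (W b k) = 0"
      using lborel_null_if_lines_countable[OF W, of b b k] countable_line_wide_face[of "1 / (real k + 1)" P _ b]
      by (simp add: W_def)
    then show ?thesis using W by (auto simp: null_sets_def)
  qed
  have B: "B = (\<Union>b\<in>Basis. \<Union>k. W b k)"
  proof
    show "B \<subseteq> (\<Union>b\<in>Basis. \<Union>k. W b k)"
    proof
      fix x assume "x \<in> B"
      then obtain p q where pq: "p \<in> face P x" "q \<in> face P x" "p \<noteq> q" by (auto simp: B_def)
      then obtain b where b: "b \<in> Basis" "p \<bullet> b \<noteq> q \<bullet> b" by (meson euclidean_eqI)
      have "\<exists>p\<in>face P x. \<exists>q\<in>face P x. q \<bullet> b < p \<bullet> b"
      proof (cases "q \<bullet> b < p \<bullet> b")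
        case False
        then have "p \<bullet> b < q \<bullet> b" using b by simp
        then show ?thesis using pq by blast
      qed (use pq in blast)
      then obtain p q where pq: "p \<in> face P x" "q \<in> face P x" "q \<bullet> b < p \<bullet> b" by blast
      obtain k where "1 / (real k + 1) < p \<bullet> b - q \<bullet> b"
        using reals_Archimedean[of "p \<bullet> b - q \<bullet> b"] pq by (auto simp: inverse_eq_divide add.commute)
      then have "q \<bullet> b + 1 / (real k + 1) \<le> p \<bullet> b" by simp
      then have "x \<in> W b k" using pq by (auto simp: W_def)
      then show "x \<in> (\<Union>b\<in>Basis. \<Union>k. W b k)" using b by blast
    qed
    have "W b k \<subseteq> B" for b k
    proof
      fix x assume "x \<in> W b k"
      then obtain p q where pq: "p \<in> face P x" "q \<in> face P x" "q \<bullet> b + 1 / (real k + 1) \<le> p \<bullet> b" by (auto simp: W_def)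
      moreover have "0 < 1 / (real k + 1)" by simp
      ultimately have "p \<noteq> q" by force
      then show "x \<in> B" using pq by (auto simp: B_def)
    qed
    then show "(\<Union>b\<in>Basis. \<Union>k. W b k) \<subseteq> B" by blast
  qed
  show "B \<in> sets borel" unfolding B using W by (intro sets.finite_UN sets.countable_UN) auto
  show "B \<in> null_sets lborel" unfolding B by (rule null_sets_UN'[OF countable_finite[OF finite_Basis]]) (rule null_sets_UN, rule W0)
qed

section \<open>The surface measure of the unit sphere\<close>

lemma hausdorff_null_set:
  assumes "hausdorff_outer m A = 0"
  shows "A \<in> null_sets (hausdorff_measure m)"
proof -
  have "A \<in> lambda_system UNIV UNIV (hausdorff_outer m)"
    unfolding lambda_system_def
  proof (intro CollectI conjI ballI UNIV_I)
    fix X :: "'a set"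
    have z: "hausdorff_outer m (A \<inter> X) = 0"
      using hausdorff_outer_mono[of "A \<inter> X" A m] assms by simp
    have "hausdorff_outer m X \<le> hausdorff_outer m (A \<inter> X) + hausdorff_outer m ((UNIV - A) \<inter> X)"
    proof -
      have "(A \<inter> X) \<inter> ((UNIV - A) \<inter> X) = {}" "(A \<inter> X) \<union> ((UNIV - A) \<inter> X) = X" by auto
      then show ?thesis
        using outer_measure_space_subadditive[OF outer_measure_space_hausdorff[of m], of "A \<inter> X" "(UNIV - A) \<inter> X"] by simp
    qed
    moreover have "hausdorff_outer m ((UNIV - A) \<inter> X) \<le> hausdorff_outer m X"
      by (rule hausdorff_outer_mono) simp
    ultimately show "hausdorff_outer m (A \<inter> X) + hausdorff_outer m ((UNIV - A) \<inter> X) = hausdorff_outer m X"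
      unfolding z by simp
  qed
  then have "A \<in> sets (hausdorff_measure m)" by (simp add: sets_hausdorff_measure)
  then show ?thesis using assms by (simp add: null_sets_def emeasure_hausdorff_measure)
qed

definition sphere_measure :: "'a::euclidean_space measure" where
  "sphere_measure = restrict_space (hausdorff_measure (DIM('a) - 1)) (sphere 0 1)"

abbreviation sphere_borel :: "'a::euclidean_space measure" where
  "sphere_borel \<equiv> restrict_space borel (sphere 0 1)"

lemma space_hausdorff_measure [simp]: "space (hausdorff_measure m) = UNIV"
  by (simp add: hausdorff_measure_def)

lemma sphere_in_hausdorff: "sphere 0 1 \<in> sets (hausdorff_measure m :: 'a::euclidean_space measure)"
  using borel_subset_hausdorff_measure[of m] borel_closed[OF closed_sphere] by blast

lemma space_sphere_measure [simp]: "space sphere_measure = sphere 0 1"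
  by (simp add: sphere_measure_def space_restrict_space)

lemma sets_sphere_measure:
  "E \<in> sets (sphere_measure :: 'a::euclidean_space measure) \<longleftrightarrow>
     E \<subseteq> sphere 0 1 \<and> E \<in> sets (hausdorff_measure (DIM('a) - 1))"
  unfolding sphere_measure_def using sphere_in_hausdorff by (subst sets_restrict_space_iff) auto

lemma emeasure_sphere_measure:
  fixes E :: "'a::euclidean_space set"
  assumes "E \<in> sets sphere_measure"
  shows "emeasure sphere_measure E = hausdorff_outer (DIM('a) - 1) E"
  using assms unfolding sets_sphere_measure
  by (simp add: sphere_measure_def emeasure_restrict_space sphere_in_hausdorff emeasure_hausdorff_measure)

lemma sets_sphere_borel:
  "E \<in> sets (sphere_borel :: 'a::euclidean_space measure) \<longleftrightarrow> E \<subseteq> sphere 0 1 \<and> E \<in> sets borel"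
  by (subst sets_restrict_space_iff) auto

lemma sphere_borel_subset: "sets (sphere_borel :: 'a::euclidean_space measure) \<subseteq> sets sphere_measure"
proof
  fix E :: "'a set" assume "E \<in> sets sphere_borel"
  then have "E \<subseteq> sphere 0 1" "E \<in> sets (hausdorff_measure (DIM('a) - 1))"
    unfolding sets_sphere_borel using borel_subset_hausdorff_measure[of "DIM('a) - 1"] by blast+
  then show "E \<in> sets sphere_measure" by (simp add: sets_sphere_measure)
qed

lemma measurable_sphere_measureI:
  assumes "f \<in> measurable sphere_borel M"
  shows "f \<in> measurable sphere_measure M"
  using assms sphere_borel_subset by (auto simp: measurable_def space_restrict_space)

lemma continuous_sphere_measurable:
  assumes "continuous_on (sphere 0 1) f"
  shows "f \<in> borel_measurable sphere_borel" "f \<in> borel_measurable sphere_measure"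
  using borel_measurable_continuous_on_restrict[OF assms] measurable_sphere_measureI by auto

lemma finite_sphere_measure: "finite_measure (sphere_measure :: 'a::euclidean_space measure)"
proof
  have "(sphere 0 1 :: 'a set) \<in> sets sphere_measure" by (metis sets.top space_sphere_measure)
  then show "emeasure sphere_measure (space sphere_measure :: 'a set) \<noteq> \<infinity>"
    using hausdorff_sphere_finite[where 'a='a] by (simp add: emeasure_sphere_measure)
qed

lemma sphere_measure_null:
  fixes A N :: "'a::euclidean_space set"
  assumes "A \<subseteq> sphere 0 1" "negligible N" "\<And>t x. x \<in> A \<Longrightarrow> 0 < t \<Longrightarrow> t *\<^sub>R x \<in> N"
  shows "A \<in> null_sets sphere_measure"
proof -
  have "hausdorff_outer (DIM('a) - 1) A = 0" by (rule hausdorff_null_of_cone_null) fact+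
  then have "A \<in> null_sets (hausdorff_measure (DIM('a) - 1))" by (rule hausdorff_null_set)
  then show ?thesis
    unfolding sphere_measure_def using assms(1) by (subst null_sets_restrict_space) (auto simp: sphere_in_hausdorff)
qed

text \<open>
  Completeness matters because the reverse radial Gauss image of a Borel set is known to be Borel
  only up to a null set.
\<close>

lemma sphere_measure_complete:
  fixes A :: "'a::euclidean_space set"
  assumes "A \<in> null_sets sphere_measure" "B \<subseteq> A"
  shows "B \<in> null_sets sphere_measure"
proof -
  have A: "A \<in> sets sphere_measure" "hausdorff_outer (DIM('a) - 1) A = 0"
    using assms(1) emeasure_sphere_measure[of A] by (auto simp: null_sets_def)
  then have "hausdorff_outer (DIM('a) - 1) B = 0"
    using hausdorff_outer_mono[OF assms(2), of "DIM('a) - 1"] by simp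
  then have "B \<in> null_sets (hausdorff_measure (DIM('a) - 1))" by (rule hausdorff_null_set)
  then show ?thesis
    unfolding sphere_measure_def using assms(2) A(1)
    by (subst null_sets_restrict_space) (auto simp: sphere_in_hausdorff sets_sphere_measure)
qed

lemma sphere_measure_cap_pos:
  fixes v :: "'a::euclidean_space"
  assumes "v \<in> sphere 0 1" "r > 0"
  shows "emeasure sphere_measure (sphere 0 1 \<inter> ball v r) > 0"
proof -
  have "sphere 0 1 \<inter> ball v r \<in> sets sphere_measure"
    using sphere_borel_subset by (auto simp: sets_sphere_borel)
  then show ?thesis using hausdorff_cap_pos[of v r] assms by (simp add: emeasure_sphere_measure)
qed

lemma sphere_measure_measurable_AE_eq:
  fixes f g :: "'a::euclidean_space \<Rightarrow> 'b"
  assumes g: "g \<in> measurable sphere_measure M" and N: "N \<in> null_sets sphere_measure"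
    and eq: "\<And>u. u \<in> sphere 0 1 - N \<Longrightarrow> f u = g u"
    and f: "\<And>u. u \<in> sphere 0 1 \<Longrightarrow> f u \<in> space M"
  shows "f \<in> measurable sphere_measure M"
proof (rule measurableI)
  fix E assume E: "E \<in> sets M"
  have split: "f -` E \<inter> sphere 0 1 = ((g -` E \<inter> sphere 0 1) - N) \<union> (f -` E \<inter> sphere 0 1 \<inter> N)"
    using eq by auto
  have gm: "(g -` E \<inter> sphere 0 1) \<in> sets sphere_measure"
    using measurable_sets[OF g E] by simp
  have nn: "f -` E \<inter> sphere 0 1 \<inter> N \<in> null_sets sphere_measure"
    by (rule sphere_measure_complete[OF N]) auto
  show "f -` E \<inter> space sphere_measure \<in> sets sphere_measure"
    unfolding space_sphere_measure
    by (subst split) (rule sets.Un[OF sets.Diff[OF gm null_setsD2[OF N]] null_setsD2[OF nn]])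
qed (use f in simp)

lemma uminus_sets_hausdorff:
  fixes E :: "'a::euclidean_space set"
  assumes "E \<in> sets (hausdorff_measure m)"
  shows "uminus ` E \<in> sets (hausdorff_measure m)"
  unfolding sets_hausdorff_measure lambda_system_def
proof (intro CollectI conjI ballI UNIV_I)
  fix X :: "'a set"
  have inj: "inj (uminus :: 'a \<Rightarrow> 'a)" by simp
  have 1: "uminus ` E \<inter> X = uminus ` (E \<inter> uminus ` X)"
    by (simp add: image_Int[OF inj] image_image)
  have 2: "(UNIV - uminus ` E) \<inter> X = uminus ` ((UNIV - E) \<inter> uminus ` X)"
  proof -
    have "uminus ` (UNIV - E) = UNIV - uminus ` E"
      by (simp add: image_set_diff[OF inj] surj_uminus)
    then show ?thesis by (simp add: image_Int[OF inj] image_image)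
  qed
  have "hausdorff_outer m (E \<inter> uminus ` X) + hausdorff_outer m ((UNIV - E) \<inter> uminus ` X) = hausdorff_outer m (uminus ` X)"
    using assms unfolding sets_hausdorff_measure lambda_system_def by blast
  then show "hausdorff_outer m (uminus ` E \<inter> X) + hausdorff_outer m ((UNIV - uminus ` E) \<inter> X) = hausdorff_outer m X"
    unfolding 1 2 hausdorff_outer_uminus .
qed

lemma measurable_uminus_sphere: "uminus \<in> measurable sphere_measure (sphere_measure :: 'a::euclidean_space measure)"
proof (rule measurableI)
  fix E :: "'a set" assume "E \<in> sets sphere_measure"
  then have E: "E \<subseteq> sphere 0 1" "E \<in> sets (hausdorff_measure (DIM('a) - 1))" by (auto simp: sets_sphere_measure)
  have "uminus -` E \<inter> sphere 0 1 = uminus ` E"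
    using E(1) by (auto simp: image_iff) (metis minus_minus)
  then show "uminus -` E \<inter> space sphere_measure \<in> sets sphere_measure"
    using uminus_sets_hausdorff[OF E(2)] E(1) by (auto simp: sets_sphere_measure)
qed auto

text \<open>
  The antipodal map is an isometry.
\<close>

lemma distr_uminus_sphere: "distr sphere_measure sphere_measure uminus = (sphere_measure :: 'a::euclidean_space measure)"
proof (rule measure_eqI)
  fix E :: "'a set" assume "E \<in> sets (distr sphere_measure sphere_measure uminus)"
  then have E: "E \<in> sets sphere_measure" by simp
  then have sub: "E \<subseteq> sphere 0 1" by (simp add: sets_sphere_measure)
  have eq: "uminus -` E \<inter> sphere 0 1 = uminus ` E"
    using sub by (auto simp: image_iff) (metis minus_minus)
  have m: "uminus ` E \<in> sets sphere_measure"
    using measurable_sets[OF measurable_uminus_sphere E] unfolding space_sphere_measure eq .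
  show "emeasure (distr sphere_measure sphere_measure uminus) E = emeasure sphere_measure E"
    unfolding emeasure_distr[OF measurable_uminus_sphere E] space_sphere_measure eq
      emeasure_sphere_measure[OF m] emeasure_sphere_measure[OF E] hausdorff_outer_uminus ..
qed simp

lemma integral_uminus_sphere:
  fixes f :: "'a::euclidean_space \<Rightarrow> real"
  assumes "f \<in> borel_measurable sphere_measure"
  shows "(\<integral>u. f (- u) \<partial>sphere_measure) = (\<integral>u. f u \<partial>sphere_measure)"
  using integral_distr[OF measurable_uminus_sphere assms] by (simp add: distr_uminus_sphere)

section \<open>Wulff shapes and their gauge functions\<close>

definition positive_on_sphere :: "('a::euclidean_space \<Rightarrow> real) \<Rightarrow> bool" where
  "positive_on_sphere f \<longleftrightarrow> continuous_on (sphere 0 1) f \<and> (\<forall>v\<in>sphere 0 1. 0 < f v)"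

definition wulff :: "('a::euclidean_space \<Rightarrow> real) \<Rightarrow> 'a set" where
  "wulff f = {x. \<forall>v\<in>sphere 0 1. x \<bullet> v \<le> f v}"

text \<open>
  The Minkowski functional of the Wulff shape, so that its reciprocal is the radial function. Being a
  maximum over the sphere, it responds to changes of \<open>f\<close> in a way that the maximizers control.
\<close>

definition wulff_gauge :: "('a::euclidean_space \<Rightarrow> real) \<Rightarrow> 'a \<Rightarrow> real" where
  "wulff_gauge f x = (SUP v\<in>sphere 0 1. (x \<bullet> v) / f v)"

text \<open>
  The directions in which the maximum in the gauge is attained; they turn out to be the outer
  normals of the Wulff shape at the boundary point in direction \<open>x\<close>.
\<close>

definition wulff_normals :: "('a::euclidean_space \<Rightarrow> real) \<Rightarrow> 'a \<Rightarrow> 'a set" where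
  "wulff_normals f x = {v \<in> sphere 0 1. (x \<bullet> v) / f v = wulff_gauge f x}"

lemma sphere_nonempty: "sphere 0 1 \<noteq> ({} :: 'a::euclidean_space set)"
  by simp

lemma continuous_on_lipschitz:
  fixes f :: "'a::real_normed_vector \<Rightarrow> real"
  assumes "0 \<le> L" "\<And>x y. \<bar>f x - f y\<bar> \<le> L * norm (x - y)"
  shows "continuous_on A f"
  using assms by (intro lipschitz_on_continuous_on[of L] lipschitz_onI) (simp_all add: dist_norm)

lemma positive_on_sphere_lower_bound:
  fixes f :: "'a::euclidean_space \<Rightarrow> real"
  assumes "positive_on_sphere f"
  obtains m where "0 < m" "\<And>v. v \<in> sphere 0 1 \<Longrightarrow> m \<le> f v"
proof -
  have "continuous_on (sphere 0 1) f" using assms by (simp add: positive_on_sphere_def)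
  then obtain v where v: "v \<in> sphere 0 1" "\<forall>w\<in>sphere 0 1. f v \<le> f w"
    using continuous_attains_inf[OF compact_sphere sphere_nonempty] by blast
  then show ?thesis using assms by (intro that[of "f v"]) (auto simp: positive_on_sphere_def)
qed

lemma continuous_quotient:
  fixes f :: "'a::euclidean_space \<Rightarrow> real"
  assumes "positive_on_sphere f"
  shows "continuous_on (sphere 0 1) (\<lambda>v. (x \<bullet> v) / f v)"
proof -
  have "\<forall>v\<in>sphere 0 1. f v \<noteq> 0" using assms by (force simp: positive_on_sphere_def)
  then show ?thesis using assms unfolding positive_on_sphere_def
    by (intro continuous_on_divide continuous_on_inner continuous_on_const continuous_on_id) auto
qed

lemma wulff_gauge_attained:
  fixes f :: "'a::euclidean_space \<Rightarrow> real"
  assumes "positive_on_sphere f"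
  shows "wulff_normals f x \<noteq> {}" and "w \<in> sphere 0 1 \<Longrightarrow> (x \<bullet> w) / f w \<le> wulff_gauge f x"
proof -
  obtain v where v: "v \<in> sphere 0 1" "\<forall>w\<in>sphere 0 1. (x \<bullet> w) / f w \<le> (x \<bullet> v) / f v"
    using continuous_attains_sup[OF compact_sphere sphere_nonempty continuous_quotient[OF assms, of x]] by blast
  have "wulff_gauge f x = (x \<bullet> v) / f v"
    unfolding wulff_gauge_def using v by (intro cSup_eq_maximum) auto
  then show "wulff_normals f x \<noteq> {}" "w \<in> sphere 0 1 \<Longrightarrow> (x \<bullet> w) / f w \<le> wulff_gauge f x"
    using v by (auto simp: wulff_normals_def)
qed

lemma wulff_gauge_eqI:
  fixes f :: "'a::euclidean_space \<Rightarrow> real"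
  assumes "v \<in> sphere 0 1" "(x \<bullet> v) / f v = c" "\<And>w. w \<in> sphere 0 1 \<Longrightarrow> (x \<bullet> w) / f w \<le> c"
  shows "wulff_gauge f x = c"
  unfolding wulff_gauge_def using assms by (intro cSup_eq_maximum) auto

lemma wulff_gauge_ge:
  fixes f :: "'a::euclidean_space \<Rightarrow> real"
  assumes "positive_on_sphere f" "u \<in> sphere 0 1"
  shows "1 / f u \<le> wulff_gauge f u"
  using wulff_gauge_attained(2)[OF assms(1), of u u] assms(2) by (simp add: dot_square_norm)

lemma wulff_gauge_pos:
  fixes f :: "'a::euclidean_space \<Rightarrow> real"
  assumes "positive_on_sphere f" "u \<in> sphere 0 1"
  shows "0 < wulff_gauge f u"
proof -
  have "0 < 1 / f u" using assms by (simp add: positive_on_sphere_def)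
  then show ?thesis using wulff_gauge_ge[OF assms] by linarith
qed

lemma wulff_gauge_diff:
  fixes f f' :: "'a::euclidean_space \<Rightarrow> real"
  assumes f: "positive_on_sphere f" and f': "positive_on_sphere f'"
    and e: "\<And>v. v \<in> sphere 0 1 \<Longrightarrow> \<bar>(x \<bullet> v) / f v - (y \<bullet> v) / f' v\<bar> \<le> e"
  shows "\<bar>wulff_gauge f x - wulff_gauge f' y\<bar> \<le> e"
proof -
  obtain v where v: "v \<in> sphere 0 1" "(x \<bullet> v) / f v = wulff_gauge f x"
    using wulff_gauge_attained(1)[OF f, of x] by (auto simp: wulff_normals_def)
  obtain w where w: "w \<in> sphere 0 1" "(y \<bullet> w) / f' w = wulff_gauge f' y"
    using wulff_gauge_attained(1)[OF f', of y] by (auto simp: wulff_normals_def)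
  show ?thesis
    using e[OF v(1)] e[OF w(1)] v(2) w(2) wulff_gauge_attained(2)[OF f w(1), of x]
      wulff_gauge_attained(2)[OF f' v(1), of y] by linarith
qed

lemma wulff_gauge_lipschitz:
  fixes f :: "'a::euclidean_space \<Rightarrow> real"
  assumes f: "positive_on_sphere f" and m: "0 < m" "\<And>v. v \<in> sphere 0 1 \<Longrightarrow> m \<le> f v"
  shows "\<bar>wulff_gauge f x - wulff_gauge f y\<bar> \<le> norm (x - y) / m"
proof (rule wulff_gauge_diff[OF f f])
  fix v :: 'a assume v: "v \<in> sphere 0 1"
  have "\<bar>(x \<bullet> v) / f v - (y \<bullet> v) / f v\<bar> = \<bar>(x - y) \<bullet> v\<bar> / f v"
    using m(1) m(2)[OF v] by (simp add: inner_diff_left diff_divide_distrib[symmetric])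
  also have "\<dots> \<le> norm (x - y) / f v"
    using Cauchy_Schwarz_ineq2[of "x - y" v] v m(1) m(2)[OF v] by (intro divide_right_mono) auto
  also have "\<dots> \<le> norm (x - y) / m"
    using m(1) m(2)[OF v] by (intro divide_left_mono) auto
  finally show "\<bar>(x \<bullet> v) / f v - (y \<bullet> v) / f v\<bar> \<le> norm (x - y) / m" .
qed

lemma continuous_wulff_gauge:
  fixes f :: "'a::euclidean_space \<Rightarrow> real"
  assumes f: "positive_on_sphere f"
  shows "continuous_on A (wulff_gauge f)"
proof -
  obtain m where m: "0 < m" "\<And>v. v \<in> sphere 0 1 \<Longrightarrow> m \<le> f v"
    using positive_on_sphere_lower_bound[OF f] by blast
  show ?thesis
    using m(1) wulff_gauge_lipschitz[OF f m] by (intro continuous_on_lipschitz[of "1 / m"]) simp_all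
qed

lemma scaleR_in_wulff_iff:
  fixes f :: "'a::euclidean_space \<Rightarrow> real"
  assumes f: "positive_on_sphere f" and r: "0 \<le> r"
  shows "r *\<^sub>R x \<in> wulff f \<longleftrightarrow> r * wulff_gauge f x \<le> 1"
proof
  assume *: "r *\<^sub>R x \<in> wulff f"
  obtain v where v: "v \<in> sphere 0 1" "(x \<bullet> v) / f v = wulff_gauge f x"
    using wulff_gauge_attained(1)[OF f, of x] by (auto simp: wulff_normals_def)
  have "r * (x \<bullet> v) \<le> f v" "0 < f v" using * v f by (auto simp: wulff_def positive_on_sphere_def)
  then have "r * ((x \<bullet> v) / f v) \<le> 1" by simp
  then show "r * wulff_gauge f x \<le> 1" using v by simp
next
  assume *: "r * wulff_gauge f x \<le> 1"
  show "r *\<^sub>R x \<in> wulff f"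
    unfolding wulff_def
  proof (intro CollectI ballI)
    fix w :: 'a assume w: "w \<in> sphere 0 1"
    have "r * ((x \<bullet> w) / f w) \<le> r * wulff_gauge f x"
      using wulff_gauge_attained(2)[OF f w] r by (intro mult_left_mono)
    then have "r * (x \<bullet> w) / f w \<le> 1" using * by simp
    moreover have "0 < f w" using f w by (simp add: positive_on_sphere_def)
    ultimately show "(r *\<^sub>R x) \<bullet> w \<le> f w" by (simp add: pos_divide_le_eq)
  qed
qed

lemma radial_fun_wulff:
  fixes f :: "'a::euclidean_space \<Rightarrow> real"
  assumes f: "positive_on_sphere f" and u: "u \<in> sphere 0 1"
  shows "radial_fun (wulff f) u = 1 / wulff_gauge f u"
proof -
  have N: "0 < wulff_gauge f u" by (rule wulff_gauge_pos[OF f u])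
  show ?thesis
    unfolding radial_fun_def
  proof (rule cSup_eq_maximum)
    show "1 / wulff_gauge f u \<in> {r. 0 \<le> r \<and> r *\<^sub>R u \<in> wulff f}"
      using N scaleR_in_wulff_iff[OF f, of "1 / wulff_gauge f u" u] by simp
    fix r assume "r \<in> {r. 0 \<le> r \<and> r *\<^sub>R u \<in> wulff f}"
    then have "r * wulff_gauge f u \<le> 1" using scaleR_in_wulff_iff[OF f, of r u] by simp
    then show "r \<le> 1 / wulff_gauge f u" using N by (simp add: pos_le_divide_eq)
  qed
qed

lemma wulff_convex_body:
  fixes f :: "'a::euclidean_space \<Rightarrow> real"
  assumes f: "positive_on_sphere f"
  shows "wulff f \<in> convex_bodies_o"
proof -
  obtain m where m: "0 < m" "\<And>v. v \<in> sphere 0 1 \<Longrightarrow> m \<le> f v"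
    using positive_on_sphere_lower_bound[OF f] by blast
  have eq: "wulff f = (\<Inter>v\<in>sphere 0 1. {x. v \<bullet> x \<le> f v})"
    by (auto simp: wulff_def inner_commute)
  have "closed (wulff f)" unfolding eq by (intro closed_INT ballI closed_halfspace_le)
  moreover have "bounded (wulff f)"
  proof -
    have "continuous_on (sphere 0 1) f" using f by (simp add: positive_on_sphere_def)
    then obtain w where w: "w \<in> sphere 0 1" "\<forall>v\<in>sphere 0 1. f v \<le> f w"
      using continuous_attains_sup[OF compact_sphere sphere_nonempty] by blast
    have "norm x \<le> f w" if x: "x \<in> wulff f" for x
    proof (cases "x = 0")
      case True
      then show ?thesis using m(1) m(2)[OF w(1)] by simp
    next
      case False
      define v where "v = (1 / norm x) *\<^sub>R x"
      have v: "v \<in> sphere 0 1" using False by (simp add: v_def)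
      have "norm x = x \<bullet> v" using False by (simp add: v_def dot_square_norm power2_eq_square)
      also have "\<dots> \<le> f v" using x v by (simp add: wulff_def)
      finally show ?thesis using w(2) v by force
    qed
    then show ?thesis unfolding bounded_iff by blast
  qed
  moreover have "convex (wulff f)" unfolding eq by (intro convex_INT convex_halfspace_le)
  moreover have "0 \<in> interior (wulff f)"
  proof -
    have "ball 0 m \<subseteq> wulff f"
    proof
      fix x :: 'a assume x: "x \<in> ball 0 m"
      have "x \<bullet> v \<le> f v" if v: "v \<in> sphere 0 1" for v
        using norm_cauchy_schwarz[of x v] v x m(2)[OF v] by simp
      then show "x \<in> wulff f" by (simp add: wulff_def)
    qed
    then show ?thesis using m(1) interior_maximal[of "ball 0 m" "wulff f"] by auto
  qed
  ultimately show ?thesis by (simp add: convex_bodies_o_def compact_eq_bounded_closed)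
qed

lemma support_fun_bounds:
  fixes K :: "'a::euclidean_space set"
  assumes K: "K \<in> convex_bodies_o"
  shows support_fun_upper: "\<And>x v. x \<in> K \<Longrightarrow> v \<bullet> x \<le> support_fun K v"
    and support_fun_least: "\<And>c v. (\<And>x. x \<in> K \<Longrightarrow> v \<bullet> x \<le> c) \<Longrightarrow> support_fun K v \<le> c"
proof -
  have K0: "K \<noteq> {}" using K interior_subset by (auto simp: convex_bodies_o_def)
  have "compact K" using K by (simp add: convex_bodies_o_def)
  then have bdd: "bdd_above ((\<lambda>x. v \<bullet> x) ` K)" for v
    by (intro bounded_imp_bdd_above compact_imp_bounded compact_continuous_image continuous_intros)
  show "v \<bullet> x \<le> support_fun K v" if "x \<in> K" for x v
    unfolding support_fun_def by (rule cSUP_upper[OF that bdd])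
  show "support_fun K v \<le> c" if "\<And>x. x \<in> K \<Longrightarrow> v \<bullet> x \<le> c" for c v
    unfolding support_fun_def by (rule cSUP_least[OF K0 that])
qed

lemma support_fun_lipschitz:
  fixes K :: "'a::euclidean_space set"
  assumes K: "K \<in> convex_bodies_o" and R: "K \<subseteq> cball 0 R"
  shows "\<bar>support_fun K v - support_fun K w\<bar> \<le> R * norm (v - w)"
proof -
  have le: "support_fun K v \<le> support_fun K w + R * norm (v - w)" for v w
  proof (rule support_fun_least[OF K])
    fix x assume x: "x \<in> K"
    have "v \<bullet> x = w \<bullet> x + (v - w) \<bullet> x" by (simp add: inner_diff_left)
    also have "\<dots> \<le> support_fun K w + norm (v - w) * norm x"
      by (intro add_mono support_fun_upper[OF K x] norm_cauchy_schwarz)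
    also have "\<dots> \<le> support_fun K w + R * norm (v - w)"
      using x R by (auto simp: mult.commute intro!: mult_right_mono)
    finally show "v \<bullet> x \<le> support_fun K w + R * norm (v - w)" .
  qed
  show ?thesis using le[of v w] le[of w v] by (simp add: norm_minus_commute abs_le_iff)
qed

lemma positive_support_fun:
  fixes K :: "'a::euclidean_space set"
  assumes K: "K \<in> convex_bodies_o"
  shows "positive_on_sphere (support_fun K)"
proof -
  have "bounded K" using K compact_imp_bounded by (auto simp: convex_bodies_o_def)
  then obtain R where R: "0 < R" "\<And>x. x \<in> K \<Longrightarrow> norm x \<le> R" by (auto simp: bounded_pos)
  have R': "K \<subseteq> cball 0 R" using R(2) by auto
  have "continuous_on (sphere 0 1) (support_fun K)"
    using R(1) support_fun_lipschitz[OF K R'] by (intro continuous_on_lipschitz[of R]) simp_all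
  moreover have "0 < support_fun K v" if v: "v \<in> sphere 0 1" for v
  proof -
    obtain r where r: "0 < r" "cball 0 r \<subseteq> K"
      using K mem_interior_cball[of 0 K] by (auto simp: convex_bodies_o_def)
    then have "r *\<^sub>R v \<in> K" using v by auto
    then have "r * (v \<bullet> v) \<le> support_fun K v" using support_fun_upper[OF K, of "r *\<^sub>R v" v] by simp
    then show ?thesis using r v by (simp add: dot_square_norm)
  qed
  ultimately show ?thesis by (simp add: positive_on_sphere_def)
qed

text \<open>
  A point outside \<open>K\<close> is strictly separated from \<open>K\<close> by a hyperplane, and the unit normal of that
  hyperplane violates the constraint of the Wulff shape.
\<close>

lemma wulff_support_fun:
  fixes K :: "'a::euclidean_space set"
  assumes K: "K \<in> convex_bodies_o"
  shows "wulff (support_fun K) = K"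
proof
  show "K \<subseteq> wulff (support_fun K)"
    using support_fun_upper[OF K] by (auto simp: wulff_def inner_commute)
  show "wulff (support_fun K) \<subseteq> K"
  proof
    fix y assume y: "y \<in> wulff (support_fun K)"
    show "y \<in> K"
    proof (rule ccontr)
      assume "y \<notin> K"
      moreover have "closed K" "convex K" "0 \<in> K"
        using K interior_subset by (auto simp: convex_bodies_o_def compact_imp_closed)
      ultimately obtain a b where ab: "a \<bullet> y < b" "\<forall>x\<in>K. b < a \<bullet> x"
        using separating_hyperplane_closed_point[of K y] by blast
      have "b < 0" using ab(2) \<open>0 \<in> K\<close> by auto
      then have a: "a \<noteq> 0" using ab(1) by auto
      define v where "v = - ((1 / norm a) *\<^sub>R a)"
      have v: "v \<in> sphere 0 1" using a by (simp add: v_def)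
      have "support_fun K v \<le> - b / norm a"
      proof (rule support_fun_least[OF K])
        fix x assume "x \<in> K"
        then have "b < a \<bullet> x" using ab(2) by blast
        then have "- (a \<bullet> x) / norm a \<le> - b / norm a" by (intro divide_right_mono) auto
        then show "v \<bullet> x \<le> - b / norm a" by (simp add: v_def)
      qed
      also have "\<dots> < - (a \<bullet> y) / norm a" using ab(1) a by (intro divide_strict_right_mono) auto
      also have "\<dots> = y \<bullet> v" by (simp add: v_def inner_commute)
      also have "\<dots> \<le> support_fun K v" using y v by (simp add: wulff_def)
      finally show False by simp
    qed
  qed
qed

lemma support_fun_wulff_le:
  fixes f :: "'a::euclidean_space \<Rightarrow> real"
  assumes "positive_on_sphere f" "v \<in> sphere 0 1"
  shows "support_fun (wulff f) v \<le> f v"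
  using assms(2) by (intro support_fun_least[OF wulff_convex_body[OF assms(1)]]) (simp add: wulff_def inner_commute)

lemma radial_fun_eq:
  assumes "K \<in> convex_bodies_o" "u \<in> sphere 0 1"
  shows "radial_fun K u = 1 / wulff_gauge (support_fun K) u"
  using radial_fun_wulff[OF positive_support_fun[OF assms(1)] assms(2)] wulff_support_fun[OF assms(1)] by simp

text \<open>
  Replacing \<open>f\<close> by the support function of its Wulff shape can lower \<open>f\<close> but does not change the
  shape.
\<close>

lemma wulff_gauge_support_fun_wulff:
  assumes "positive_on_sphere f" "u \<in> sphere 0 1"
  shows "wulff_gauge (support_fun (wulff f)) u = wulff_gauge f u"
  using radial_fun_wulff[OF assms] radial_fun_eq[OF wulff_convex_body[OF assms(1)] assms(2)] by simp

lemma radial_normal_iff: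
  fixes K :: "'a::euclidean_space set"
  assumes K: "K \<in> convex_bodies_o" and u: "u \<in> sphere 0 1"
  shows "radial_normal K u v \<longleftrightarrow> v \<in> wulff_normals (support_fun K) u"
proof (cases "v \<in> sphere 0 1")
  case True
  let ?N = "wulff_gauge (support_fun K) u"
  have h: "0 < support_fun K v" using positive_support_fun[OF K] True by (simp add: positive_on_sphere_def)
  have N: "0 < ?N" by (rule wulff_gauge_pos[OF positive_support_fun[OF K] u])
  have eq: "v \<bullet> (radial_fun K u *\<^sub>R u) = (u \<bullet> v) / ?N" by (simp add: radial_fun_eq[OF K u] inner_commute)
  have "v \<bullet> (radial_fun K u *\<^sub>R u) = support_fun K v \<longleftrightarrow> (u \<bullet> v) / support_fun K v = ?N"
    unfolding eq using h N by (auto simp: field_simps)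
  then show ?thesis using True by (simp add: radial_normal_def wulff_normals_def)
qed (simp add: radial_normal_def wulff_normals_def)

section \<open>Outer normals and the first variation of the gauge\<close>

text \<open>
  The gauge of the Wulff shape is the support function of this compact set, to which the result on
  unique maximizers applies.
\<close>

definition wulff_polar :: "('a::euclidean_space \<Rightarrow> real) \<Rightarrow> 'a set" where
  "wulff_polar f = (\<lambda>v. (1 / f v) *\<^sub>R v) ` sphere 0 1"

definition wulff_singular :: "('a::euclidean_space \<Rightarrow> real) \<Rightarrow> 'a set" where
  "wulff_singular f = {x. \<exists>p\<in>face (wulff_polar f) x. \<exists>q\<in>face (wulff_polar f) x. p \<noteq> q}"

text \<open>
  On the singular set, which is null, the value is an arbitrary unit vector, so that the map sends
  the whole space into the sphere.
\<close>

definition wulff_normal :: "('a::euclidean_space \<Rightarrow> real) \<Rightarrow> 'a \<Rightarrow> 'a" where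
  "wulff_normal f x =
     (if x \<in> wulff_singular f then SOME v. v \<in> sphere 0 1 else THE v. v \<in> wulff_normals f x)"

lemma compact_wulff_polar:
  assumes "positive_on_sphere f"
  shows "compact (wulff_polar f)"
proof -
  have "\<forall>v\<in>sphere 0 1. f v \<noteq> 0" using assms by (force simp: positive_on_sphere_def)
  then have "continuous_on (sphere 0 1) (\<lambda>v. (1 / f v) *\<^sub>R v)"
    using assms unfolding positive_on_sphere_def by (intro continuous_intros) auto
  then show ?thesis unfolding wulff_polar_def by (rule compact_continuous_image) simp
qed

lemma face_wulff_polar:
  fixes f :: "'a::euclidean_space \<Rightarrow> real"
  assumes f: "positive_on_sphere f"
  shows "face (wulff_polar f) x = (\<lambda>v. (1 / f v) *\<^sub>R v) ` wulff_normals f x"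
proof -
  have inner: "((1 / f v) *\<^sub>R v) \<bullet> x = (x \<bullet> v) / f v" for v by (simp add: inner_commute)
  have "(\<forall>w\<in>sphere 0 1. (x \<bullet> w) / f w \<le> (x \<bullet> v) / f v) \<longleftrightarrow> (x \<bullet> v) / f v = wulff_gauge f x"
    if v: "v \<in> sphere 0 1" for v
  proof
    assume *: "\<forall>w\<in>sphere 0 1. (x \<bullet> w) / f w \<le> (x \<bullet> v) / f v"
    show "(x \<bullet> v) / f v = wulff_gauge f x"
      using wulff_gauge_eqI[OF v refl, of x f] * by simp
  qed (use wulff_gauge_attained(2)[OF f] in auto)
  then have "{v \<in> sphere 0 1. \<forall>w\<in>sphere 0 1. ((1 / f w) *\<^sub>R w) \<bullet> x \<le> ((1 / f v) *\<^sub>R v) \<bullet> x} = wulff_normals f x"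
    unfolding wulff_normals_def inner by (intro Collect_cong conj_cong refl)
  moreover have "face (wulff_polar f) x = (\<lambda>v. (1 / f v) *\<^sub>R v) `
      {v \<in> sphere 0 1. \<forall>w\<in>sphere 0 1. ((1 / f w) *\<^sub>R w) \<bullet> x \<le> ((1 / f v) *\<^sub>R v) \<bullet> x}"
    unfolding face_def wulff_polar_def by blast
  ultimately show ?thesis by (simp only:)
qed

lemma not_singular_iff:
  fixes f :: "'a::euclidean_space \<Rightarrow> real"
  assumes f: "positive_on_sphere f"
  shows "x \<notin> wulff_singular f \<longleftrightarrow> (\<exists>!v. v \<in> wulff_normals f x)"
proof -
  have inj: "v = w" if "v \<in> wulff_normals f x" "w \<in> wulff_normals f x" "(1 / f v) *\<^sub>R v = (1 / f w) *\<^sub>R w" for v w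
  proof -
    have vw: "norm v = 1" "norm w = 1" "0 < f v" "0 < f w"
      using that f by (auto simp: wulff_normals_def positive_on_sphere_def)
    have "norm ((1 / f v) *\<^sub>R v) = norm ((1 / f w) *\<^sub>R w)" using that(3) by simp
    then have "1 / f v = 1 / f w" using vw by simp
    then show ?thesis using that(3) vw by simp
  qed
  obtain v0 where "v0 \<in> wulff_normals f x" using wulff_gauge_attained(1)[OF f, of x] by blast
  then show ?thesis
    unfolding wulff_singular_def face_wulff_polar[OF f] using inj by auto
qed

text \<open>
  The singular set is a cone and is Lebesgue null, and so its trace on the sphere is null.
\<close>

lemma wulff_singular_null:
  fixes f :: "'a::euclidean_space \<Rightarrow> real"
  assumes f: "positive_on_sphere f"
  shows "wulff_singular f \<in> sets borel"
    and "wulff_singular f \<inter> sphere 0 1 \<in> null_sets sphere_measure"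
proof -
  show "wulff_singular f \<in> sets borel"
    unfolding wulff_singular_def by (rule nonunique_face(1)[OF compact_wulff_polar[OF f]])
  have "wulff_singular f \<in> null_sets lborel"
    unfolding wulff_singular_def by (rule nonunique_face(2)[OF compact_wulff_polar[OF f]])
  then have neg: "negligible (wulff_singular f)"
    by (simp add: negligible_iff_null_sets null_sets_completionI)
  show "wulff_singular f \<inter> sphere 0 1 \<in> null_sets sphere_measure"
    by (rule sphere_measure_null[OF _ neg]) (auto simp: wulff_singular_def face_scaleR)
qed

lemma wulff_normal_in_sphere:
  fixes f :: "'a::euclidean_space \<Rightarrow> real"
  assumes "positive_on_sphere f"
  shows "wulff_normal f x \<in> sphere 0 1"
proof (cases "x \<in> wulff_singular f")
  case True
  have eq: "wulff_normal f x = (SOME v. v \<in> sphere 0 1)"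
    unfolding wulff_normal_def using True by (rule if_P)
  have "\<exists>v::'a. v \<in> sphere 0 1" using sphere_nonempty by blast
  from someI_ex[OF this] show ?thesis unfolding eq .
next
  case False
  then have "\<exists>!v. v \<in> wulff_normals f x" using not_singular_iff[OF assms] by blast
  then have "(THE v. v \<in> wulff_normals f x) \<in> wulff_normals f x" by (rule theI')
  then show ?thesis using False by (simp add: wulff_normal_def wulff_normals_def)
qed

lemma wulff_normals_regular:
  fixes f :: "'a::euclidean_space \<Rightarrow> real"
  assumes "positive_on_sphere f" "x \<notin> wulff_singular f"
  shows "wulff_normals f x = {wulff_normal f x}"
proof -
  have ex: "\<exists>!v. v \<in> wulff_normals f x" using not_singular_iff[OF assms(1)] assms(2) by blast
  then have "(THE v. v \<in> wulff_normals f x) \<in> wulff_normals f x" by (rule theI')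
  then show ?thesis using ex assms(2) by (auto simp: wulff_normal_def)
qed

text \<open>
  Away from the unique maximizer, compactness keeps the quotient below its maximum by a fixed
  amount.
\<close>

lemma maximizers_converge:
  fixes f :: "'a::euclidean_space \<Rightarrow> real"
  assumes f: "positive_on_sphere f" and x: "x \<notin> wulff_singular f"
    and w: "\<And>k. w k \<in> sphere 0 1"
    and lim: "(\<lambda>k. (x \<bullet> w k) / f (w k)) \<longlonglongrightarrow> wulff_gauge f x"
  shows "w \<longlonglongrightarrow> wulff_normal f x"
proof (rule metric_LIMSEQ_I)
  fix e :: real assume e: "0 < e"
  let ?T = "sphere 0 1 - ball (wulff_normal f x) e"
  have "\<exists>c < wulff_gauge f x. \<forall>v\<in>?T. (x \<bullet> v) / f v \<le> c"
  proof (cases "?T = {}")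
    case True
    then show ?thesis
      by (intro exI[of _ "wulff_gauge f x - 1"]) (simp only: ball_empty, simp)
  next
    case False
    have cT: "compact ?T" by (simp add: compact_diff)
    have cq: "continuous_on ?T (\<lambda>v. (x \<bullet> v) / f v)"
      by (rule continuous_on_subset[OF continuous_quotient[OF f]]) auto
    obtain v where v: "v \<in> ?T" "\<forall>w\<in>?T. (x \<bullet> w) / f w \<le> (x \<bullet> v) / f v"
      using continuous_attains_sup[OF cT False cq] by blast
    have "v \<notin> wulff_normals f x" using wulff_normals_regular[OF f x] v(1) e by auto
    then have "(x \<bullet> v) / f v \<noteq> wulff_gauge f x" using v(1) by (simp add: wulff_normals_def)
    moreover have "(x \<bullet> v) / f v \<le> wulff_gauge f x" using wulff_gauge_attained(2)[OF f, of v x] v(1) by simp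
    ultimately show ?thesis using v(2) by (intro exI[of _ "(x \<bullet> v) / f v"]) simp
  qed
  then obtain c where c: "c < wulff_gauge f x" "\<And>v. v \<in> ?T \<Longrightarrow> (x \<bullet> v) / f v \<le> c" by blast
  from order_tendstoD(1)[OF lim c(1)]
  obtain k0 where k0: "\<And>k. k \<ge> k0 \<Longrightarrow> c < (x \<bullet> w k) / f (w k)" by (auto simp: eventually_sequentially)
  have "dist (w k) (wulff_normal f x) < e" if "k \<ge> k0" for k
  proof (rule ccontr)
    assume "\<not> ?thesis"
    then have "w k \<in> ?T" using w[of k] by (simp add: dist_commute)
    then show False using c(2) k0[OF that] by fastforce
  qed
  then show "\<exists>no. \<forall>k\<ge>no. dist (w k) (wulff_normal f x) < e" by blast
qed

lemma continuous_wulff_normal: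
  fixes f :: "'a::euclidean_space \<Rightarrow> real"
  assumes f: "positive_on_sphere f"
  shows "continuous_on (- wulff_singular f) (wulff_normal f)"
  unfolding continuous_on_sequentially
proof (intro allI ballI impI)
  fix X :: "nat \<Rightarrow> 'a" and x
  assume x: "x \<in> - wulff_singular f" and X: "(\<forall>n. X n \<in> - wulff_singular f) \<and> X \<longlonglongrightarrow> x"
  obtain m where m: "0 < m" "\<And>v. v \<in> sphere 0 1 \<Longrightarrow> m \<le> f v"
    using positive_on_sphere_lower_bound[OF f] by blast
  let ?w = "\<lambda>k. wulff_normal f (X k)"
  have w: "?w k \<in> sphere 0 1" for k by (rule wulff_normal_in_sphere[OF f])
  have q: "(X k \<bullet> ?w k) / f (?w k) = wulff_gauge f (X k)" for k
  proof -
    have "?w k \<in> wulff_normals f (X k)" using wulff_normals_regular[OF f] X by blast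
    then show ?thesis by (simp add: wulff_normals_def)
  qed
  have bd: "norm ((x \<bullet> ?w k) / f (?w k) - wulff_gauge f x) \<le> 2 * (norm (X k - x) / m)" for k
  proof -
    have "\<bar>(x \<bullet> ?w k) / f (?w k) - (X k \<bullet> ?w k) / f (?w k)\<bar> = \<bar>(X k - x) \<bullet> ?w k\<bar> / f (?w k)"
      using m(1) m(2)[OF w[of k]] by (simp add: inner_diff_left diff_divide_distrib[symmetric] abs_minus_commute)
    also have "\<dots> \<le> norm (X k - x) / f (?w k)"
      using Cauchy_Schwarz_ineq2[of "X k - x" "?w k"] w[of k] m(1) m(2)[OF w[of k]] by (intro divide_right_mono) auto
    also have "\<dots> \<le> norm (X k - x) / m"
      using m(1) m(2)[OF w[of k]] by (intro divide_left_mono) auto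
    finally show ?thesis using wulff_gauge_lipschitz[OF f m, of "X k" x] unfolding q real_norm_def by linarith
  qed
  have "(\<lambda>k. norm (X k - x)) \<longlonglongrightarrow> 0"
    using X by (intro tendsto_norm_zero) (simp add: LIM_zero_iff)
  then have "(\<lambda>k. 2 * (norm (X k - x) / m)) \<longlonglongrightarrow> 2 * (0 / m)"
    using m(1) by (intro tendsto_intros) simp_all
  then have "(\<lambda>k. 2 * (norm (X k - x) / m)) \<longlonglongrightarrow> 0" by simp
  then have "(\<lambda>k. (x \<bullet> ?w k) / f (?w k) - wulff_gauge f x) \<longlonglongrightarrow> 0"
    by (rule Lim_null_comparison[rotated]) (intro always_eventually allI bd)
  then have "(\<lambda>k. (x \<bullet> ?w k) / f (?w k)) \<longlonglongrightarrow> wulff_gauge f x" by (simp add: LIM_zero_iff)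
  then show "(wulff_normal f \<circ> X) \<longlonglongrightarrow> wulff_normal f x"
    unfolding o_def using x by (intro maximizers_converge[OF f _ w]) auto
qed

lemma measurable_wulff_normal:
  fixes f :: "'a::euclidean_space \<Rightarrow> real"
  assumes f: "positive_on_sphere f"
  shows "wulff_normal f \<in> measurable sphere_measure sphere_borel"
proof -
  have "(\<lambda>x. if x \<in> wulff_singular f then (SOME v. v \<in> sphere 0 1) else wulff_normal f x) \<in> borel_measurable borel"
    by (rule borel_measurable_continuous_on_if[OF wulff_singular_null(1)[OF f] continuous_on_const continuous_wulff_normal[OF f]])
  also have "(\<lambda>x. if x \<in> wulff_singular f then (SOME v. v \<in> sphere 0 1) else wulff_normal f x) = wulff_normal f"
    by (auto simp: wulff_normal_def)
  finally have "wulff_normal f \<in> measurable sphere_borel borel" by (rule measurable_restrict_space1)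
  then have "wulff_normal f \<in> measurable sphere_measure borel" by (rule measurable_sphere_measureI)
  moreover have "wulff_normal f \<in> space sphere_measure \<rightarrow> sphere 0 1"
    by (intro Pi_I wulff_normal_in_sphere[OF f])
  ultimately show ?thesis by (intro measurable_restrict_space2)
qed

lemma AE_sphere_regular:
  assumes f: "positive_on_sphere f"
  shows "AE u in sphere_measure. u \<notin> wulff_singular f"
proof -
  have "AE u in sphere_measure. u \<notin> wulff_singular f \<inter> sphere 0 1"
    by (rule AE_not_in[OF wulff_singular_null(2)[OF f]])
  then show ?thesis by (rule AE_mp) (rule AE_I2, simp)
qed

lemma positive_exp_perturbation:
  assumes f: "positive_on_sphere f" and g: "continuous_on (sphere 0 1) g"
  shows "positive_on_sphere (\<lambda>v. f v * exp (t * g v))"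
  using assms unfolding positive_on_sphere_def by (auto intro!: continuous_intros)

text \<open>
  Each of the two maximizers is a competitor in the other maximization problem, which bounds the
  change of the logarithm from both sides.
\<close>

lemma ln_wulff_gauge_perturbation:
  fixes f :: "'a::euclidean_space \<Rightarrow> real"
  assumes f: "positive_on_sphere f" and g: "continuous_on (sphere 0 1) g" and u: "u \<in> sphere 0 1"
    and v: "v \<in> wulff_normals f u" and w: "w \<in> wulff_normals (\<lambda>v. f v * exp (t * g v)) u"
  defines "N \<equiv> wulff_gauge f u" and "Nt \<equiv> wulff_gauge (\<lambda>v. f v * exp (t * g v)) u"
  shows "- t * g v \<le> ln Nt - ln N" "ln Nt - ln N \<le> - t * g w"
    "(u \<bullet> w) / f w = Nt * exp (t * g w)"
proof -
  note ft = positive_exp_perturbation[OF f g, of t]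
  have N: "0 < N" "0 < Nt" unfolding N_def Nt_def by (intro wulff_gauge_pos f ft u)+
  have vw: "v \<in> sphere 0 1" "w \<in> sphere 0 1" "0 < f v" "0 < f w"
    using v w f by (auto simp: wulff_normals_def positive_on_sphere_def)
  have "(u \<bullet> v) / (f v * exp (t * g v)) \<le> Nt"
    unfolding Nt_def by (rule wulff_gauge_attained(2)[OF ft vw(1)])
  then have "((u \<bullet> v) / f v) / exp (t * g v) \<le> Nt" by (simp only: divide_divide_eq_left)
  moreover have "(u \<bullet> v) / f v = N" using v by (simp add: wulff_normals_def N_def)
  ultimately have 1: "N / exp (t * g v) \<le> Nt" by (simp only:)
  have "ln (N / exp (t * g v)) \<le> ln Nt" using 1 N by (subst ln_le_cancel_iff) auto
  then show "- t * g v \<le> ln Nt - ln N" using N by (simp add: ln_div)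
  have w': "(u \<bullet> w) / (f w * exp (t * g w)) = Nt" using w by (simp add: wulff_normals_def Nt_def)
  then show 2: "(u \<bullet> w) / f w = Nt * exp (t * g w)" using vw by (simp add: field_simps)
  have "(u \<bullet> w) / f w \<le> N" unfolding N_def by (rule wulff_gauge_attained(2)[OF f vw(2)])
  then have "ln (Nt * exp (t * g w)) \<le> ln N" unfolding 2 using N by (subst ln_le_cancel_iff) auto
  then show "ln Nt - ln N \<le> - t * g w" using N by (simp add: ln_mult)
qed

lemma ln_wulff_gauge_perturbation_bound:
  fixes f :: "'a::euclidean_space \<Rightarrow> real"
  assumes f: "positive_on_sphere f" and g: "continuous_on (sphere 0 1) g" and u: "u \<in> sphere 0 1"
    and B: "\<And>v. v \<in> sphere 0 1 \<Longrightarrow> \<bar>g v\<bar> \<le> B" and t: "0 \<le> t"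
  shows "\<bar>ln (wulff_gauge (\<lambda>v. f v * exp (t * g v)) u) - ln (wulff_gauge f u)\<bar> \<le> t * B"
proof -
  obtain v where v: "v \<in> wulff_normals f u" using wulff_gauge_attained(1)[OF f, of u] by blast
  obtain w where w: "w \<in> wulff_normals (\<lambda>v. f v * exp (t * g v)) u"
    using wulff_gauge_attained(1)[OF positive_exp_perturbation[OF f g], of t u] by blast
  have "\<bar>g v\<bar> \<le> B" "\<bar>g w\<bar> \<le> B" using v w B by (auto simp: wulff_normals_def)
  then have "t * g v \<le> t * B" "t * - g w \<le> t * B" using t by (intro mult_left_mono; linarith)+
  then show ?thesis using ln_wulff_gauge_perturbation(1,2)[OF f g u v w] by (simp add: abs_le_iff)
qed

text \<open>
  The envelope theorem: only the explicit dependence on \<open>t\<close> at the maximizer counts, since the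
  maximizers of the perturbed problems converge to the unique maximizer.
\<close>

lemma ln_wulff_gauge_derivative:
  fixes f :: "'a::euclidean_space \<Rightarrow> real"
  assumes f: "positive_on_sphere f" and g: "continuous_on (sphere 0 1) g" and u: "u \<in> sphere 0 1"
    and reg: "u \<notin> wulff_singular f" and t: "\<And>k. 0 < t k" "t \<longlonglongrightarrow> 0"
  shows "(\<lambda>k. (ln (wulff_gauge (\<lambda>v. f v * exp (t k * g v)) u) - ln (wulff_gauge f u)) / t k)
           \<longlonglongrightarrow> - g (wulff_normal f u)"
proof -
  let ?N = "wulff_gauge f u" and ?Nt = "\<lambda>k. wulff_gauge (\<lambda>v. f v * exp (t k * g v)) u"
  obtain B where B: "\<And>v. v \<in> sphere 0 1 \<Longrightarrow> \<bar>g v\<bar> \<le> B"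
    using compact_imp_bounded[OF compact_continuous_image[OF g compact_sphere]] unfolding bounded_iff by force
  have N: "0 < ?N" by (rule wulff_gauge_pos[OF f u])
  have Nt: "0 < ?Nt k" for k by (rule wulff_gauge_pos[OF positive_exp_perturbation[OF f g] u])
  have v: "wulff_normal f u \<in> wulff_normals f u" using wulff_normals_regular[OF f reg] by blast
  have "\<forall>k. \<exists>w. w \<in> wulff_normals (\<lambda>v. f v * exp (t k * g v)) u"
    using wulff_gauge_attained(1)[OF positive_exp_perturbation[OF f g]] by blast
  then obtain w where w: "\<forall>k. w k \<in> wulff_normals (\<lambda>v. f v * exp (t k * g v)) u" by (rule choice[THEN exE])
  have ws: "w k \<in> sphere 0 1" for k using w by (simp add: wulff_normals_def)
  note pert = ln_wulff_gauge_perturbation[OF f g u v w[rule_format]]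
  note bound = ln_wulff_gauge_perturbation_bound[OF f g u B less_imp_le[OF t(1)]]
  have lim_t: "(\<lambda>k. t k * B) \<longlonglongrightarrow> 0" using tendsto_mult_left_zero[OF t(2)] by simp
  have "(\<lambda>k. ln (?Nt k) - ln ?N) \<longlonglongrightarrow> 0"
    by (rule Lim_null_comparison[OF _ lim_t]) (use bound in auto)
  then have "(\<lambda>k. ln (?Nt k)) \<longlonglongrightarrow> ln ?N" by (simp add: LIM_zero_iff)
  then have "(\<lambda>k. exp (ln (?Nt k))) \<longlonglongrightarrow> exp (ln ?N)" by (rule tendsto_exp)
  then have 1: "?Nt \<longlonglongrightarrow> ?N" using N Nt by simp
  have "(\<lambda>k. t k * g (w k)) \<longlonglongrightarrow> 0"
  proof (rule Lim_null_comparison[OF _ lim_t], intro always_eventually allI)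
    fix k show "norm (t k * g (w k)) \<le> t k * B"
      using B[OF ws[of k]] t(1)[of k] by (simp add: abs_mult)
  qed
  then have "(\<lambda>k. exp (t k * g (w k))) \<longlonglongrightarrow> exp 0" by (rule tendsto_exp)
  from tendsto_mult[OF 1 this] have "(\<lambda>k. (u \<bullet> w k) / f (w k)) \<longlonglongrightarrow> ?N"
    by (simp add: pert(3))
  then have wlim: "w \<longlonglongrightarrow> wulff_normal f u" by (rule maximizers_converge[OF f reg ws])
  have glim: "(\<lambda>k. - g (w k)) \<longlonglongrightarrow> - g (wulff_normal f u)"
    using g wlim ws wulff_normal_in_sphere[OF f, of u]
    by (intro tendsto_minus) (auto simp: continuous_on_sequentially o_def)
  show ?thesis
  proof (rule tendsto_sandwich[OF _ _ tendsto_const glim])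
    show "\<forall>\<^sub>F k in sequentially. - g (wulff_normal f u) \<le> (ln (?Nt k) - ln ?N) / t k"
      using pert(1) t(1) by (intro always_eventually allI) (simp add: pos_le_divide_eq mult.commute)
    show "\<forall>\<^sub>F k in sequentially. (ln (?Nt k) - ln ?N) / t k \<le> - g (w k)"
      using pert(2) t(1) by (intro always_eventually allI) (simp add: pos_divide_le_eq mult.commute)
  qed
qed

lemma difference_quotient_chain:
  fixes \<Gamma> :: "real \<Rightarrow> real"
  assumes D: "(\<Gamma> has_real_derivative D) (at y)" and y: "Y \<longlonglongrightarrow> y"
    and L: "(\<lambda>k. (Y k - y) / t k) \<longlonglongrightarrow> L"
  shows "(\<lambda>k. (\<Gamma> (Y k) - \<Gamma> y) / t k) \<longlonglongrightarrow> D * L"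
proof -
  obtain q where q: "\<And>z. \<Gamma> z - \<Gamma> y = q z * (z - y)" "isCont q y" "q y = D"
    using D unfolding CARAT_DERIV by blast
  have "(\<lambda>k. q (Y k)) \<longlonglongrightarrow> q y" by (rule isCont_tendsto_compose[OF q(2) y])
  from tendsto_mult[OF this L] show ?thesis by (simp add: q(1,3))
qed

text \<open>
  Differentiation under the integral sign by dominated convergence; the mean value theorem
  provides the bound \<open>C * B\<close> for all difference quotients.
\<close>

lemma integral_difference_quotient:
  fixes \<Gamma> \<Gamma>' :: "'a \<Rightarrow> real \<Rightarrow> real"
  assumes "finite_measure M" and t: "\<And>k. 0 < t k" "\<And>k. t k \<le> 1" "t \<longlonglongrightarrow> 0"
    and y: "\<And>x. x \<in> space M \<Longrightarrow> \<bar>y x\<bar> \<le> A"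
    and Y: "\<And>k x. x \<in> space M \<Longrightarrow> \<bar>Y k x - y x\<bar> \<le> t k * B" and B: "0 \<le> B"
    and D: "\<And>x s. x \<in> space M \<Longrightarrow> (\<Gamma> x has_real_derivative \<Gamma>' x s) (at s)"
    and C: "\<And>x s. x \<in> space M \<Longrightarrow> \<bar>s\<bar> \<le> A + B \<Longrightarrow> \<bar>\<Gamma>' x s\<bar> \<le> C"
    and L: "AE x in M. (\<lambda>k. (Y k x - y x) / t k) \<longlonglongrightarrow> L x"
    and int: "\<And>k. integrable M (\<lambda>x. \<Gamma> x (Y k x))" "integrable M (\<lambda>x. \<Gamma> x (y x))"
    and meas: "(\<lambda>x. \<Gamma>' x (y x) * L x) \<in> borel_measurable M"
  shows "(\<lambda>k. ((\<integral>x. \<Gamma> x (Y k x) \<partial>M) - (\<integral>x. \<Gamma> x (y x) \<partial>M)) / t k) \<longlonglongrightarrow> (\<integral>x. \<Gamma>' x (y x) * L x \<partial>M)"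
proof -
  interpret finite_measure M by fact
  have "(\<lambda>k. \<integral>x. (\<Gamma> x (Y k x) - \<Gamma> x (y x)) / t k \<partial>M) \<longlonglongrightarrow> (\<integral>x. \<Gamma>' x (y x) * L x \<partial>M)"
  proof (rule integral_dominated_convergence[where w="\<lambda>x. C * B"])
    show "(\<lambda>x. (\<Gamma> x (Y k x) - \<Gamma> x (y x)) / t k) \<in> borel_measurable M" for k
      using int by (intro borel_measurable_divide borel_measurable_diff borel_measurable_const) auto
    show "AE x in M. (\<lambda>k. (\<Gamma> x (Y k x) - \<Gamma> x (y x)) / t k) \<longlonglongrightarrow> \<Gamma>' x (y x) * L x"
      using L
    proof (rule AE_mp, intro AE_I2 impI)
      fix x assume x: "x \<in> space M" and lim: "(\<lambda>k. (Y k x - y x) / t k) \<longlonglongrightarrow> L x"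
      have "(\<lambda>k. t k * B) \<longlonglongrightarrow> 0" using tendsto_mult_left_zero[OF t(3)] by simp
      then have "(\<lambda>k. Y k x - y x) \<longlonglongrightarrow> 0"
        by (rule Lim_null_comparison[rotated]) (use Y[OF x] in auto)
      then have "(\<lambda>k. Y k x) \<longlonglongrightarrow> y x" by (simp add: LIM_zero_iff)
      then show "(\<lambda>k. (\<Gamma> x (Y k x) - \<Gamma> x (y x)) / t k) \<longlonglongrightarrow> \<Gamma>' x (y x) * L x"
        using lim by (rule difference_quotient_chain[OF D[OF x]])
    qed
    show "AE x in M. norm ((\<Gamma> x (Y k x) - \<Gamma> x (y x)) / t k) \<le> C * B" for k
    proof (rule AE_I2)
      fix x assume x: "x \<in> space M"
      have tB: "t k * B \<le> B" using t(2)[of k] B by (simp add: mult_left_le_one_le t(1) less_imp_le)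
      have "\<bar>Y k x\<bar> \<le> A + B" "\<bar>y x\<bar> \<le> A + B" using Y[OF x, of k] y[OF x] tB B by linarith+
      then have "norm (\<Gamma> x (Y k x) - \<Gamma> x (y x)) \<le> C * norm (Y k x - y x)"
        using D[OF x] C[OF x]
        by (intro field_differentiable_bound[of "{-(A+B)..A+B}" "\<Gamma> x" "\<Gamma>' x"])
           (auto intro: has_field_derivative_at_within)
      also have "\<dots> \<le> C * (t k * B)"
      proof (rule mult_left_mono)
        have "\<bar>0::real\<bar> \<le> A + B" using y[OF x] B by linarith
        then show "0 \<le> C" using C[OF x] by (meson abs_ge_zero order_trans)
      qed (use Y[OF x] in simp)
      finally show "norm ((\<Gamma> x (Y k x) - \<Gamma> x (y x)) / t k) \<le> C * B"
        using t(1)[of k] by (simp add: pos_divide_le_eq mult_ac)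
    qed
  qed (use meas in simp_all)
  then show ?thesis using int by (simp add: integral_diff)
qed

section \<open>The two functionals and their first variations\<close>

lemma bounded_on_sphere:
  fixes f :: "'a::euclidean_space \<Rightarrow> real"
  assumes "continuous_on (sphere 0 1) f"
  obtains B where "0 \<le> B" "\<And>u. u \<in> sphere 0 1 \<Longrightarrow> \<bar>f u\<bar> \<le> B"
proof -
  obtain B where "\<forall>x\<in>f ` sphere 0 1. norm x \<le> B"
    using compact_imp_bounded[OF compact_continuous_image[OF assms compact_sphere]] unfolding bounded_iff by blast
  then have "\<And>u. u \<in> sphere 0 1 \<Longrightarrow> \<bar>f u\<bar> \<le> max 0 B" by force
  then show ?thesis by (intro that[of "max 0 B"]) simp_all
qed

lemma integrable_continuous_sphere:
  fixes f :: "'a::euclidean_space \<Rightarrow> real"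
  assumes "finite_measure M" "space M = sphere 0 1" "f \<in> borel_measurable M" "continuous_on (sphere 0 1) f"
  shows "integrable M f"
proof -
  obtain B where "0 \<le> B" "\<And>u. u \<in> sphere 0 1 \<Longrightarrow> \<bar>f u\<bar> \<le> B" using bounded_on_sphere[OF assms(4)] by blast
  then show ?thesis
    using assms by (intro finite_measure.integrable_const_bound[where B=B]) (auto intro!: AE_I2)
qed

lemma integrable_sphere_measure:
  fixes f :: "'a::euclidean_space \<Rightarrow> real"
  assumes "continuous_on (sphere 0 1) f"
  shows "integrable sphere_measure f"
  by (intro integrable_continuous_sphere finite_sphere_measure continuous_sphere_measurable assms) simp

lemma space_eq_sphere:
  fixes M :: "'a::euclidean_space measure"
  assumes "sets M = sets sphere_borel"
  shows "space M = sphere 0 1"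
  using sets_eq_imp_space_eq[OF assms] by (simp add: space_restrict_space)

lemma continuous_imp_measurable:
  fixes M :: "'a::euclidean_space measure"
  assumes "sets M = sets sphere_borel" "continuous_on (sphere 0 1) h"
  shows "h \<in> borel_measurable M"
  using continuous_sphere_measurable(1)[OF assms(2)] measurable_cong_sets[OF assms(1) refl] by blast

lemma continuous_imp_integrable:
  fixes h :: "'a::euclidean_space \<Rightarrow> real"
  assumes "finite_measure M" "sets M = sets sphere_borel" "continuous_on (sphere 0 1) h"
  shows "integrable M h"
  by (rule integrable_continuous_sphere[OF assms(1) space_eq_sphere[OF assms(2)] continuous_imp_measurable[OF assms(2,3)] assms(3)])

lemma closed_cap_sets:
  fixes v :: "'a::euclidean_space"
  shows "{u \<in> sphere 0 1. c \<le> u \<bullet> v} \<in> sets sphere_borel"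
proof -
  have "closed (sphere 0 1 \<inter> {u. v \<bullet> u \<ge> c})" by (intro closed_Int closed_sphere closed_halfspace_ge)
  moreover have "{u \<in> sphere 0 1. c \<le> u \<bullet> v} = sphere 0 1 \<inter> {u. v \<bullet> u \<ge> c}" by (auto simp: inner_commute)
  ultimately show ?thesis by (auto simp: sets_sphere_borel)
qed

lemma open_hemisphere_sets:
  fixes v :: "'a::euclidean_space"
  shows "{u \<in> sphere 0 1. 0 < u \<bullet> v} \<in> sets sphere_borel"
proof -
  have "open {u. v \<bullet> u > 0}" by (rule open_halfspace_gt)
  moreover have "{u \<in> sphere 0 1. 0 < u \<bullet> v} = sphere 0 1 \<inter> {u. v \<bullet> u > 0}" by (auto simp: inner_commute)
  ultimately have "{u \<in> sphere 0 1. 0 < u \<bullet> v} \<in> sets borel" by (simp add: borel_open sets.Int)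
  then show ?thesis by (simp add: sets_sphere_borel subset_iff)
qed

locale dual_orlicz =
  fixes G :: "real \<Rightarrow> 'a::euclidean_space \<Rightarrow> real" and \<psi> :: "real \<Rightarrow> real"
  assumes G_cont: "continuous_on ({0..} \<times> sphere 0 1) (\<lambda>(t, u). G t u)"
    and G_diff: "\<And>t u. t > 0 \<Longrightarrow> u \<in> sphere 0 1 \<Longrightarrow> (\<lambda>s. G s u) differentiable (at t)"
    and Gt_cont: "continuous_on ({0<..} \<times> sphere 0 1) (\<lambda>(t, u). deriv (\<lambda>s. G s u) t)"
    and Gt_pos: "\<And>t u. t > 0 \<Longrightarrow> u \<in> sphere 0 1 \<Longrightarrow> deriv (\<lambda>s. G s u) t > 0"
    and Gt_even: "\<And>t u. t > 0 \<Longrightarrow> u \<in> sphere 0 1 \<Longrightarrow> deriv (\<lambda>s. G s u) t = deriv (\<lambda>s. G s (- u)) t"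
    and psi_cont: "continuous_on {0<..} \<psi>"
    and psi_pos: "\<And>s. s > 0 \<Longrightarrow> \<psi> s > 0"
    and psi_infinite: "(\<integral>\<^sup>+ s\<in>{1..}. ennreal (\<psi> s / s) \<partial>lborel) = \<infinity>"
    and psi_finite: "\<And>t. t > 0 \<Longrightarrow> (\<integral>\<^sup>+ s\<in>{0<..t}. ennreal (\<psi> s / s) \<partial>lborel) < \<infinity>"
begin

definition Gt :: "real \<Rightarrow> 'a \<Rightarrow> real" where
  "Gt t u = deriv (\<lambda>s. G s u) t"

definition \<phi> :: "real \<Rightarrow> real" where
  "\<phi> t = (\<integral>s. indicator {0<..t} s *\<^sub>R (\<psi> s / s) \<partial>lborel)"

text \<open>
  The general dual volume of the Wulff shape of \<open>f\<close>.
\<close>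

definition dual_volume :: "('a \<Rightarrow> real) \<Rightarrow> real" where
  "dual_volume f = (\<integral>u. G (1 / wulff_gauge f u) u \<partial>sphere_measure)"

text \<open>
  The density, before division by \<open>\<psi>\<close> and by the dimension, of the curvature measure in the radial
  direction \<open>u\<close>.
\<close>

definition radial_weight :: "('a \<Rightarrow> real) \<Rightarrow> 'a \<Rightarrow> real" where
  "radial_weight f u = Gt (1 / wulff_gauge f u) u * (1 / wulff_gauge f u)"

lemma continuous_G_comp:
  assumes "continuous_on A r" "continuous_on A w" "\<And>x. x \<in> A \<Longrightarrow> 0 \<le> r x" "\<And>x. x \<in> A \<Longrightarrow> w x \<in> sphere 0 1"
  shows "continuous_on A (\<lambda>x. G (r x) (w x))"
proof -
  have "continuous_on A (\<lambda>x. (\<lambda>(t, u). G t u) (r x, w x))"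
    by (rule continuous_on_compose2[OF G_cont]) (use assms in \<open>auto intro!: continuous_on_Pair\<close>)
  then show ?thesis by simp
qed

lemma continuous_Gt_comp:
  assumes "continuous_on A r" "continuous_on A w" "\<And>x. x \<in> A \<Longrightarrow> 0 < r x" "\<And>x. x \<in> A \<Longrightarrow> w x \<in> sphere 0 1"
  shows "continuous_on A (\<lambda>x. Gt (r x) (w x))"
proof -
  have "continuous_on A (\<lambda>x. (\<lambda>(t, u). deriv (\<lambda>s. G s u) t) (r x, w x))"
    by (rule continuous_on_compose2[OF Gt_cont]) (use assms in \<open>auto intro!: continuous_on_Pair\<close>)
  then show ?thesis by (simp add: Gt_def)
qed

lemma G_deriv: "0 < t \<Longrightarrow> u \<in> sphere 0 1 \<Longrightarrow> ((\<lambda>s. G s u) has_real_derivative Gt t u) (at t)"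
  using G_diff unfolding Gt_def by (simp add: DERIV_deriv_iff_real_differentiable)

lemma G_strict_mono:
  assumes "0 \<le> s" "s < t" "u \<in> sphere 0 1"
  shows "G s u < G t u"
proof (rule DERIV_pos_imp_increasing_open[OF \<open>s < t\<close>])
  show "\<exists>y. ((\<lambda>s. G s u) has_real_derivative y) (at x) \<and> 0 < y" if "s < x" for x
    using that assms G_deriv[of x u] Gt_pos[of x u] unfolding Gt_def by (intro exI[of _ "deriv (\<lambda>s. G s u) x"]) simp
  show "continuous_on {s..t} (\<lambda>s. G s u)"
    using assms by (intro continuous_G_comp continuous_on_id continuous_on_const) auto
qed

lemma phi_integrable: "integrable lborel (\<lambda>s. indicator {0<..t} s *\<^sub>R (\<psi> s / s))"
proof (rule integrableI_bounded)
  have "continuous_on {0<..t} (\<lambda>s. \<psi> s / s)"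
    by (intro continuous_on_divide continuous_on_subset[OF psi_cont] continuous_on_id) auto
  then have "(\<lambda>s. indicator {0<..t} s *\<^sub>R (\<psi> s / s)) \<in> borel_measurable borel"
    by (rule borel_measurable_continuous_on_indicator[rotated]) simp
  then show "(\<lambda>s. indicator {0<..t} s *\<^sub>R (\<psi> s / s)) \<in> borel_measurable lborel" by simp
  have "(\<integral>\<^sup>+ s. ennreal (norm (indicator {0<..t} s *\<^sub>R (\<psi> s / s))) \<partial>lborel)
      = (\<integral>\<^sup>+ s\<in>{0<..t}. ennreal (\<psi> s / s) \<partial>lborel)"
    using psi_pos by (intro nn_integral_cong) (auto split: split_indicator simp: less_imp_le)
  also have "\<dots> < \<infinity>"
  proof (cases "0 < t")
    case False
    then have "{0<..t} = {}" by auto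
    then show ?thesis by simp
  qed (rule psi_finite)
  finally show "(\<integral>\<^sup>+ s. ennreal (norm (indicator {0<..t} s *\<^sub>R (\<psi> s / s))) \<partial>lborel) < \<infinity>" .
qed

lemma phi_mono: "s \<le> t \<Longrightarrow> \<phi> s \<le> \<phi> t"
  unfolding \<phi>_def using psi_pos
  by (intro integral_mono phi_integrable) (auto split: split_indicator simp: less_imp_le)

lemma phi_nonneg: "0 \<le> \<phi> t"
  unfolding \<phi>_def using psi_pos
  by (intro Bochner_Integration.integral_nonneg) (auto split: split_indicator simp: less_imp_le)

lemma phi_deriv:
  assumes "0 < t"
  shows "(\<phi> has_real_derivative \<psi> t / t) (at t)"
proof -
  define a where "a = t / 2"
  define b where "b = 2 * t"
  have ab: "0 < a" "a < t" "t < b" using assms by (auto simp: a_def b_def)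
  have cont: "continuous_on {a..b} (\<lambda>s. \<psi> s / s)"
    using ab by (intro continuous_on_divide continuous_on_subset[OF psi_cont] continuous_on_id) auto
  have eq: "\<phi> x = \<phi> a + integral {a..x} (\<lambda>s. \<psi> s / s)" if x: "x \<in> {a..b}" for x
  proof -
    have c: "continuous_on {a..x} (\<lambda>s. \<psi> s / s)" by (rule continuous_on_subset[OF cont]) (use x in auto)
    have i: "integrable lborel (\<lambda>s. indicator {a..x} s *\<^sub>R (\<psi> s / s))"
      by (rule borel_integrable_compact[OF compact_Icc c])
    have "\<phi> x = (\<integral>s. indicator {0<..a} s *\<^sub>R (\<psi> s / s) + indicator {a..x} s *\<^sub>R (\<psi> s / s) \<partial>lborel)"
      unfolding \<phi>_def
    proof (rule integral_cong_AE)
      have "AE s in lborel. s \<noteq> a" by (rule AE_lborel_singleton)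
      then show "AE s in lborel. indicator {0<..x} s *\<^sub>R (\<psi> s / s) =
          indicator {0<..a} s *\<^sub>R (\<psi> s / s) + indicator {a..x} s *\<^sub>R (\<psi> s / s)"
        using x ab by (auto elim!: eventually_mono split: split_indicator)
    qed (use phi_integrable i in \<open>auto intro!: borel_measurable_add\<close>)
    also have "\<dots> = \<phi> a + (\<integral>s. indicator {a..x} s *\<^sub>R (\<psi> s / s) \<partial>lborel)"
      unfolding \<phi>_def by (rule Bochner_Integration.integral_add[OF phi_integrable i])
    also have "(\<integral>s. indicator {a..x} s *\<^sub>R (\<psi> s / s) \<partial>lborel) = integral {a..x} (\<lambda>s. \<psi> s / s)"
      using set_borel_integral_eq_integral(2)[of "{a..x}" "\<lambda>s. \<psi> s / s"] i
      by (simp add: set_integrable_def set_lebesgue_integral_def)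
    finally show ?thesis .
  qed
  have "((\<lambda>x. integral {a..x} (\<lambda>s. \<psi> s / s)) has_real_derivative \<psi> t / t) (at t within {a..b})"
    using ab by (intro integral_has_real_derivative[OF cont]) auto
  then have "((\<lambda>x. \<phi> a + integral {a..x} (\<lambda>s. \<psi> s / s)) has_real_derivative \<psi> t / t) (at t within {a..b})"
    by (auto intro!: derivative_eq_intros)
  then have "((\<lambda>x. \<phi> a + integral {a..x} (\<lambda>s. \<psi> s / s)) has_real_derivative \<psi> t / t) (at t)"
    using ab at_within_Icc_at[of a t b] by simp
  then show ?thesis
  proof (rule has_field_derivative_transform_within_open[of _ _ _ "{a<..<b}"])
    show "\<phi> a + integral {a..x} (\<lambda>s. \<psi> s / s) = \<phi> x" if "x \<in> {a<..<b}" for x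
      using eq[of x] that by simp
  qed (use ab in auto)
qed

lemma phi_continuous: "continuous_on {0<..} \<phi>"
  by (intro continuous_at_imp_continuous_on ballI DERIV_isCont[OF phi_deriv]) simp

lemma phi_unbounded: "\<exists>t>0. X < \<phi> t"
proof (rule ccontr)
  assume "\<not> ?thesis"
  then have le: "\<And>t. 0 < t \<Longrightarrow> \<phi> t \<le> X" by force
  let ?F = "\<lambda>k s. ennreal (\<psi> s / s) * indicator {1..real k} s"
  have meas: "(\<lambda>s. ennreal (\<psi> s / s) * indicator {1..b} s) \<in> borel_measurable lborel" for b
  proof -
    have "continuous_on {1..b} (\<lambda>s. \<psi> s / s)"
      by (intro continuous_on_divide continuous_on_subset[OF psi_cont] continuous_on_id) auto
    then have "(\<lambda>s. indicator {1..b} s *\<^sub>R (\<psi> s / s)) \<in> borel_measurable borel"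
      by (rule borel_measurable_continuous_on_indicator[rotated]) simp
    then have "(\<lambda>s. ennreal (indicator {1..b} s *\<^sub>R (\<psi> s / s))) \<in> borel_measurable lborel" by simp
    also have "(\<lambda>s. ennreal (indicator {1..b} s *\<^sub>R (\<psi> s / s))) = (\<lambda>s. ennreal (\<psi> s / s) * indicator {1..b} s)"
      by (auto split: split_indicator)
    finally show ?thesis .
  qed
  have "(\<lambda>k. \<integral>\<^sup>+s. ?F k s \<partial>lborel) \<longlonglongrightarrow> (\<integral>\<^sup>+ s\<in>{1..}. ennreal (\<psi> s / s) \<partial>lborel)"
  proof (rule nn_integral_LIMSEQ)
    show "incseq ?F" by (auto simp: incseq_def le_fun_def split: split_indicator)
    show "?F k \<in> borel_measurable lborel" for k by (rule meas)
    show "(\<lambda>k. ?F k s) \<longlonglongrightarrow> ennreal (\<psi> s / s) * indicator {1..} s" for s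
    proof (rule tendsto_eventually)
      obtain k0 where k0: "s \<le> real k0" using real_arch_simple by blast
      show "\<forall>\<^sub>F k in sequentially. ?F k s = ennreal (\<psi> s / s) * indicator {1..} s"
        using eventually_ge_at_top[of k0] by (rule eventually_mono) (use k0 in \<open>auto split: split_indicator\<close>)
    qed
  qed
  then have "(\<lambda>k. \<integral>\<^sup>+s. ?F k s \<partial>lborel) \<longlonglongrightarrow> \<infinity>" unfolding psi_infinite .
  moreover have "(\<integral>\<^sup>+s. ?F k s \<partial>lborel) \<le> ennreal X" if "k \<ge> 1" for k
  proof -
    have "(\<integral>\<^sup>+s. ?F k s \<partial>lborel) \<le> (\<integral>\<^sup>+s. ennreal (indicator {0<..real k} s *\<^sub>R (\<psi> s / s)) \<partial>lborel)"
      by (intro nn_integral_mono) (auto split: split_indicator)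
    also have "\<dots> = ennreal (\<phi> (real k))"
      unfolding \<phi>_def using psi_pos
      by (intro nn_integral_eq_integral[OF phi_integrable] AE_I2) (auto split: split_indicator simp: less_imp_le)
    also have "\<dots> \<le> ennreal X" using le[of "real k"] that by (intro ennreal_leI) simp
    finally show ?thesis .
  qed
  ultimately have "\<infinity> \<le> ennreal X"
    by (intro LIMSEQ_le_const2) blast+
  then show False by (simp add: top_unique)
qed

lemma continuous_radial_of_gauge:
  assumes "positive_on_sphere f"
  shows "continuous_on (sphere 0 1) (\<lambda>u. 1 / wulff_gauge f u)"
proof -
  have "\<forall>u\<in>sphere 0 1. wulff_gauge f u \<noteq> 0" using wulff_gauge_pos[OF assms] by force
  then show ?thesis by (intro continuous_on_divide continuous_on_const continuous_wulff_gauge[OF assms])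
qed

lemma continuous_G_gauge:
  assumes "positive_on_sphere f"
  shows "continuous_on (sphere 0 1) (\<lambda>u. G (1 / wulff_gauge f u) u)"
  using wulff_gauge_pos[OF assms]
  by (intro continuous_G_comp continuous_radial_of_gauge[OF assms] continuous_on_id) (simp_all add: less_imp_le)

lemma continuous_radial_weight:
  assumes "positive_on_sphere f"
  shows "continuous_on (sphere 0 1) (radial_weight f)"
  using wulff_gauge_pos[OF assms] unfolding radial_weight_def[abs_def]
  by (intro continuous_on_mult continuous_Gt_comp continuous_radial_of_gauge[OF assms] continuous_on_id) simp_all

lemma radial_weight_pos:
  assumes "positive_on_sphere f" "u \<in> sphere 0 1"
  shows "0 < radial_weight f u"
  using wulff_gauge_pos[OF assms] Gt_pos[of "1 / wulff_gauge f u" u] assms(2)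
  by (simp add: radial_weight_def Gt_def)

lemma measurable_comp_normal:
  assumes f: "positive_on_sphere f" and g: "continuous_on (sphere 0 1) g"
  shows "(\<lambda>u. g (wulff_normal f u)) \<in> borel_measurable sphere_measure"
  using measurable_compose[OF measurable_wulff_normal[OF f] continuous_sphere_measurable(1)[OF g]] .

lemma integrable_Gt_comp_normal:
  assumes f: "positive_on_sphere f" and g: "continuous_on (sphere 0 1) g"
  shows "integrable sphere_measure (\<lambda>u. radial_weight f u * g (wulff_normal f u))"
proof -
  let ?w = "radial_weight f"
  obtain B where B: "0 \<le> B" "\<And>u. u \<in> sphere 0 1 \<Longrightarrow> \<bar>g u\<bar> \<le> B" using bounded_on_sphere[OF g] by blast
  show ?thesis
  proof (rule Bochner_Integration.integrable_bound)
    show "integrable sphere_measure (\<lambda>u. B * ?w u)"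
      by (rule integrable_mult_right[OF integrable_sphere_measure[OF continuous_radial_weight[OF f]]])
    show "(\<lambda>u. ?w u * g (wulff_normal f u)) \<in> borel_measurable sphere_measure"
      by (intro borel_measurable_times[OF continuous_sphere_measurable(2)[OF continuous_radial_weight[OF f]] measurable_comp_normal[OF f g]])
    show "AE u in sphere_measure. norm (?w u * g (wulff_normal f u)) \<le> norm (B * ?w u)"
    proof (rule AE_I2)
      fix u :: 'a
      have "\<bar>g (wulff_normal f u)\<bar> \<le> \<bar>B\<bar>" using B(2)[OF wulff_normal_in_sphere[OF f, of u]] B(1) by simp
      then show "norm (?w u * g (wulff_normal f u)) \<le> norm (B * ?w u)"
        unfolding real_norm_def abs_mult[of B] abs_mult[of _ "g (wulff_normal f u)"]
        by (subst mult.commute) (intro mult_right_mono abs_ge_zero)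
    qed
  qed
qed

text \<open>
  In terms of \<open>ln (1 / wulff_gauge f u)\<close>, whose derivative is \<open>g (wulff_normal f u)\<close> for almost all
  \<open>u\<close>, the claim is an instance of differentiation under the integral sign.
\<close>

lemma dual_volume_variation:
  assumes f: "positive_on_sphere f" and g: "continuous_on (sphere 0 1) g"
    and t: "\<And>k. 0 < t k" "\<And>k. t k \<le> 1" "t \<longlonglongrightarrow> 0"
  shows "(\<lambda>k. (dual_volume (\<lambda>v. f v * exp (t k * g v)) - dual_volume f) / t k) \<longlonglongrightarrow>
    (\<integral>u. radial_weight f u * g (wulff_normal f u) \<partial>sphere_measure)"
proof -
  obtain B where B: "0 \<le> B" "\<And>u. u \<in> sphere 0 1 \<Longrightarrow> \<bar>g u\<bar> \<le> B" using bounded_on_sphere[OF g] by blast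
  define y where "y u = - ln (wulff_gauge f u)" for u
  define Y where "Y k u = - ln (wulff_gauge (\<lambda>v. f v * exp (t k * g v)) u)" for k u
  note ft = positive_exp_perturbation[OF f g]
  have ey: "exp (y u) = 1 / wulff_gauge f u" if "u \<in> sphere 0 1" for u
    using wulff_gauge_pos[OF f that] by (simp add: y_def exp_minus inverse_eq_divide)
  have eY: "exp (Y k u) = 1 / wulff_gauge (\<lambda>v. f v * exp (t k * g v)) u" if "u \<in> sphere 0 1" for k u
    using wulff_gauge_pos[OF ft that] by (simp add: Y_def exp_minus inverse_eq_divide)
  have "\<forall>u\<in>sphere 0 1. wulff_gauge f u \<noteq> 0" using wulff_gauge_pos[OF f] by force
  then have "continuous_on (sphere 0 1) y" unfolding y_def
    by (intro continuous_on_minus continuous_on_ln continuous_wulff_gauge[OF f])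
  then obtain A where A: "0 \<le> A" "\<And>u. u \<in> sphere 0 1 \<Longrightarrow> \<bar>y u\<bar> \<le> A" using bounded_on_sphere by blast
  have "continuous_on ({-(A+B)..A+B} \<times> sphere 0 1) (\<lambda>p. Gt (exp (fst p)) (snd p) * exp (fst p))"
    by (intro continuous_on_mult continuous_Gt_comp continuous_on_exp continuous_on_fst continuous_on_snd continuous_on_id) auto
  then have "bounded ((\<lambda>p. Gt (exp (fst p)) (snd p) * exp (fst p)) ` ({-(A+B)..A+B} \<times> sphere 0 1))"
    by (intro compact_imp_bounded compact_continuous_image compact_Times compact_Icc compact_sphere)
  then obtain C where C: "\<forall>z\<in>(\<lambda>p. Gt (exp (fst p)) (snd p) * exp (fst p)) ` ({-(A+B)..A+B} \<times> sphere 0 1). norm z \<le> C"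
    unfolding bounded_iff by blast
  have vol: "dual_volume f = (\<integral>u. G (exp (y u)) u \<partial>sphere_measure)"
    unfolding dual_volume_def by (intro Bochner_Integration.integral_cong refl) (simp add: ey)
  have vol': "dual_volume (\<lambda>v. f v * exp (t k * g v)) = (\<integral>u. G (exp (Y k u)) u \<partial>sphere_measure)" for k
    unfolding dual_volume_def by (intro Bochner_Integration.integral_cong refl) (simp add: eY)
  have lim: "(\<integral>u. radial_weight f u * g (wulff_normal f u) \<partial>sphere_measure)
     = (\<integral>u. Gt (exp (y u)) u * exp (y u) * g (wulff_normal f u) \<partial>sphere_measure)"
    by (intro Bochner_Integration.integral_cong refl) (simp add: ey radial_weight_def)
  show ?thesis
    unfolding vol vol' lim
  proof (rule integral_difference_quotient[where \<Gamma> = "\<lambda>u s. G (exp s) u" and \<Gamma>' = "\<lambda>u s. Gt (exp s) u * exp s", OF finite_sphere_measure t])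
    show "\<bar>y u\<bar> \<le> A" if "u \<in> space sphere_measure" for u using A(2) that by simp
    show "0 \<le> B" by (rule B(1))
    show "\<bar>Y k u - y u\<bar> \<le> t k * B" if "u \<in> space sphere_measure" for k u
      using ln_wulff_gauge_perturbation_bound[OF f g _ B(2) less_imp_le[OF t(1)], of u k] that
      by (simp add: Y_def y_def abs_minus_commute)
    show "((\<lambda>s. G (exp s) u) has_real_derivative Gt (exp s) u * exp s) (at s)" if "u \<in> space sphere_measure" for u s
      using DERIV_chain2[OF G_deriv[of "exp s" u] DERIV_exp] that by simp
    show "\<bar>Gt (exp s) u * exp s\<bar> \<le> C" if "u \<in> space sphere_measure" "\<bar>s\<bar> \<le> A + B" for u s
    proof -
      have "(s, u) \<in> {-(A+B)..A+B} \<times> sphere 0 1" using that by auto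
      from bspec[OF C imageI[OF this]] show ?thesis by simp
    qed
    show "AE u in sphere_measure. (\<lambda>k. (Y k u - y u) / t k) \<longlonglongrightarrow> g (wulff_normal f u)"
      using AE_sphere_regular[OF f]
    proof (rule AE_mp, intro AE_I2 impI)
      fix u :: 'a assume u: "u \<in> space sphere_measure" "u \<notin> wulff_singular f"
      have "(\<lambda>k. - ((ln (wulff_gauge (\<lambda>v. f v * exp (t k * g v)) u) - ln (wulff_gauge f u)) / t k)) \<longlonglongrightarrow> - (- g (wulff_normal f u))"
        by (intro tendsto_minus ln_wulff_gauge_derivative[OF f g _ u(2) t(1,3)]) (use u in simp)
      then show "(\<lambda>k. (Y k u - y u) / t k) \<longlonglongrightarrow> g (wulff_normal f u)"
        by (simp add: Y_def y_def minus_divide_left)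
    qed
    show "integrable sphere_measure (\<lambda>u. G (exp (Y k u)) u)" for k
      using integrable_sphere_measure[OF continuous_G_gauge[OF ft]]
      by (rule Bochner_Integration.integrable_cong[THEN iffD1, rotated -1]) (simp_all add: eY)
    show "integrable sphere_measure (\<lambda>u. G (exp (y u)) u)"
      using integrable_sphere_measure[OF continuous_G_gauge[OF f]]
      by (rule Bochner_Integration.integrable_cong[THEN iffD1, rotated -1]) (simp_all add: ey)
    have "(\<lambda>u. radial_weight f u * g (wulff_normal f u)) \<in> borel_measurable sphere_measure"
      by (intro borel_measurable_times[OF continuous_sphere_measurable(2)[OF continuous_radial_weight[OF f]] measurable_comp_normal[OF f g]])
    then show "(\<lambda>u. Gt (exp (y u)) u * exp (y u) * g (wulff_normal f u)) \<in> borel_measurable sphere_measure"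
      by (rule measurable_cong[THEN iffD1, rotated]) (simp add: ey radial_weight_def)
  qed
qed

text \<open>
  The perturbation is additive in the logarithm of \<open>f\<close>, and \<open>\<phi>' s * s = \<psi> s\<close>.
\<close>

lemma phi_integral_variation:
  fixes \<mu> :: "'a measure"
  assumes f: "positive_on_sphere f" and g: "continuous_on (sphere 0 1) g"
    and t: "\<And>k. 0 < t k" "\<And>k. t k \<le> 1" "t \<longlonglongrightarrow> 0"
    and \<mu>: "finite_measure \<mu>" "sets \<mu> = sets sphere_borel"
  shows "(\<lambda>k. ((\<integral>v. \<phi> (f v * exp (t k * g v)) \<partial>\<mu>) - (\<integral>v. \<phi> (f v) \<partial>\<mu>)) / t k) \<longlonglongrightarrow> (\<integral>v. \<psi> (f v) * g v \<partial>\<mu>)"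
proof -
  note sp = space_eq_sphere[OF \<mu>(2)]
  note meas = continuous_imp_measurable[OF \<mu>(2)]
  note int = continuous_imp_integrable[OF \<mu>]
  have fpos: "0 < f v" if "v \<in> sphere 0 1" for v using f that by (simp add: positive_on_sphere_def)
  have fc: "continuous_on (sphere 0 1) f" using f by (simp add: positive_on_sphere_def)
  have phic: "continuous_on (sphere 0 1) (\<lambda>v. \<phi> (h v))" if "positive_on_sphere h" for h
    by (rule continuous_on_compose2[OF phi_continuous]) (use that in \<open>auto simp: positive_on_sphere_def\<close>)
  obtain B where B: "0 \<le> B" "\<And>u. u \<in> sphere 0 1 \<Longrightarrow> \<bar>g u\<bar> \<le> B" using bounded_on_sphere[OF g] by blast
  define y where "y v = ln (f v)" for v
  define Y where "Y k v = ln (f v) + t k * g v" for k v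
  have ey: "exp (y v) = f v" "exp (Y k v) = f v * exp (t k * g v)" if "v \<in> sphere 0 1" for k v
    using fpos[OF that] by (simp_all add: y_def Y_def exp_add)
  have "\<forall>v\<in>sphere 0 1. f v \<noteq> 0" using fpos by force
  then have "continuous_on (sphere 0 1) y" unfolding y_def by (intro continuous_on_ln fc)
  then obtain A where A: "0 \<le> A" "\<And>u. u \<in> sphere 0 1 \<Longrightarrow> \<bar>y u\<bar> \<le> A" using bounded_on_sphere by blast
  have "continuous_on {-(A+B)..A+B} (\<lambda>s. \<psi> (exp s))"
    by (rule continuous_on_compose2[OF psi_cont]) (auto intro!: continuous_intros)
  then have "bounded ((\<lambda>s. \<psi> (exp s)) ` {-(A+B)..A+B})"
    by (intro compact_imp_bounded compact_continuous_image compact_Icc)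
  then obtain C where C: "\<forall>z\<in>(\<lambda>s. \<psi> (exp s)) ` {-(A+B)..A+B}. norm z \<le> C"
    unfolding bounded_iff by blast
  have eqs: "(\<integral>v. \<phi> (f v * exp (t k * g v)) \<partial>\<mu>) = (\<integral>v. \<phi> (exp (Y k v)) \<partial>\<mu>)"
    "(\<integral>v. \<phi> (f v) \<partial>\<mu>) = (\<integral>v. \<phi> (exp (y v)) \<partial>\<mu>)"
    "(\<integral>v. \<psi> (f v) * g v \<partial>\<mu>) = (\<integral>v. \<psi> (exp (y v)) * g v \<partial>\<mu>)" for k
    by (intro Bochner_Integration.integral_cong refl; simp add: ey sp)+
  show ?thesis
    unfolding eqs
  proof (rule integral_difference_quotient[where \<Gamma> = "\<lambda>v s. \<phi> (exp s)" and \<Gamma>' = "\<lambda>v s. \<psi> (exp s)", OF \<mu>(1) t])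
    show "\<bar>y u\<bar> \<le> A" if "u \<in> space \<mu>" for u using A(2) that sp by simp
    show "0 \<le> B" by (rule B(1))
    show "\<bar>Y k u - y u\<bar> \<le> t k * B" if "u \<in> space \<mu>" for k u
      using B(2)[of u] that t(1)[of k] by (simp add: Y_def y_def abs_mult sp)
    show "((\<lambda>s. \<phi> (exp s)) has_real_derivative \<psi> (exp s)) (at s)" for s
      using DERIV_chain2[OF phi_deriv[of "exp s"] DERIV_exp[of s]] by simp
    show "\<bar>\<psi> (exp s)\<bar> \<le> C" if "\<bar>s\<bar> \<le> A + B" for s
    proof -
      have "s \<in> {-(A+B)..A+B}" using that by auto
      from bspec[OF C imageI[OF this]] show ?thesis by simp
    qed
    show "AE v in \<mu>. (\<lambda>k. (Y k v - y v) / t k) \<longlonglongrightarrow> g v"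
    proof (rule AE_I2)
      fix v
      have "(Y k v - y v) / t k = g v" for k using t(1)[of k] by (simp add: Y_def y_def)
      then show "(\<lambda>k. (Y k v - y v) / t k) \<longlonglongrightarrow> g v" by simp
    qed
    show "integrable \<mu> (\<lambda>v. \<phi> (exp (Y k v)))" for k
      using int[OF phic[OF positive_exp_perturbation[OF f g]]]
      by (rule Bochner_Integration.integrable_cong[THEN iffD1, rotated -1]) (simp_all add: ey sp)
    show "integrable \<mu> (\<lambda>v. \<phi> (exp (y v)))"
      using int[OF phic[OF f]]
      by (rule Bochner_Integration.integrable_cong[THEN iffD1, rotated -1]) (simp_all add: ey sp)
    have "continuous_on (sphere 0 1) (\<lambda>v. \<psi> (f v))"
      by (rule continuous_on_compose2[OF psi_cont fc]) (use fpos in auto)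
    then have "(\<lambda>v. \<psi> (f v) * g v) \<in> borel_measurable \<mu>" by (intro borel_measurable_times meas g)
    then show "(\<lambda>v. \<psi> (exp (y v)) * g v) \<in> borel_measurable \<mu>"
      by (rule measurable_cong[THEN iffD1, rotated]) (simp add: ey sp)
  qed
qed

end

section \<open>Existence of a minimizer\<close>

text \<open>
  The integral of \<open>max 0 (u \<bullet> v)\<close> is continuous in \<open>v\<close> and therefore bounded below by a positive
  constant on the sphere. A cap with small \<open>c\<close> must carry half of that amount, as the remainder of
  the sphere contributes at most \<open>c\<close> times the total mass.
\<close>

lemma not_concentrated_uniform:
  fixes \<mu> :: "'a::euclidean_space measure"
  assumes fin: "finite_measure \<mu>" and sets: "sets \<mu> = sets sphere_borel"
    and nc: "not_concentrated_on_hemisphere \<mu>"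
  obtains c m where "0 < c" "0 < m" "\<And>v. v \<in> sphere 0 1 \<Longrightarrow> m \<le> measure \<mu> {u \<in> sphere 0 1. c \<le> u \<bullet> v}"
proof -
  interpret finite_measure \<mu> by fact
  note sp = space_eq_sphere[OF sets]
  note int = continuous_imp_integrable[OF fin sets]
  have intp: "integrable \<mu> (\<lambda>u. max 0 (u \<bullet> v))" for v
    by (intro int continuous_intros)
  let ?T = "measure \<mu> (space \<mu>)"
  define J where "J v = (\<integral>u. max 0 (u \<bullet> v) \<partial>\<mu>)" for v
  have lip: "J v \<le> J w + ?T * norm (v - w)" for v w
  proof -
    have "J v \<le> (\<integral>u. max 0 (u \<bullet> w) + norm (v - w) \<partial>\<mu>)"
      unfolding J_def
    proof (rule integral_mono[OF intp])
      show "integrable \<mu> (\<lambda>u. max 0 (u \<bullet> w) + norm (v - w))" by (intro Bochner_Integration.integrable_add intp) simp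
      fix u assume "u \<in> space \<mu>"
      then have "u \<bullet> (v - w) \<le> norm (v - w)" using norm_cauchy_schwarz[of u "v - w"] sp by simp
      then show "max 0 (u \<bullet> v) \<le> max 0 (u \<bullet> w) + norm (v - w)"
        using norm_ge_zero[of "v - w"] unfolding inner_diff_right by linarith
    qed
    also have "\<dots> = J w + ?T * norm (v - w)"
      unfolding J_def by (subst Bochner_Integration.integral_add[OF intp]) simp_all
    finally show ?thesis .
  qed
  have T0: "0 \<le> ?T" by simp
  have "\<bar>J v - J w\<bar> \<le> ?T * norm (v - w)" for v w
    using lip[of v w] lip[of w v] by (simp add: norm_minus_commute abs_le_iff)
  then have "continuous_on (sphere 0 1) J" by (rule continuous_on_lipschitz[OF T0])
  then obtain v0 where v0: "v0 \<in> sphere 0 1" "\<And>v. v \<in> sphere 0 1 \<Longrightarrow> J v0 \<le> J v"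
    using continuous_attains_inf[OF compact_sphere sphere_nonempty] by blast
  have J0: "0 < J v0" using nc v0(1) by (simp add: not_concentrated_on_hemisphere_def J_def)
  define c where "c = J v0 / (2 * (?T + 1))"
  have c: "0 < c" unfolding c_def using J0 T0 by (intro divide_pos_pos mult_pos_pos) linarith+
  have cT: "c * ?T \<le> J v0 / 2"
  proof -
    have "c * ?T \<le> c * (?T + 1)" using c by (intro mult_left_mono) simp_all
    also have "c * (?T + 1) = J v0 / 2"
    proof -
      have "?T + 1 \<noteq> 0" using T0 by linarith
      then have "J v0 / (2 * (?T + 1)) * (?T + 1) = J v0 / 2" by (simp add: divide_simps)
      then show ?thesis unfolding c_def .
    qed
    finally show ?thesis .
  qed
  show ?thesis
  proof (rule that[of c "J v0 / 2"])
    fix v :: 'a assume v: "v \<in> sphere 0 1"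
    let ?E = "{u \<in> sphere 0 1. c \<le> u \<bullet> v}"
    have E: "?E \<in> sets \<mu>" unfolding sets by (rule closed_cap_sets)
    have "J v \<le> (\<integral>u. c + indicator ?E u \<partial>\<mu>)"
      unfolding J_def
    proof (rule integral_mono[OF intp])
      show "integrable \<mu> (\<lambda>u. c + indicator ?E u)" using E by (intro Bochner_Integration.integrable_add) (simp_all add: emeasure_eq_measure)
      fix u assume u: "u \<in> space \<mu>"
      then have "u \<bullet> v \<le> 1" using norm_cauchy_schwarz[of u v] sp v by simp
      then show "max 0 (u \<bullet> v) \<le> c + indicator ?E u"
        using u sp c by (auto simp: indicator_def)
    qed
    also have "\<dots> = c * ?T + measure \<mu> ?E"
      using E by (subst Bochner_Integration.integral_add) (simp_all add: emeasure_eq_measure)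
    finally show "J v0 / 2 \<le> measure \<mu> ?E" using v0(2)[OF v] cT by linarith
  qed (use c J0 in simp_all)
qed

lemma wulff_gauge_one:
  fixes u :: "'a::euclidean_space"
  assumes "u \<in> sphere 0 1"
  shows "wulff_gauge (\<lambda>_. 1) u = 1"
proof (rule wulff_gauge_eqI[OF assms])
  show "(u \<bullet> u) / 1 = 1" using assms by (simp add: dot_square_norm)
  show "(u \<bullet> w) / 1 \<le> 1" if "w \<in> sphere 0 1" for w using norm_cauchy_schwarz[of u w] that assms by simp
qed

lemma support_fun_uminus:
  fixes K :: "'a::euclidean_space set"
  assumes "K = uminus ` K"
  shows "support_fun K (- v) = support_fun K v"
proof -
  have "(\<lambda>x. - v \<bullet> x) ` K = (\<lambda>x. v \<bullet> x) ` uminus ` K" by (simp add: image_image)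
  then show ?thesis unfolding support_fun_def using assms by simp
qed

lemma wulff_symmetric:
  fixes f :: "'a::euclidean_space \<Rightarrow> real"
  assumes "\<And>v. v \<in> sphere 0 1 \<Longrightarrow> f (- v) = f v"
  shows "wulff f = uminus ` wulff f"
proof -
  have sub: "- x \<in> wulff f" if x: "x \<in> wulff f" for x
    unfolding wulff_def
  proof (intro CollectI ballI)
    fix v :: 'a assume v: "v \<in> sphere 0 1"
    then have "- v \<in> sphere 0 1" by simp
    then have "x \<bullet> (- v) \<le> f (- v)" using x unfolding wulff_def by blast
    then show "- x \<bullet> v \<le> f v" using assms[OF v] by simp
  qed
  show ?thesis
  proof
    show "wulff f \<subseteq> uminus ` wulff f"
    proof
      fix x assume "x \<in> wulff f"
      then have "- x \<in> wulff f" by (rule sub)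
      then show "x \<in> uminus ` wulff f" by (rule rev_image_eqI) simp
    qed
  qed (use sub in blast)
qed

locale dual_orlicz_minkowski = dual_orlicz G \<psi>
  for G :: "real \<Rightarrow> 'a::euclidean_space \<Rightarrow> real" and \<psi> :: "real \<Rightarrow> real" +
  fixes \<mu> :: "'a measure"
  assumes \<mu>_finite: "finite_measure \<mu>" and \<mu>_sets: "sets \<mu> = sets sphere_borel"
    and \<mu>_nc: "not_concentrated_on_hemisphere \<mu>"
begin

text \<open>
  An inequality instead of the equation for the volume spares rescaling the competitors to a
  prescribed volume.
\<close>

definition feasible :: "('a \<Rightarrow> real) \<Rightarrow> bool" where
  "feasible f \<longleftrightarrow> positive_on_sphere f \<and> (\<forall>v\<in>sphere 0 1. f (- v) = f v) \<and> dual_volume (\<lambda>_. 1) \<le> dual_volume f"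

definition cost :: "('a \<Rightarrow> real) \<Rightarrow> real" where
  "cost f = (\<integral>v. \<phi> (f v) \<partial>\<mu>)"

lemmas \<mu>_space = space_eq_sphere[OF \<mu>_sets]
lemmas \<mu>_measurable = continuous_imp_measurable[OF \<mu>_sets]
lemmas \<mu>_integrable = continuous_imp_integrable[OF \<mu>_finite \<mu>_sets]

lemma continuous_phi: "positive_on_sphere h \<Longrightarrow> continuous_on (sphere 0 1) (\<lambda>v. \<phi> (h v))"
  by (rule continuous_on_compose2[OF phi_continuous]) (auto simp: positive_on_sphere_def)

lemma cost_mono:
  assumes "positive_on_sphere f" "positive_on_sphere g" "\<And>v. v \<in> sphere 0 1 \<Longrightarrow> f v \<le> g v"
  shows "cost f \<le> cost g"
  unfolding cost_def using assms(3) \<mu>_space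
  by (intro integral_mono \<mu>_integrable continuous_phi assms phi_mono) auto

lemma feasible_one: "feasible (\<lambda>_. 1)"
  by (simp add: feasible_def positive_on_sphere_def)

lemma dual_volume_support_fun_wulff:
  assumes "positive_on_sphere f"
  shows "dual_volume (support_fun (wulff f)) = dual_volume f"
  unfolding dual_volume_def
  by (intro Bochner_Integration.integral_cong refl) (simp add: wulff_gauge_support_fun_wulff[OF assms])

lemma feasible_support_fun_wulff:
  assumes "feasible f"
  shows "feasible (support_fun (wulff f))" "cost (support_fun (wulff f)) \<le> cost f"
proof -
  have f: "positive_on_sphere f" "\<And>v. v \<in> sphere 0 1 \<Longrightarrow> f (- v) = f v" "dual_volume (\<lambda>_. 1) \<le> dual_volume f"
    using assms by (auto simp: feasible_def)
  note p = positive_support_fun[OF wulff_convex_body[OF f(1)]]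
  show "feasible (support_fun (wulff f))"
    unfolding feasible_def
    using p f(3) support_fun_uminus[OF wulff_symmetric[of f, OF f(2)]] dual_volume_support_fun_wulff[OF f(1)] by simp
  show "cost (support_fun (wulff f)) \<le> cost f"
    by (intro cost_mono p f(1) support_fun_wulff_le)
qed

text \<open>
  A point \<open>x\<close> of the Wulff shape forces \<open>f u \<ge> x \<bullet> u\<close>, which is large on a cap of uniformly
  positive measure when \<open>x\<close> is long; as \<open>\<phi>\<close> is unbounded, the cost is then large.
\<close>

lemma bounded_sublevel:
  obtains R where "0 < R" "\<And>f. feasible f \<Longrightarrow> cost f \<le> X \<Longrightarrow> wulff f \<subseteq> cball 0 R"
proof -
  obtain c m where cm: "0 < c" "0 < m" "\<And>v. v \<in> sphere 0 1 \<Longrightarrow> m \<le> measure \<mu> {u \<in> sphere 0 1. c \<le> u \<bullet> v}"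
    using not_concentrated_uniform[OF \<mu>_finite \<mu>_sets \<mu>_nc] by blast
  obtain t where t: "0 < t" "X / m < \<phi> t" using phi_unbounded by blast
  show ?thesis
  proof (rule that[of "t / c"])
    show "0 < t / c" using t cm by simp
    fix f assume f: "feasible f" "cost f \<le> X"
    then have pf: "positive_on_sphere f" by (simp add: feasible_def)
    show "wulff f \<subseteq> cball 0 (t / c)"
    proof
      fix x assume x: "x \<in> wulff f"
      show "x \<in> cball 0 (t / c)"
      proof (rule ccontr)
        assume "x \<notin> cball 0 (t / c)"
        then have nx: "t / c < norm x" by simp
        then have tc: "t < c * norm x" using cm(1) by (simp add: pos_divide_less_eq mult.commute)
        have x0: "0 < norm x" using nx t cm by (meson divide_pos_pos less_trans)
        define v where "v = (1 / norm x) *\<^sub>R x"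
        have v: "v \<in> sphere 0 1" using x0 by (simp add: v_def)
        let ?E = "{u \<in> sphere 0 1. c \<le> u \<bullet> v}"
        have E: "?E \<in> sets \<mu>" unfolding \<mu>_sets by (rule closed_cap_sets)
        have "\<phi> t * m \<le> \<phi> t * measure \<mu> ?E" by (intro mult_left_mono cm(3) v phi_nonneg)
        also have "\<dots> = (\<integral>u. \<phi> t * indicator ?E u \<partial>\<mu>)" using E by simp
        also have "\<dots> \<le> cost f"
          unfolding cost_def
        proof (rule integral_mono)
          show "integrable \<mu> (\<lambda>u. \<phi> t * indicator ?E u)"
            using E finite_measure.emeasure_finite[OF \<mu>_finite] by (intro integrable_mult_right integrable_real_indicator) (simp_all add: top.not_eq_extremum)
          show "integrable \<mu> (\<lambda>v. \<phi> (f v))" by (intro \<mu>_integrable continuous_phi pf)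
          fix u assume u: "u \<in> space \<mu>"
          show "\<phi> t * indicator ?E u \<le> \<phi> (f u)"
          proof (cases "u \<in> ?E")
            case True
            have "c * norm x \<le> (u \<bullet> v) * norm x" using True x0 by (intro mult_right_mono) auto
            also have "\<dots> = x \<bullet> u" using x0 by (simp add: v_def inner_commute)
            also have "\<dots> \<le> f u" using x True by (simp add: wulff_def)
            finally have "\<phi> t \<le> \<phi> (f u)" using tc by (intro phi_mono) linarith
            then show ?thesis using True by simp
          qed (use phi_nonneg in simp)
        qed
        finally have "\<phi> t * m \<le> X" using f(2) by linarith
        moreover have "X < \<phi> t * m" using t(2) cm(2) by (simp add: pos_divide_less_eq)
        ultimately show False by linarith
      qed
    qed
  qed
qed

lemma integral_G_tendsto:
  assumes r: "\<And>k. continuous_on (sphere 0 1) (r k)" "\<And>k u. u \<in> sphere 0 1 \<Longrightarrow> 0 \<le> r k u \<and> r k u \<le> R"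
    and s: "continuous_on (sphere 0 1) s" "\<And>u. u \<in> sphere 0 1 \<Longrightarrow> 0 \<le> s u"
    and lim: "AE u in sphere_measure. (\<lambda>k. r k u) \<longlonglongrightarrow> s u"
  shows "(\<lambda>k. \<integral>u. G (r k u) u \<partial>sphere_measure) \<longlonglongrightarrow> (\<integral>u. G (s u) u \<partial>sphere_measure)"
proof -
  have "continuous_on ({0..R} \<times> sphere 0 1) (\<lambda>p. G (fst p) (snd p))"
    by (intro continuous_G_comp continuous_on_fst continuous_on_snd continuous_on_id) auto
  then have "bounded ((\<lambda>p. G (fst p) (snd p)) ` ({0..R} \<times> sphere 0 1))"
    by (intro compact_imp_bounded compact_continuous_image compact_Times compact_Icc compact_sphere)
  then obtain C where C: "\<forall>z\<in>(\<lambda>p. G (fst p) (snd p)) ` ({0..R} \<times> sphere 0 1). norm z \<le> C"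
    unfolding bounded_iff by blast
  interpret finite_measure "sphere_measure :: 'a measure" by (rule finite_sphere_measure)
  show ?thesis
  proof (rule integral_dominated_convergence[where w="\<lambda>_. C"])
    show "(\<lambda>u. G (s u) u) \<in> borel_measurable sphere_measure"
      by (intro continuous_sphere_measurable continuous_G_comp s continuous_on_id)
    show "(\<lambda>u. G (r k u) u) \<in> borel_measurable sphere_measure" for k
      using r(2) by (intro continuous_sphere_measurable continuous_G_comp r(1) continuous_on_id) blast+
    show "AE u in sphere_measure. (\<lambda>k. G (r k u) u) \<longlonglongrightarrow> G (s u) u"
      using lim
    proof (rule AE_mp, intro AE_I2 impI)
      fix u :: 'a assume u: "u \<in> space sphere_measure" and l: "(\<lambda>k. r k u) \<longlonglongrightarrow> s u"
      have cG: "continuous_on {0..} (\<lambda>t. G t u)"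
        using u by (intro continuous_G_comp continuous_on_id continuous_on_const) auto
      have "s u \<in> {0..}" "\<And>k. r k u \<in> {0..}" using r(2) s(2) u by auto
      then show "(\<lambda>k. G (r k u) u) \<longlonglongrightarrow> G (s u) u"
        by (intro continuous_on_tendsto_compose[OF cG l] always_eventually allI)
    qed
    show "AE u in sphere_measure. norm (G (r k u) u) \<le> C" for k
    proof (rule AE_I2)
      fix u :: 'a assume "u \<in> space sphere_measure"
      then have "(r k u, u) \<in> {0..R} \<times> sphere 0 1" using r(2) by auto
      from bspec[OF C imageI[OF this]] show "norm (G (r k u) u) \<le> C" by simp
    qed
  qed simp
qed

lemma hyperplane_sphere_null:
  fixes v0 :: 'a
  assumes "v0 \<noteq> 0"
  shows "AE u in sphere_measure. u \<bullet> v0 \<noteq> 0"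
proof -
  have "{u \<in> sphere 0 1. u \<bullet> v0 = 0} \<in> null_sets sphere_measure"
  proof (rule sphere_measure_null[where N="{u. v0 \<bullet> u = 0}"])
    show "negligible {u. v0 \<bullet> u = 0}" using assms by (intro negligible_hyperplane) simp
  qed (auto simp: inner_commute)
  from AE_not_in[OF this] show ?thesis
    by (rule AE_mp) (rule AE_I2, simp)
qed

lemma sphere_measure_positive: "0 < measure sphere_measure (sphere 0 1 :: 'a set)"
proof -
  interpret finite_measure "sphere_measure :: 'a measure" by (rule finite_sphere_measure)
  obtain v :: 'a where v: "v \<in> sphere 0 1" using sphere_nonempty by blast
  have "0 < emeasure sphere_measure (sphere 0 1 \<inter> ball v 1)" by (rule sphere_measure_cap_pos[OF v]) simp
  also have "\<dots> \<le> emeasure sphere_measure (space (sphere_measure :: 'a measure))"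
    by (rule emeasure_space)
  finally show ?thesis by (simp add: emeasure_eq_measure)
qed

text \<open>
  The constraint excludes degenerate limits: the volume of a degenerate body is the integral of
  \<open>G 0\<close>.
\<close>

lemma dual_volume_one_gt: "(\<integral>u. G 0 u \<partial>sphere_measure) < dual_volume (\<lambda>_. 1)"
proof -
  have c0: "continuous_on (sphere 0 1) (\<lambda>u. G 0 u)" and c1: "continuous_on (sphere 0 1) (\<lambda>u. G 1 u)"
    by (intro continuous_G_comp continuous_on_const continuous_on_id; simp)+
  have "(\<integral>u. G 0 u \<partial>sphere_measure) < (\<integral>u. G 1 u \<partial>sphere_measure)"
  proof (rule finite_measure.integral_less_AE_space[OF finite_sphere_measure integrable_sphere_measure[OF c0] integrable_sphere_measure[OF c1]])
    show "AE u in sphere_measure. G 0 u < G 1 u" by (rule AE_I2) (simp add: G_strict_mono)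
    show "emeasure sphere_measure (space (sphere_measure :: 'a measure)) \<noteq> 0"
      using sphere_measure_positive by (auto simp: measure_def)
  qed
  also have "\<dots> = dual_volume (\<lambda>_. 1)"
    unfolding dual_volume_def by (intro Bochner_Integration.integral_cong refl) (simp add: wulff_gauge_one)
  finally show ?thesis .
qed

text \<open>
  The support functions of the Wulff shapes of a minimizing sequence are again minimizing, and by
  \<open>bounded_sublevel\<close> they are uniformly Lipschitz, so a subsequence converges uniformly by the
  theorem of Arzela and Ascoli. If the limit vanished in some direction \<open>v0\<close>, symmetry would squeeze
  the Wulff shapes onto the hyperplane orthogonal to \<open>v0\<close>; the radial functions would tend to 0
  almost everywhere and the volumes to a value smaller than the required one. So the limit is
  positive, and both functionals pass to the limit.
\<close>

lemma minimizer_exists: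
  obtains K where "K \<in> convex_bodies_os" "feasible (support_fun K)"
    "\<And>f. feasible f \<Longrightarrow> cost (support_fun K) \<le> cost f"
proof -
  define I where "I = Inf (cost ` Collect feasible)"
  have cost0: "0 \<le> cost f" for f
    unfolding cost_def by (intro Bochner_Integration.integral_nonneg phi_nonneg)
  have bb: "bdd_below (cost ` Collect feasible)" using cost0 by (intro bdd_belowI[of _ 0]) auto
  have ne: "cost ` Collect feasible \<noteq> {}" using feasible_one by blast
  have I: "I \<le> cost f" if "feasible f" for f
    unfolding I_def using that by (intro cInf_lower bb) auto
  have "\<forall>i::nat. \<exists>f. feasible f \<and> cost f < I + 1 / (real i + 1)"
  proof
    fix i :: nat
    have "Inf (cost ` Collect feasible) < I + 1 / (real i + 1)" by (simp add: I_def)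
    from cInf_lessD[OF ne this] show "\<exists>f. feasible f \<and> cost f < I + 1 / (real i + 1)" by blast
  qed
  then obtain F where F: "\<forall>i. feasible (F i) \<and> cost (F i) < I + 1 / (real i + 1)" by (rule choice[THEN exE])
  define h where "h i = support_fun (wulff (F i))" for i
  have hf: "feasible (h i)" and hc: "cost (h i) < I + 1 / (real i + 1)" for i
    using F[rule_format, of i] feasible_support_fun_wulff[of "F i"] unfolding h_def by auto
  obtain R where R: "0 < R" "\<And>f. feasible f \<Longrightarrow> cost f \<le> I + 1 \<Longrightarrow> wulff f \<subseteq> cball 0 R"
    using bounded_sublevel[of "I + 1"] by blast
  have KR: "wulff (F i) \<subseteq> cball 0 R" for i
  proof (rule R(2))
    have "1 / (real i + 1) \<le> 1" by simp
    then show "cost (F i) \<le> I + 1" using F[rule_format, of i] by linarith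
  qed (use F in blast)
  have body: "wulff (F i) \<in> convex_bodies_o" for i
    using F by (intro wulff_convex_body) (simp add: feasible_def)
  have lip: "\<bar>h i v - h i w\<bar> \<le> R * norm (v - w)" for i v w
    unfolding h_def by (rule support_fun_lipschitz[OF body KR])
  have h0: "h i 0 = 0" for i
  proof -
    have "wulff (F i) \<noteq> {}" using body[of i] interior_subset by (auto simp: convex_bodies_o_def)
    then show ?thesis by (simp add: h_def support_fun_def)
  qed
  have hR: "norm (h i v) \<le> R" if "v \<in> sphere 0 1" for i v
    using lip[of i v 0] that by (simp add: h0)
  obtain hh k where hh: "continuous_on (sphere 0 1) hh" "strict_mono (k :: nat \<Rightarrow> nat)"
      "\<And>e. 0 < e \<Longrightarrow> \<exists>N. \<forall>n x. n \<ge> N \<and> x \<in> sphere 0 1 \<longrightarrow> norm (h (k n) x - hh x) < e"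
  proof (rule Arzela_Ascoli[of "sphere 0 1" h R])
    show "\<exists>d>0. \<forall>n y. y \<in> sphere 0 1 \<and> norm (x - y) < d \<longrightarrow> norm (h n x - h n y) < e" if "0 < e" for x e
    proof (intro exI[of _ "e / R"] conjI allI impI)
      fix n y assume "y \<in> sphere 0 1 \<and> norm (x - y) < e / R"
      then have "R * norm (x - y) < e" using R(1) by (simp add: pos_less_divide_eq mult.commute)
      then show "norm (h n x - h n y) < e" using lip[of n x y] by simp
    qed (use that R(1) in simp)
  qed (use hR in auto)
  define H where "H n = h (k n)" for n
  have Hf: "feasible (H n)" for n by (simp add: H_def hf)
  have Hp: "positive_on_sphere (H n)" and Heven: "\<And>v. v \<in> sphere 0 1 \<Longrightarrow> H n (- v) = H n v"
    and Hvol: "dual_volume (\<lambda>_. 1) \<le> dual_volume (H n)" for n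
    using Hf[of n] by (auto simp: feasible_def)
  have HR: "\<bar>H n v\<bar> \<le> R" if "v \<in> sphere 0 1" for n v using hR[OF that, of "k n"] by (simp add: H_def)
  have lim: "(\<lambda>n. H n v) \<longlonglongrightarrow> hh v" if "v \<in> sphere 0 1" for v
  proof (rule LIMSEQ_I)
    fix r :: real assume "0 < r"
    from hh(3)[OF this] show "\<exists>no. \<forall>n\<ge>no. norm (H n v - hh v) < r" using that unfolding H_def by blast
  qed
  have Hpos: "0 < H n v" if "v \<in> sphere 0 1" for n v using Hp that by (simp add: positive_on_sphere_def)
  have hh0: "0 \<le> hh v" if "v \<in> sphere 0 1" for v
    by (rule LIMSEQ_le_const[OF lim[OF that]]) (use Hpos[OF that] in \<open>auto intro: less_imp_le\<close>)
  have hheven: "hh (- v) = hh v" if v: "v \<in> sphere 0 1" for v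
  proof -
    have "- v \<in> sphere 0 1" using v by simp
    from lim[OF this] have "(\<lambda>n. H n v) \<longlonglongrightarrow> hh (- v)" using Heven[OF v] by simp
    then show ?thesis using lim[OF v] by (rule LIMSEQ_unique)
  qed
  have rad: "continuous_on (sphere 0 1) (\<lambda>u. 1 / wulff_gauge (H n) u)" for n
    by (rule continuous_radial_of_gauge[OF Hp])
  have radR: "0 \<le> 1 / wulff_gauge (H n) u \<and> 1 / wulff_gauge (H n) u \<le> R" if u: "u \<in> sphere 0 1" for n u
  proof -
    have "1 / R \<le> 1 / H n u" using HR[OF u, of n] Hpos[OF u, of n] by (intro divide_left_mono) auto
    also have "\<dots> \<le> wulff_gauge (H n) u" by (rule wulff_gauge_ge[OF Hp u])
    finally have "1 / R \<le> wulff_gauge (H n) u" .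
    then show ?thesis using R(1) wulff_gauge_pos[OF Hp u, of n] by (simp add: field_simps)
  qed
  have hhpos: "0 < hh v0" if v0: "v0 \<in> sphere 0 1" for v0
  proof (rule ccontr)
    assume "\<not> 0 < hh v0"
    then have z: "hh v0 = 0" using hh0[OF v0] by linarith
    have "v0 \<noteq> 0" using v0 by auto
    from hyperplane_sphere_null[OF this]
    have "AE u in sphere_measure. (\<lambda>n. 1 / wulff_gauge (H n) u) \<longlonglongrightarrow> 0"
    proof (rule AE_mp)
      show "AE u in sphere_measure. u \<bullet> v0 \<noteq> 0 \<longrightarrow> (\<lambda>n. 1 / wulff_gauge (H n) u) \<longlonglongrightarrow> 0"
      proof (intro AE_I2 impI)
        fix u :: 'a assume "u \<in> space sphere_measure" and uv: "u \<bullet> v0 \<noteq> 0"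
        then have u: "u \<in> sphere 0 1" by simp
        have bd: "norm (1 / wulff_gauge (H n) u) \<le> H n v0 * (1 / \<bar>u \<bullet> v0\<bar>)" for n
        proof -
          have "\<bar>u \<bullet> v0\<bar> / H n v0 \<le> wulff_gauge (H n) u"
          proof (cases "0 \<le> u \<bullet> v0")
            case True
            then show ?thesis using wulff_gauge_attained(2)[OF Hp v0, of u n] by simp
          next
            case False
            have "- v0 \<in> sphere 0 1" using v0 by simp
            from wulff_gauge_attained(2)[OF Hp this, of u n] show ?thesis using False Heven[OF v0] by simp
          qed
          then show ?thesis
            using wulff_gauge_pos[OF Hp u, of n] Hpos[OF v0, of n] uv by (simp add: field_simps)
        qed
        have l0: "(\<lambda>n. H n v0 * (1 / \<bar>u \<bullet> v0\<bar>)) \<longlonglongrightarrow> 0"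
          using tendsto_mult_right[OF lim[OF v0], of "1 / \<bar>u \<bullet> v0\<bar>"] z by (simp add: mult.commute)
        show "(\<lambda>n. 1 / wulff_gauge (H n) u) \<longlonglongrightarrow> 0"
          by (rule Lim_null_comparison[OF always_eventually[OF allI[OF bd]] l0])
      qed
    qed
    then have "(\<lambda>n. dual_volume (H n)) \<longlonglongrightarrow> (\<integral>u. G 0 u \<partial>sphere_measure)"
      unfolding dual_volume_def by (intro integral_G_tendsto[OF rad radR] continuous_on_const) auto
    then have "dual_volume (\<lambda>_. 1) \<le> (\<integral>u. G 0 u \<partial>sphere_measure)"
      by (rule LIMSEQ_le_const) (use Hvol in auto)
    then show False using dual_volume_one_gt by linarith
  qed
  have hhp: "positive_on_sphere hh" using hh(1) hhpos by (simp add: positive_on_sphere_def)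
  obtain m where m: "0 < m" "\<And>v. v \<in> sphere 0 1 \<Longrightarrow> m \<le> hh v"
    using positive_on_sphere_lower_bound[OF hhp] by blast
  have gauge_lim: "(\<lambda>n. wulff_gauge (H n) u) \<longlonglongrightarrow> wulff_gauge hh u" if u: "u \<in> sphere 0 1" for u
  proof (rule LIMSEQ_I)
    fix e :: real assume e: "0 < e"
    define d where "d = min (m / 2) (e * m * m / 4)"
    have d: "0 < d" "d \<le> m / 2" "d \<le> e * m * m / 4" using e m(1) by (auto simp: d_def)
    obtain N where N: "\<And>n x. n \<ge> N \<Longrightarrow> x \<in> sphere 0 1 \<Longrightarrow> \<bar>H n x - hh x\<bar> < d"
      using hh(3)[OF d(1)] unfolding H_def by auto
    have "norm (wulff_gauge (H n) u - wulff_gauge hh u) < e" if n: "n \<ge> N" for n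
    proof -
      have "\<bar>wulff_gauge (H n) u - wulff_gauge hh u\<bar> \<le> e / 2"
      proof (rule wulff_gauge_diff[OF Hp hhp])
        fix v :: 'a assume v: "v \<in> sphere 0 1"
        have a: "m \<le> hh v" "m / 2 \<le> H n v" using m(2)[OF v] N[OF n v] d(2) by linarith+
        have "(u \<bullet> v) / H n v - (u \<bullet> v) / hh v = (u \<bullet> v) * (hh v - H n v) / (H n v * hh v)"
          using a m(1) by (simp add: field_simps)
        then have "\<bar>(u \<bullet> v) / H n v - (u \<bullet> v) / hh v\<bar> = \<bar>u \<bullet> v\<bar> * \<bar>hh v - H n v\<bar> / (H n v * hh v)"
          using a m(1) by (simp add: abs_mult)
        also have "\<dots> \<le> 1 * d / (m / 2 * m)"
        proof (intro frac_le mult_mono)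
          show "\<bar>u \<bullet> v\<bar> \<le> 1" using Cauchy_Schwarz_ineq2[of u v] u v by simp
          show "\<bar>hh v - H n v\<bar> \<le> d" using N[OF n v] by (simp add: abs_minus_commute)
        qed (use a m(1) d(1) in auto)
        also have "\<dots> \<le> e / 2" using d(3) m(1) by (simp add: field_simps)
        finally show "\<bar>(u \<bullet> v) / H n v - (u \<bullet> v) / hh v\<bar> \<le> e / 2" .
      qed
      then show ?thesis using e by simp
    qed
    then show "\<exists>no. \<forall>n\<ge>no. norm (wulff_gauge (H n) u - wulff_gauge hh u) < e" by blast
  qed
  have "AE u in sphere_measure. (\<lambda>n. 1 / wulff_gauge (H n) u) \<longlonglongrightarrow> 1 / wulff_gauge hh u"
  proof (rule AE_I2)
    fix u :: 'a assume "u \<in> space sphere_measure"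
    then have u: "u \<in> sphere 0 1" by simp
    show "(\<lambda>n. 1 / wulff_gauge (H n) u) \<longlonglongrightarrow> 1 / wulff_gauge hh u"
      using wulff_gauge_pos[OF hhp u] by (intro tendsto_divide tendsto_const gauge_lim u) simp
  qed
  then have "(\<lambda>n. dual_volume (H n)) \<longlonglongrightarrow> dual_volume hh"
    unfolding dual_volume_def
    using wulff_gauge_pos[OF hhp] by (intro integral_G_tendsto[OF rad radR] continuous_radial_of_gauge[OF hhp]) (auto intro: less_imp_le)
  then have "dual_volume (\<lambda>_. 1) \<le> dual_volume hh"
    by (rule LIMSEQ_le_const) (use Hvol in auto)
  then have hhf: "feasible hh" using hhp hheven by (simp add: feasible_def)
  have "(\<lambda>n. cost (H n)) \<longlonglongrightarrow> cost hh"
    unfolding cost_def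
  proof (rule integral_dominated_convergence[where w="\<lambda>_. \<phi> R"])
    show "(\<lambda>v. \<phi> (hh v)) \<in> borel_measurable \<mu>" by (intro \<mu>_measurable continuous_phi hhp)
    show "(\<lambda>v. \<phi> (H n v)) \<in> borel_measurable \<mu>" for n by (intro \<mu>_measurable continuous_phi Hp)
    show "integrable \<mu> (\<lambda>_. \<phi> R)" by (intro \<mu>_integrable continuous_on_const)
    show "AE v in \<mu>. (\<lambda>n. \<phi> (H n v)) \<longlonglongrightarrow> \<phi> (hh v)"
    proof (rule AE_I2)
      fix v assume "v \<in> space \<mu>"
      then have v: "v \<in> sphere 0 1" by (simp add: \<mu>_space)
      show "(\<lambda>n. \<phi> (H n v)) \<longlonglongrightarrow> \<phi> (hh v)"
        by (rule isCont_tendsto_compose[OF DERIV_isCont[OF phi_deriv[OF hhpos[OF v]]] lim[OF v]])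
    qed
    show "AE v in \<mu>. norm (\<phi> (H n v)) \<le> \<phi> R" for n
    proof (rule AE_I2)
      fix v assume "v \<in> space \<mu>"
      then have v: "v \<in> sphere 0 1" by (simp add: \<mu>_space)
      have "\<phi> (H n v) \<le> \<phi> R" using HR[OF v, of n] by (intro phi_mono) simp
      then show "norm (\<phi> (H n v)) \<le> \<phi> R" using phi_nonneg[of "H n v"] by simp
    qed
  qed
  moreover have "(\<lambda>n. I + 1 / (real (k n) + 1)) \<longlonglongrightarrow> I + 0"
  proof (intro tendsto_add tendsto_const)
    have "(\<lambda>i. 1 / (real i + 1)) \<longlonglongrightarrow> 0"
      using LIMSEQ_inverse_real_of_nat by (simp add: inverse_eq_divide add.commute)
    from LIMSEQ_subseq_LIMSEQ[OF this hh(2)] show "(\<lambda>n. 1 / (real (k n) + 1)) \<longlonglongrightarrow> 0" by (simp add: o_def)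
  qed
  ultimately have "cost hh \<le> I + 0"
    by (rule LIMSEQ_le) (use hc in \<open>auto simp: H_def intro: less_imp_le\<close>)
  then have hhI: "cost hh \<le> I" by simp
  show ?thesis
  proof (rule that[of "wulff hh"])
    show "wulff hh \<in> convex_bodies_os"
      using wulff_convex_body[OF hhp] wulff_symmetric[of hh, OF hheven] by (simp add: convex_bodies_os_def)
    show "feasible (support_fun (wulff hh))" by (rule feasible_support_fun_wulff(1)[OF hhf])
    show "cost (support_fun (wulff hh)) \<le> cost f" if "feasible f" for f
      using feasible_support_fun_wulff(2)[OF hhf] hhI I[OF that] by linarith
  qed
qed

text \<open>
  If the first variation \<open>C g\<close> of the volume is positive, then the perturbed functions remain
  feasible for small \<open>t\<close>, so the first variation \<open>M g\<close> of the cost cannot be negative. A linear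
  functional that is nonnegative wherever another one is positive is a nonnegative multiple of it.
\<close>

lemma lagrange_multiplier:
  assumes f: "feasible f" and min: "\<And>f'. feasible f' \<Longrightarrow> cost f \<le> cost f'"
    and g: "continuous_on (sphere 0 1) g" and even: "\<And>v. v \<in> sphere 0 1 \<Longrightarrow> g (- v) = g v"
  defines "C \<equiv> \<lambda>g. \<integral>u. radial_weight f u * g (wulff_normal f u) \<partial>sphere_measure"
    and "M \<equiv> \<lambda>g. \<integral>v. \<psi> (f v) * g v \<partial>\<mu>"
  shows "0 < C (\<lambda>_. 1)" "M g = M (\<lambda>_. 1) / C (\<lambda>_. 1) * C g"
proof -
  have pf: "positive_on_sphere f" and fe: "\<And>v. v \<in> sphere 0 1 \<Longrightarrow> f (- v) = f v"
    and fv: "dual_volume (\<lambda>_. 1) \<le> dual_volume f"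
    using f by (auto simp: feasible_def)
  have sign: "0 \<le> M g" if g: "continuous_on (sphere 0 1) g" and even: "\<And>v. v \<in> sphere 0 1 \<Longrightarrow> g (- v) = g v" and pos: "0 < C g" for g
  proof -
    define t where "t k = 1 / (real k + 1)" for k
    have t: "\<And>k. 0 < t k" "\<And>k. t k \<le> 1" "t \<longlonglongrightarrow> 0"
      using LIMSEQ_inverse_real_of_nat by (simp_all add: t_def[abs_def] inverse_eq_divide add.commute)
    let ?f = "\<lambda>k v. f v * exp (t k * g v)"
    have "(\<lambda>k. (dual_volume (?f k) - dual_volume f) / t k) \<longlonglongrightarrow> C g"
      unfolding C_def by (rule dual_volume_variation[OF pf g t])
    then have "\<forall>\<^sub>F k in sequentially. 0 < (dual_volume (?f k) - dual_volume f) / t k"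
      using pos by (rule order_tendstoD(1))
    then have "\<forall>\<^sub>F k in sequentially. 0 \<le> (cost (?f k) - cost f) / t k"
    proof (rule eventually_mono)
      fix k assume "0 < (dual_volume (?f k) - dual_volume f) / t k"
      then have "dual_volume f < dual_volume (?f k)" using t(1)[of k] by (simp add: zero_less_divide_iff)
      then have "feasible (?f k)"
        using fv positive_exp_perturbation[OF pf g, of "t k"] fe even by (simp add: feasible_def)
      from min[OF this] show "0 \<le> (cost (?f k) - cost f) / t k" using t(1)[of k] by simp
    qed
    moreover have "(\<lambda>k. (cost (?f k) - cost f) / t k) \<longlonglongrightarrow> M g"
      unfolding cost_def M_def by (rule phi_integral_variation[OF pf g t \<mu>_finite \<mu>_sets])
    ultimately show "0 \<le> M g" by (intro tendsto_lowerbound[where F=sequentially]) auto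
  qed
  note intC = integrable_Gt_comp_normal[OF pf]
  have fc: "continuous_on (sphere 0 1) (\<lambda>v. \<psi> (f v))"
    by (rule continuous_on_compose2[OF psi_cont]) (use pf in \<open>auto simp: positive_on_sphere_def\<close>)
  have intM: "integrable \<mu> (\<lambda>v. \<psi> (f v) * g v)" if "continuous_on (sphere 0 1) g" for g
    by (intro \<mu>_integrable continuous_on_mult fc that)
  have Clin: "C (\<lambda>v. a * g v + b) = a * C g + b * C (\<lambda>_. 1)" if g: "continuous_on (sphere 0 1) g" for g a b
  proof -
    have X: "\<And>w c. w * (a * c + b) = a * (w * c) + b * (w * 1)" by (simp add: algebra_simps)
    have "C (\<lambda>v. a * g v + b) = (\<integral>u. a * (radial_weight f u * g (wulff_normal f u))
        + b * (radial_weight f u * 1) \<partial>sphere_measure)"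
      unfolding C_def by (intro Bochner_Integration.integral_cong refl) (rule X)
    also have "\<dots> = a * C g + b * C (\<lambda>_. 1)"
      unfolding C_def
      by (simp only: Bochner_Integration.integral_add[OF integrable_mult_right[OF intC[OF g]] integrable_mult_right[OF intC[OF continuous_on_const]]]
          integral_mult_right_zero)
    finally show ?thesis .
  qed
  have Mlin: "M (\<lambda>v. a * g v + b) = a * M g + b * M (\<lambda>_. 1)" if g: "continuous_on (sphere 0 1) g" for g a b
  proof -
    have "M (\<lambda>v. a * g v + b) = (\<integral>v. a * (\<psi> (f v) * g v) + b * (\<psi> (f v) * 1) \<partial>\<mu>)"
      unfolding M_def by (intro Bochner_Integration.integral_cong refl) (simp add: algebra_simps)
    also have "\<dots> = a * M g + b * M (\<lambda>_. 1)"
      unfolding M_def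
      by (simp only: Bochner_Integration.integral_add[OF integrable_mult_right[OF intM[OF g]] integrable_mult_right[OF intM[OF continuous_on_const]]]
          integral_mult_right_zero)
    finally show ?thesis .
  qed
  show C1: "0 < C (\<lambda>_. 1)"
  proof -
    have "0 < (\<integral>u. radial_weight f u \<partial>sphere_measure)"
    proof -
      have "(\<integral>u. 0 \<partial>(sphere_measure :: 'a measure)) < (\<integral>u. radial_weight f u \<partial>sphere_measure)"
      proof (rule finite_measure.integral_less_AE_space[OF finite_sphere_measure integrable_sphere_measure[OF continuous_on_const] integrable_sphere_measure[OF continuous_radial_weight[OF pf]]])
        show "AE u in sphere_measure. 0 < radial_weight f u"
          by (intro AE_I2) (simp add: radial_weight_pos[OF pf])
        show "emeasure sphere_measure (space (sphere_measure :: 'a measure)) \<noteq> 0"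
          using sphere_measure_positive by (auto simp: measure_def)
      qed
      then show ?thesis by simp
    qed
    then show ?thesis by (simp add: C_def)
  qed
  have le: "M (\<lambda>_. 1) / C (\<lambda>_. 1) * C g \<le> M g"
    if g: "continuous_on (sphere 0 1) g" and even: "\<And>v. v \<in> sphere 0 1 \<Longrightarrow> g (- v) = g v" for g
  proof (rule field_le_epsilon)
    fix e :: real assume e: "0 < e"
    \<comment> \<open>subtract the multiple of 1 that makes the first variation of the volume barely positive\<close>
    define d where "d = e / (\<bar>M (\<lambda>_. 1)\<bar> + 1)"
    have d: "0 < d" using e by (simp add: d_def)
    let ?b = "d - C g / C (\<lambda>_. 1)"
    have "0 \<le> M (\<lambda>v. 1 * g v + ?b)"
    proof (rule sign)
      show "continuous_on (sphere 0 1) (\<lambda>v. 1 * g v + ?b)" by (intro continuous_intros g)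
      show "0 < C (\<lambda>v. 1 * g v + ?b)" unfolding Clin[OF g] using C1 d by (simp add: algebra_simps)
    qed (use even in simp)
    then have "C g / C (\<lambda>_. 1) * M (\<lambda>_. 1) \<le> M g + d * M (\<lambda>_. 1)"
      unfolding Mlin[OF g] by (simp add: algebra_simps)
    moreover have "d * M (\<lambda>_. 1) \<le> e"
    proof -
      have "d * M (\<lambda>_. 1) \<le> d * (\<bar>M (\<lambda>_. 1)\<bar> + 1)" using d by (intro mult_left_mono) auto
      also have "\<dots> = e" by (simp add: d_def)
      finally show ?thesis .
    qed
    ultimately show "M (\<lambda>_. 1) / C (\<lambda>_. 1) * C g \<le> M g + e" by (simp add: mult.commute)
  qed
  have "M (\<lambda>_. 1) / C (\<lambda>_. 1) * C (\<lambda>v. - 1 * g v + 0) \<le> M (\<lambda>v. - 1 * g v + 0)"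
    by (rule le) (use g even in \<open>auto intro!: continuous_intros\<close>)
  then have "M g \<le> M (\<lambda>_. 1) / C (\<lambda>_. 1) * C g" unfolding Clin[OF g] Mlin[OF g] by simp
  then show "M g = M (\<lambda>_. 1) / C (\<lambda>_. 1) * C g" using le[OF g even] by simp
qed

end

section \<open>Curvature measures as image measures\<close>

text \<open>
  The indicator of a closed set is the limit of the continuous functions
  \<open>max 0 (1 - k * infdist u F)\<close>, and closed sets generate the Borel sets.
\<close>

lemma sphere_measures_eqI:
  fixes M N :: "'a::euclidean_space measure"
  assumes fin: "finite_measure M" "finite_measure N"
    and sets: "sets M = sets sphere_borel" "sets N = sets sphere_borel"
    and eq: "\<And>g. continuous_on (sphere 0 1) g \<Longrightarrow> (\<integral>u. g u \<partial>M) = (\<integral>u. (g u :: real) \<partial>N)"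
  shows "M = N"
proof -
  let ?S = "sphere 0 1 :: 'a set"
  let ?E = "((\<inter>) ?S) ` Collect closed"
  have lim: "(\<lambda>k. \<integral>u. max 0 (1 - real k * infdist u F) \<partial>L) \<longlonglongrightarrow> measure L F"
    if L: "finite_measure L" "sets L = sets sphere_borel" and F: "closed F" "F \<subseteq> ?S" "F \<noteq> {}" for L F
  proof -
    interpret finite_measure L by fact
    have FL: "F \<in> sets L" unfolding L(2) sets_sphere_borel using F by simp
    have "(\<lambda>k. \<integral>u. max 0 (1 - real k * infdist u F) \<partial>L) \<longlonglongrightarrow> (\<integral>u. indicator F u \<partial>L)"
    proof (rule integral_dominated_convergence[where w="\<lambda>_. 1"])
      show "(\<lambda>u. max 0 (1 - real k * infdist u F)) \<in> borel_measurable L" for k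
        by (intro continuous_imp_measurable[OF L(2)] continuous_intros)
      show "AE u in L. (\<lambda>k. max 0 (1 - real k * infdist u F)) \<longlonglongrightarrow> indicator F u"
      proof (rule AE_I2)
        fix u :: 'a
        show "(\<lambda>k. max 0 (1 - real k * infdist u F)) \<longlonglongrightarrow> indicator F u"
        proof (cases "u \<in> F")
          case True
          then show ?thesis by simp
        next
          case False
          then have d: "0 < infdist u F"
            using in_closed_iff_infdist_zero[OF F(1,3), of u] infdist_nonneg[of u F] by linarith
          obtain k0 where k0: "1 / infdist u F \<le> real k0" using real_arch_simple by blast
          have "max 0 (1 - real k * infdist u F) = indicator F u" if "k0 \<le> k" for k
          proof -
            have "1 / infdist u F \<le> real k" using k0 that by linarith
            then have "1 \<le> real k * infdist u F" using d by (simp add: pos_divide_le_eq)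
            then show ?thesis using False by simp
          qed
          then show ?thesis by (intro tendsto_eventually eventually_sequentiallyI)
        qed
      qed
      show "AE u in L. norm (max 0 (1 - real k * infdist u F)) \<le> 1" for k
        by (intro AE_I2) (simp add: infdist_nonneg)
    qed (use FL in simp_all)
    then show ?thesis using FL by simp
  qed
  have msets: "sets L = sigma_sets ?S ?E" if "sets L = sets (sphere_borel :: 'a measure)" for L
  proof -
    have "sets (sphere_borel :: 'a measure) = ((\<inter>) ?S) ` sigma_sets UNIV (Collect closed)"
      unfolding sets_restrict_space borel_eq_closed by simp
    also have "\<dots> = sigma_sets ?S ?E" by (rule sigma_sets_Int) (auto intro: sigma_sets.Basic)
    finally show ?thesis using that by simp
  qed
  show ?thesis
  proof (rule measure_eqI_generator_eq[where E="?E" and \<Omega>="?S" and A="\<lambda>_. ?S"])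
    show "Int_stable ?E"
    proof (rule Int_stableI)
      fix a b assume "a \<in> ?E" "b \<in> ?E"
      then obtain X Y where "a = ?S \<inter> X" "b = ?S \<inter> Y" "closed X" "closed Y" by blast
      then have "a \<inter> b = ?S \<inter> (X \<inter> Y)" "closed (X \<inter> Y)" by auto
      then show "a \<inter> b \<in> ?E" by blast
    qed
    show "emeasure M X = emeasure N X" if X: "X \<in> ?E" for X
    proof (cases "X = {}")
      case False
      have cX: "closed X" "X \<subseteq> ?S" using X by auto
      have "(\<integral>u. max 0 (1 - real k * infdist u X) \<partial>M) = (\<integral>u. max 0 (1 - real k * infdist u X) \<partial>N)" for k
        by (intro eq continuous_intros)
      then have "measure M X = measure N X"
        using lim[OF fin(1) sets(1) cX False] lim[OF fin(2) sets(2) cX False] LIMSEQ_unique by simp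
      then show ?thesis
        by (simp add: finite_measure.emeasure_eq_measure[OF fin(1)] finite_measure.emeasure_eq_measure[OF fin(2)])
    qed simp
    show "sets M = sigma_sets ?S ?E" "sets N = sigma_sets ?S ?E" by (intro msets sets)+
    show "range (\<lambda>_::nat. ?S) \<subseteq> ?E"
    proof -
      have "?S = ?S \<inter> ?S" "?S \<in> Collect closed" by auto
      then show ?thesis by blast
    qed
    show "emeasure M ?S \<noteq> \<infinity>" using finite_measure.emeasure_finite[OF fin(1)] by simp
  qed auto
qed

lemma wulff_gauge_uminus:
  fixes f :: "'a::euclidean_space \<Rightarrow> real"
  assumes f: "positive_on_sphere f" and even: "\<And>v. v \<in> sphere 0 1 \<Longrightarrow> f (- v) = f v"
  shows "wulff_gauge f (- x) = wulff_gauge f x" and "v \<in> wulff_normals f x \<Longrightarrow> - v \<in> wulff_normals f (- x)"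
proof -
  have le: "wulff_gauge f (- x) \<le> wulff_gauge f x" for x
  proof -
    obtain v where v: "v \<in> sphere 0 1" "(- x \<bullet> v) / f v = wulff_gauge f (- x)"
      using wulff_gauge_attained(1)[OF f, of "- x"] by (auto simp: wulff_normals_def)
    have "- v \<in> sphere 0 1" using v by simp
    from wulff_gauge_attained(2)[OF f this, of x] show ?thesis using v even[OF v(1)] by simp
  qed
  show eq: "wulff_gauge f (- x) = wulff_gauge f x" using le[of x] le[of "- x"] by simp
  show "- v \<in> wulff_normals f (- x)" if "v \<in> wulff_normals f x"
    using that even[of v] eq by (simp add: wulff_normals_def)
qed

lemma wulff_normal_uminus:
  fixes f :: "'a::euclidean_space \<Rightarrow> real"
  assumes f: "positive_on_sphere f" and even: "\<And>v. v \<in> sphere 0 1 \<Longrightarrow> f (- v) = f v"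
    and x: "x \<notin> wulff_singular f"
  shows "- x \<notin> wulff_singular f" "wulff_normal f (- x) = - wulff_normal f x"
proof -
  have sub: "v = - wulff_normal f x" if "v \<in> wulff_normals f (- x)" for v
  proof -
    have "- v \<in> wulff_normals f x" using wulff_gauge_uminus(2)[OF f even that] by simp
    then have "- v = wulff_normal f x" using wulff_normals_regular[OF f x] by simp
    then show ?thesis by (metis minus_minus)
  qed
  have mem: "- wulff_normal f x \<in> wulff_normals f (- x)"
    using wulff_normals_regular[OF f x] by (intro wulff_gauge_uminus(2)[OF f even]) simp_all
  then have "\<exists>!v. v \<in> wulff_normals f (- x)" using sub by blast
  then show reg: "- x \<notin> wulff_singular f" using not_singular_iff[OF f] by blast
  show "wulff_normal f (- x) = - wulff_normal f x"
    using wulff_normals_regular[OF f reg] mem by simp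
qed

lemma uminus_sets_sphere_borel:
  fixes E :: "'a::euclidean_space set"
  assumes "E \<in> sets sphere_borel"
  shows "uminus ` E \<in> sets sphere_borel"
proof -
  have E: "E \<subseteq> sphere 0 1" "E \<in> sets borel" using assms by (auto simp: sets_sphere_borel)
  have "uminus -` E \<in> sets borel"
    using measurable_sets[of uminus borel borel E] E(2) by simp
  moreover have "uminus -` E = uminus ` E" by (auto simp: image_iff) (metis minus_minus)
  moreover have "uminus ` E \<subseteq> sphere 0 1" using E(1) by auto
  ultimately show ?thesis by (simp add: sets_sphere_borel)
qed

lemma even_measure_integral:
  fixes \<mu> :: "'a::euclidean_space measure"
  assumes sets: "sets \<mu> = sets sphere_borel" and even: "even_measure \<mu>"
    and g: "continuous_on (sphere 0 1) g"
  shows "(\<integral>u. g (- u) \<partial>\<mu>) = (\<integral>u. (g u :: real) \<partial>\<mu>)"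
proof -
  note sp = space_eq_sphere[OF sets]
  have pre: "uminus -` E \<inter> sphere 0 1 = uminus ` E" if "E \<in> sets \<mu>" for E
  proof -
    have "E \<subseteq> sphere 0 1" using that unfolding sets sets_sphere_borel by blast
    then show ?thesis by (auto simp: image_iff) (metis minus_minus)
  qed
  have m: "uminus \<in> measurable \<mu> \<mu>"
  proof (rule measurableI)
    fix E assume E: "E \<in> sets \<mu>"
    then have "uminus ` E \<in> sets \<mu>" unfolding sets by (rule uminus_sets_sphere_borel)
    then show "uminus -` E \<inter> space \<mu> \<in> sets \<mu>" unfolding sp pre[OF E] .
  qed (simp add: sp)
  have "distr \<mu> \<mu> uminus = \<mu>"
  proof (rule measure_eqI)
    fix E assume "E \<in> sets (distr \<mu> \<mu> uminus)"
    then have E: "E \<in> sets \<mu>" by simp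
    have "emeasure (distr \<mu> \<mu> uminus) E = emeasure \<mu> (uminus ` E)"
      unfolding emeasure_distr[OF m E] sp pre[OF E] ..
    also have "\<dots> = emeasure \<mu> E" using even E unfolding even_measure_def by simp
    finally show "emeasure (distr \<mu> \<mu> uminus) E = emeasure \<mu> E" .
  qed simp
  moreover have "g \<in> borel_measurable \<mu>" by (rule continuous_imp_measurable[OF sets g])
  ultimately show ?thesis using integral_distr[OF m, of g] by simp
qed

context dual_orlicz
begin

text \<open>
  For a symmetric body the radial weight is even and the normal map is odd, almost everywhere.
\<close>

lemma integral_comp_normal_uminus:
  assumes f: "positive_on_sphere f" and even: "\<And>v. v \<in> sphere 0 1 \<Longrightarrow> f (- v) = f v"
    and g: "g \<in> borel_measurable sphere_borel" "(\<lambda>v. g (- v)) \<in> borel_measurable sphere_borel"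
  shows "(\<integral>u. radial_weight f u * g (- wulff_normal f u) \<partial>sphere_measure)
    = (\<integral>u. radial_weight f u * g (wulff_normal f u) \<partial>sphere_measure)"
proof -
  let ?w = "radial_weight f"
  have wm: "?w \<in> borel_measurable sphere_measure" by (rule continuous_sphere_measurable(2)[OF continuous_radial_weight[OF f]])
  have m1: "(\<lambda>u. ?w u * g (wulff_normal f u)) \<in> borel_measurable sphere_measure"
    by (rule borel_measurable_times[OF wm measurable_compose[OF measurable_wulff_normal[OF f] g(1)]])
  have m2: "(\<lambda>u. ?w u * g (- wulff_normal f u)) \<in> borel_measurable sphere_measure"
    by (rule borel_measurable_times[OF wm measurable_compose[OF measurable_wulff_normal[OF f] g(2)]])
  have "(\<integral>u. ?w u * g (wulff_normal f u) \<partial>sphere_measure) = (\<integral>u. ?w (- u) * g (wulff_normal f (- u)) \<partial>sphere_measure)"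
    by (rule integral_uminus_sphere[OF m1, symmetric])
  also have "\<dots> = (\<integral>u. ?w u * g (- wulff_normal f u) \<partial>sphere_measure)"
  proof (rule integral_cong_AE)
    show "(\<lambda>u. ?w (- u) * g (wulff_normal f (- u))) \<in> borel_measurable sphere_measure"
      using measurable_compose[OF measurable_uminus_sphere m1] .
    show "AE u in sphere_measure. ?w (- u) * g (wulff_normal f (- u)) = ?w u * g (- wulff_normal f u)"
      using AE_sphere_regular[OF f]
    proof (rule AE_mp, intro AE_I2 impI)
      fix u :: 'a assume u: "u \<in> space sphere_measure" "u \<notin> wulff_singular f"
      then have "u \<in> sphere 0 1" by simp
      then have "?w (- u) = ?w u"
        using Gt_even[of "1 / wulff_gauge f u" u] wulff_gauge_pos[OF f] wulff_gauge_uminus(1)[OF f even, of u]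
        unfolding radial_weight_def Gt_def by simp
      moreover have "wulff_normal f (- u) = - wulff_normal f u"
        by (rule wulff_normal_uminus(2)[OF f even u(2)])
      ultimately show "?w (- u) * g (wulff_normal f (- u)) = ?w u * g (- wulff_normal f u)"
        by (simp only:)
    qed
  qed (rule m2)
  finally show ?thesis by (rule sym)
qed

lemma continuous_inverse_support_fun:
  fixes K :: "'a set" and \<psi>' :: "real \<Rightarrow> real"
  assumes K: "K \<in> convex_bodies_o" and \<psi>': "continuous_on {0<..} \<psi>'" "\<And>s. 0 < s \<Longrightarrow> 0 < \<psi>' s"
  shows "continuous_on (sphere 0 1) (\<lambda>v. 1 / \<psi>' (support_fun K v))"
proof -
  have h: "continuous_on (sphere 0 1) (support_fun K)" "\<forall>v\<in>sphere 0 1. 0 < support_fun K v"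
    using positive_support_fun[OF K] by (auto simp: positive_on_sphere_def)
  have "continuous_on (sphere 0 1) (\<lambda>v. \<psi>' (support_fun K v))"
    by (rule continuous_on_compose2[OF \<psi>'(1) h(1)]) (use h(2) in auto)
  moreover have "\<forall>v\<in>sphere 0 1. \<psi>' (support_fun K v) \<noteq> 0"
  proof
    fix v :: 'a assume "v \<in> sphere 0 1"
    with h(2) have "0 < support_fun K v" by blast
    from \<psi>'(2)[OF this] show "\<psi>' (support_fun K v) \<noteq> 0" by simp
  qed
  ultimately show ?thesis by (rule continuous_on_divide[OF continuous_on_const])
qed

text \<open>
  Outside the null set of singular directions, \<open>u\<close> belongs to the reverse radial Gauss image of \<open>E\<close>
  exactly if its only normal lies in \<open>E\<close>. The curvature measure thus becomes the image under the
  normal map of a measure with a density.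
\<close>

lemma dual_orlicz_curvature_eq:
  assumes K: "K \<in> convex_bodies_o" and \<psi>': "continuous_on {0<..} \<psi>'" "\<And>s. 0 < s \<Longrightarrow> 0 < \<psi>' s"
    and E: "E \<in> sets sphere_borel"
  defines "h \<equiv> support_fun K"
  shows "dual_orlicz_curvature G \<psi>' K E = 1 / DIM('a) * (\<integral>u. radial_weight h u
      * (indicator E (wulff_normal h u) * (1 / \<psi>' (h (wulff_normal h u)))) \<partial>sphere_measure)"
proof -
  let ?A = "reverse_radial_gauss_image K E"
  let ?F = "\<lambda>u. radial_fun K u * deriv (\<lambda>t. G t u) (radial_fun K u) / \<psi>' (support_fun K (radial_gauss_map K u))"
  let ?J = "\<lambda>u. radial_weight h u * (indicator E (wulff_normal h u) * (1 / \<psi>' (h (wulff_normal h u))))"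
  have hp: "positive_on_sphere h" unfolding h_def by (rule positive_support_fun[OF K])
  have A: "?A \<subseteq> sphere 0 1" by (auto simp: reverse_radial_gauss_image_def)
  have "(\<integral>u. indicator ?A u *\<^sub>R ?F u \<partial>sphere_measure)
      = (\<integral>u. indicator (sphere 0 1) u *\<^sub>R (indicator ?A u *\<^sub>R ?F u) \<partial>hausdorff_measure (DIM('a) - 1))"
    unfolding sphere_measure_def by (rule integral_restrict_space) (simp add: sphere_in_hausdorff)
  also have "(\<lambda>u. indicator (sphere 0 1) u *\<^sub>R (indicator ?A u *\<^sub>R ?F u)) = (\<lambda>u. indicator ?A u *\<^sub>R ?F u)"
    using A by (auto simp: fun_eq_iff split: split_indicator)
  finally have restr: "(LINT u : ?A | hausdorff_measure (DIM('a) - 1). ?F u) = (\<integral>u. indicator ?A u *\<^sub>R ?F u \<partial>sphere_measure)"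
    unfolding set_lebesgue_integral_def by (rule sym)
  have eq: "indicator ?A u *\<^sub>R ?F u = ?J u" if u: "u \<in> sphere 0 1 - wulff_singular h \<inter> sphere 0 1" for u
  proof -
    have us: "u \<in> sphere 0 1" and ur: "u \<notin> wulff_singular h" using u by auto
    have rn: "radial_normal K u = (\<lambda>v. v = wulff_normal h u)"
      using radial_normal_iff[OF K us] wulff_normals_regular[OF hp ur] unfolding h_def by (intro ext) simp
    have "radial_gauss_map K u = wulff_normal h u" unfolding radial_gauss_map_def rn by (rule the_eq_trivial)
    moreover have "u \<in> ?A \<longleftrightarrow> wulff_normal h u \<in> E"
      using us by (auto simp: reverse_radial_gauss_image_def rn)
    moreover have "radial_fun K u = 1 / wulff_gauge h u" unfolding h_def by (rule radial_fun_eq[OF K us])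
    ultimately show ?thesis by (simp add: radial_weight_def Gt_def h_def indicator_def)
  qed
  have "continuous_on (sphere 0 1) (\<lambda>v. 1 / \<psi>' (h v))"
    unfolding h_def by (rule continuous_inverse_support_fun[OF K \<psi>'])
  then have "(\<lambda>v. indicator E v * (1 / \<psi>' (h v))) \<in> borel_measurable sphere_borel"
    by (intro borel_measurable_times borel_measurable_indicator E continuous_sphere_measurable(1))
  then have Jm: "?J \<in> borel_measurable sphere_measure"
    by (intro borel_measurable_times[OF continuous_sphere_measurable(2)[OF continuous_radial_weight[OF hp]]]
        measurable_compose[OF measurable_wulff_normal[OF hp]])
  have Fm: "(\<lambda>u. indicator ?A u *\<^sub>R ?F u) \<in> borel_measurable sphere_measure"
    by (rule sphere_measure_measurable_AE_eq[OF Jm wulff_singular_null(2)[OF hp]]) (erule eq, simp)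
  have "(\<integral>u. indicator ?A u *\<^sub>R ?F u \<partial>sphere_measure) = (\<integral>u. ?J u \<partial>sphere_measure)"
  proof (rule integral_cong_AE[OF Fm Jm])
    show "AE u in sphere_measure. indicator ?A u *\<^sub>R ?F u = ?J u"
      using AE_sphere_regular[OF hp]
    proof (rule AE_mp, intro AE_I2 impI)
      fix u :: 'a assume "u \<in> space sphere_measure" "u \<notin> wulff_singular h"
      then show "indicator ?A u *\<^sub>R ?F u = ?J u" by (intro eq) simp
    qed
  qed
  then show ?thesis unfolding dual_orlicz_curvature_def restr by (simp only:)
qed

lemma dual_orlicz_curvature_psi_eq:
  assumes K: "K \<in> convex_bodies_o" and E: "E \<in> sets sphere_borel"
  defines "h \<equiv> support_fun K"
  shows "dual_orlicz_curvature G \<psi> K E = 1 / DIM('a) * (\<integral>u. radial_weight h u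
      * (indicator E (wulff_normal h u) * (1 / \<psi> (h (wulff_normal h u)))) \<partial>sphere_measure)"
  unfolding h_def by (rule dual_orlicz_curvature_eq[OF K psi_cont _ E]) (rule psi_pos)

lemma indicator_inverse_measurable:
  fixes K :: "'a set"
  assumes K: "K \<in> convex_bodies_o" and E: "E \<in> sets sphere_borel"
  shows "(\<lambda>v. indicator E v * (1 / \<psi> (support_fun K v))) \<in> borel_measurable sphere_borel"
  by (intro borel_measurable_times borel_measurable_indicator E continuous_sphere_measurable(1)
      continuous_inverse_support_fun[OF K psi_cont psi_pos])

lemma curvature_even:
  assumes K: "K \<in> convex_bodies_os" and E: "E \<in> sets sphere_borel"
  shows "dual_orlicz_curvature G \<psi> K (uminus ` E) = dual_orlicz_curvature G \<psi> K E"
proof -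
  have K': "K \<in> convex_bodies_o" and sym: "K = uminus ` K" using K by (auto simp: convex_bodies_os_def)
  have hp: "positive_on_sphere (support_fun K)" by (rule positive_support_fun[OF K'])
  have even: "\<And>v. support_fun K (- v) = support_fun K v" by (rule support_fun_uminus[OF sym])
  let ?g = "\<lambda>v. indicator E v * (1 / \<psi> (support_fun K v))"
  have mem: "- v \<in> E \<longleftrightarrow> v \<in> uminus ` E" for v by (auto simp: image_iff) (metis minus_minus)
  then have ind: "?g (- v) = indicator (uminus ` E) v * (1 / \<psi> (support_fun K v))" for v
    unfolding even by (simp add: indicator_def)
  have m2: "(\<lambda>v. ?g (- v)) \<in> borel_measurable sphere_borel"
    unfolding ind by (rule indicator_inverse_measurable[OF K' uminus_sets_sphere_borel[OF E]])
  note eq = integral_comp_normal_uminus[where g="?g", OF hp even indicator_inverse_measurable[OF K' E] m2, unfolded ind]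
  show ?thesis
    unfolding dual_orlicz_curvature_psi_eq[OF K' E]
      dual_orlicz_curvature_psi_eq[OF K' uminus_sets_sphere_borel[OF E]] eq ..
qed

text \<open>
  An outer normal at the boundary point in direction \<open>u\<close> has an inner product with \<open>u\<close> that is
  bounded below by some \<open>r > 0\<close>, as the body contains a ball around the origin and is bounded. Hence for
  almost all \<open>u\<close> in the cap around \<open>v\<close> of radius \<open>r\<close> the normals lie in the open hemisphere centred at \<open>v\<close>,
  and the cap has positive measure.
\<close>

lemma curvature_open_hemisphere_nonzero:
  assumes K: "K \<in> convex_bodies_o" and v: "v \<in> sphere 0 1"
  shows "dual_orlicz_curvature G \<psi> K {u \<in> sphere 0 1. 0 < u \<bullet> v} \<noteq> 0"
proof
  define h where "h = support_fun K"
  let ?E = "{u \<in> sphere 0 1. 0 < u \<bullet> v}"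
  assume zero: "dual_orlicz_curvature G \<psi> K ?E = 0"
  have hp: "positive_on_sphere h" unfolding h_def by (rule positive_support_fun[OF K])
  have E: "?E \<in> sets sphere_borel" by (rule open_hemisphere_sets)
  let ?D = "\<lambda>u. radial_weight h u * (1 / \<psi> (h (wulff_normal h u)))"
  let ?J = "\<lambda>u. radial_weight h u * (indicator ?E (wulff_normal h u) * (1 / \<psi> (h (wulff_normal h u))))"
  have pos: "0 < ?D u" if u: "u \<in> sphere 0 1" for u
  proof -
    have "0 < h (wulff_normal h u)" using hp wulff_normal_in_sphere[OF hp] by (simp add: positive_on_sphere_def)
    then show ?thesis using psi_pos radial_weight_pos[OF hp u] by simp
  qed
  have cont: "continuous_on (sphere 0 1) (\<lambda>v. 1 / \<psi> (h v))"
    unfolding h_def by (rule continuous_inverse_support_fun[OF K psi_cont psi_pos])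
  have Jm: "?J \<in> borel_measurable sphere_measure"
    unfolding h_def by (intro borel_measurable_times[OF continuous_sphere_measurable(2)[OF continuous_radial_weight[OF hp[unfolded h_def]]]]
        measurable_compose[OF measurable_wulff_normal[OF hp[unfolded h_def]] indicator_inverse_measurable[OF K E]])
  have JD: "?J u = indicator ?E (wulff_normal h u) * ?D u" for u by (simp add: indicator_def)
  have Ji: "integrable sphere_measure ?J"
  proof (rule Bochner_Integration.integrable_bound[OF integrable_Gt_comp_normal[OF hp cont] Jm])
    show "AE u in sphere_measure. norm (?J u) \<le> norm (?D u)"
      by (intro AE_I2) (simp add: indicator_def)
  qed
  have n0: "1 / real DIM('a) \<noteq> 0" by simp
  have "1 / real DIM('a) * (\<integral>u. ?J u \<partial>sphere_measure) = 0"
    using zero unfolding dual_orlicz_curvature_psi_eq[OF K E] h_def .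
  then have "(\<integral>u. ?J u \<partial>sphere_measure) = 0"
    using n0 unfolding mult_eq_0_iff by blast
  moreover have "AE u in sphere_measure. 0 \<le> ?J u"
  proof (rule AE_I2)
    fix u :: 'a assume "u \<in> space sphere_measure"
    then show "0 \<le> ?J u" unfolding JD by (intro mult_nonneg_nonneg indicator_pos_le less_imp_le[OF pos]) simp
  qed
  ultimately have AEJ: "AE u in sphere_measure. ?J u = 0" using integral_nonneg_eq_0_iff_AE[OF Ji] by blast
  obtain m where m: "0 < m" "\<And>v. v \<in> sphere 0 1 \<Longrightarrow> m \<le> h v"
    using positive_on_sphere_lower_bound[OF hp] by blast
  obtain B where B: "0 \<le> B" "\<And>v. v \<in> sphere 0 1 \<Longrightarrow> \<bar>h v\<bar> \<le> B"
    using hp bounded_on_sphere[of h] unfolding positive_on_sphere_def by blast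
  define r where "r = m / (B + 1)"
  have r: "0 < r" using m(1) B(1) by (simp add: r_def)
  have near: "wulff_normal h u \<in> ?E" if u: "u \<in> sphere 0 1" "u \<in> ball v r" "u \<notin> wulff_singular h" for u
  proof -
    let ?n = "wulff_normal h u"
    have n: "?n \<in> sphere 0 1" by (rule wulff_normal_in_sphere[OF hp])
    have "?n \<in> wulff_normals h u" using wulff_normals_regular[OF hp u(3)] by simp
    then have "(u \<bullet> ?n) / h ?n = wulff_gauge h u" by (simp add: wulff_normals_def)
    then have "u \<bullet> ?n = wulff_gauge h u * h ?n" using m(1) m(2)[OF n] by (simp add: field_simps)
    also have "\<dots> \<ge> 1 / (B + 1) * m"
    proof (rule mult_mono)
      have "1 / (B + 1) \<le> 1 / h u" using B(2)[OF u(1)] m(1) m(2)[OF u(1)] by (intro divide_left_mono) auto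
      then show "1 / (B + 1) \<le> wulff_gauge h u" using wulff_gauge_ge[OF hp u(1)] by linarith
    qed (use m n wulff_gauge_pos[OF hp u(1)] in \<open>auto intro: less_imp_le\<close>)
    finally have "r \<le> u \<bullet> ?n" by (simp add: r_def)
    moreover have "\<bar>(v - u) \<bullet> ?n\<bar> < r"
      using Cauchy_Schwarz_ineq2[of "v - u" ?n] n u(2) by (simp add: dist_norm)
    ultimately have "0 < v \<bullet> ?n" unfolding inner_diff_left by linarith
    then show ?thesis using n by (simp add: inner_commute)
  qed
  have "AE u in sphere_measure. u \<notin> sphere 0 1 \<inter> ball v r"
    using AEJ AE_sphere_regular[OF hp]
  proof eventually_elim
    case (elim u)
    show ?case
    proof
      assume "u \<in> sphere 0 1 \<inter> ball v r"
      then have u: "u \<in> sphere 0 1" "u \<in> ball v r" by blast+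
      have "?J u = ?D u" unfolding JD using near[OF u elim(2)] by simp
      then show False using elim(1) pos[OF u(1)] by linarith
    qed
  qed
  moreover have "sphere 0 1 \<inter> ball v r \<in> sets sphere_measure"
    using sphere_borel_subset by (auto simp: sets_sphere_borel)
  ultimately have "sphere 0 1 \<inter> ball v r \<in> null_sets sphere_measure"
    using AE_iff_null_sets by blast
  then show False using sphere_measure_cap_pos[OF v r] by auto
qed

end

text \<open>
  The multiplier rule for the minimizer says that \<open>\<mu>\<close> and the image measure \<open>\<nu>\<close> agree on even
  continuous functions. Both are even, so they agree on all continuous functions and hence are
  equal.
\<close>

lemma (in dual_orlicz_minkowski) solution_exists:
  assumes even: "even_measure \<mu>"
  obtains K where "K \<in> convex_bodies_os"
    "0 < 1 / dual_orlicz_curvature G (\<lambda>_. 1) K (sphere 0 1) * (\<integral>u. \<psi> (support_fun K u) \<partial>\<mu>)"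
    "\<forall>E\<in>sets \<mu>. measure \<mu> E =
       1 / dual_orlicz_curvature G (\<lambda>_. 1) K (sphere 0 1) * (\<integral>u. \<psi> (support_fun K u) \<partial>\<mu>) *
       dual_orlicz_curvature G \<psi> K E"
proof -
  obtain K where K: "K \<in> convex_bodies_os" "feasible (support_fun K)"
    "\<And>f. feasible f \<Longrightarrow> cost (support_fun K) \<le> cost f"
    using minimizer_exists by blast
  define h where "h = support_fun K"
  have K': "K \<in> convex_bodies_o" and sym: "K = uminus ` K" using K(1) by (auto simp: convex_bodies_os_def)
  have hp: "positive_on_sphere h" unfolding h_def by (rule positive_support_fun[OF K'])
  have he: "h (- v) = h v" for v unfolding h_def by (rule support_fun_uminus[OF sym])
  have hc: "continuous_on (sphere 0 1) h" and hpos: "\<And>v. v \<in> sphere 0 1 \<Longrightarrow> 0 < h v"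
    using hp by (auto simp: positive_on_sphere_def)
  let ?w = "radial_weight h"
  define C where "C g = (\<integral>u. ?w u * g (wulff_normal h u) \<partial>sphere_measure)" for g
  define M where "M g = (\<integral>v. \<psi> (h v) * g v \<partial>\<mu>)" for g
  define l where "l = M (\<lambda>_. 1) / C (\<lambda>_. 1)"
  note lagr = lagrange_multiplier[OF K(2,3), folded h_def]
  have C1: "0 < C (\<lambda>_. 1)"
    unfolding C_def by (rule lagr(1)[OF _ continuous_on_const]) simp_all
  have mult: "M g = l * C g" if "continuous_on (sphere 0 1) g" "\<And>v. v \<in> sphere 0 1 \<Longrightarrow> g (- v) = g v" for g
    unfolding l_def C_def M_def by (rule lagr(2)[OF _ that]) simp_all
  define \<omega> where "\<omega> v = 1 / \<psi> (h v)" for v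
  have \<omega>c: "continuous_on (sphere 0 1) \<omega>"
    unfolding \<omega>_def h_def by (rule continuous_inverse_support_fun[OF K' psi_cont psi_pos])
  have \<psi>\<omega>: "\<psi> (h v) * (\<omega> v * c) = c" if "v \<in> sphere 0 1" for v c
    using psi_pos[OF hpos[OF that]] by (simp add: \<omega>_def)
  have evenrep: "(\<integral>v. g v \<partial>\<mu>) = l * C (\<lambda>v. \<omega> v * g v)"
    if g: "continuous_on (sphere 0 1) g" and ge: "\<And>v. v \<in> sphere 0 1 \<Longrightarrow> g (- v) = g v" for g
  proof -
    have "M (\<lambda>v. \<omega> v * g v) = (\<integral>v. g v \<partial>\<mu>)"
      unfolding M_def by (intro Bochner_Integration.integral_cong refl \<psi>\<omega>) (simp add: \<mu>_space)
    moreover have "M (\<lambda>v. \<omega> v * g v) = l * C (\<lambda>v. \<omega> v * g v)"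
    proof (rule mult)
      show "continuous_on (sphere 0 1) (\<lambda>v. \<omega> v * g v)" by (intro continuous_on_mult \<omega>c g)
      show "\<omega> (- v) * g (- v) = \<omega> v * g v" if "v \<in> sphere 0 1" for v
        using ge[OF that] by (simp add: \<omega>_def he)
    qed
    ultimately show ?thesis by simp
  qed
  have rep: "(\<integral>v. g v \<partial>\<mu>) = l * C (\<lambda>v. \<omega> v * g v)" if g: "continuous_on (sphere 0 1) g" for g
  proof -
    have gm: "continuous_on (sphere 0 1) (\<lambda>v. g (- v))"
      by (rule continuous_on_compose2[OF g]) (auto intro!: continuous_intros)
    define g2 where "g2 v = g v + g (- v)" for v
    have g2c: "continuous_on (sphere 0 1) g2" unfolding g2_def by (intro continuous_on_add g gm)
    have wg: "continuous_on (sphere 0 1) (\<lambda>v. \<omega> v * g v)" "continuous_on (sphere 0 1) (\<lambda>v. \<omega> v * g (- v))"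
      by (intro continuous_on_mult \<omega>c g gm)+
    have "(\<integral>v. g2 v \<partial>\<mu>) = (\<integral>v. g v \<partial>\<mu>) + (\<integral>v. g (- v) \<partial>\<mu>)"
      unfolding g2_def by (intro Bochner_Integration.integral_add \<mu>_integrable g gm)
    then have 1: "(\<integral>v. g2 v \<partial>\<mu>) = 2 * (\<integral>v. g v \<partial>\<mu>)"
      using even_measure_integral[OF \<mu>_sets even g] by simp
    have "C (\<lambda>v. \<omega> v * g2 v) = (\<integral>u. ?w u * (\<omega> (wulff_normal h u) * g (wulff_normal h u))
        + ?w u * (\<omega> (wulff_normal h u) * g (- wulff_normal h u)) \<partial>sphere_measure)"
      unfolding C_def g2_def by (simp only: distrib_left)
    also have "\<dots> = C (\<lambda>v. \<omega> v * g v) + C (\<lambda>v. \<omega> v * g (- v))"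
      unfolding C_def by (rule Bochner_Integration.integral_add[OF integrable_Gt_comp_normal[OF hp wg(1)] integrable_Gt_comp_normal[OF hp wg(2)]])
    also have "C (\<lambda>v. \<omega> v * g (- v)) = C (\<lambda>v. \<omega> v * g v)"
    proof -
      have \<omega>e: "\<omega> (- v) = \<omega> v" for v by (simp add: \<omega>_def he)
      have m: "(\<lambda>v. \<omega> v * g v) \<in> borel_measurable sphere_borel"
        "(\<lambda>v. \<omega> (- v) * g (- v)) \<in> borel_measurable sphere_borel"
        unfolding \<omega>e by (intro continuous_sphere_measurable(1) wg)+
      show ?thesis
        using integral_comp_normal_uminus[OF hp he m] unfolding C_def \<omega>e .
    qed
    finally have 2: "C (\<lambda>v. \<omega> v * g2 v) = 2 * C (\<lambda>v. \<omega> v * g v)" by simp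
    have "(\<integral>v. g2 v \<partial>\<mu>) = l * C (\<lambda>v. \<omega> v * g2 v)"
      by (rule evenrep[OF g2c]) (simp add: g2_def)
    then show ?thesis unfolding 1 2 by simp
  qed
  have M1: "0 < M (\<lambda>_. 1)"
  proof -
    interpret finite_measure \<mu> by (rule \<mu>_finite)
    have \<mu>0: "emeasure \<mu> (space \<mu>) \<noteq> 0"
    proof
      assume z: "emeasure \<mu> (space \<mu>) = 0"
      obtain v :: 'a where v: "v \<in> sphere 0 1" using sphere_nonempty by blast
      have "AE u in \<mu>. max 0 (u \<bullet> v) = 0" using z by (intro AE_I[of _ _ "space \<mu>"]) auto
      then have "(\<integral>u. max 0 (u \<bullet> v) \<partial>\<mu>) = 0" by (rule integral_eq_zero_AE)
      then show False using \<mu>_nc v unfolding not_concentrated_on_hemisphere_def by fastforce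
    qed
    have c: "continuous_on (sphere 0 1) (\<lambda>v. \<psi> (h v) * 1)"
      by (intro continuous_on_mult continuous_on_const continuous_on_compose2[OF psi_cont hc]) (use hpos in auto)
    have "(\<integral>v. 0 \<partial>\<mu>) < (\<integral>v. \<psi> (h v) * 1 \<partial>\<mu>)"
    proof (rule integral_less_AE_space[OF _ \<mu>_integrable[OF c] _ \<mu>0])
      show "AE v in \<mu>. 0 < \<psi> (h v) * 1" by (rule AE_I2) (simp add: \<mu>_space psi_pos hpos)
    qed simp
    then show ?thesis by (simp add: M_def)
  qed
  have l: "0 < l" unfolding l_def using M1 C1 by simp
  let ?D = "\<lambda>u. l * (?w u * \<omega> (wulff_normal h u))"
  have Di: "integrable sphere_measure ?D"
    by (intro integrable_mult_right integrable_Gt_comp_normal[OF hp \<omega>c])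
  have Dpos: "0 \<le> ?D u" if u: "u \<in> sphere 0 1" for u
  proof -
    have w: "0 < ?w u" by (rule radial_weight_pos[OF hp u])
    have o: "0 < \<omega> (wulff_normal h u)"
      using psi_pos hpos wulff_normal_in_sphere[OF hp, of u] by (simp add: \<omega>_def)
    show ?thesis by (rule less_imp_le[OF mult_pos_pos[OF l mult_pos_pos[OF w o]]])
  qed
  define \<nu> where "\<nu> = distr (density sphere_measure (\<lambda>u. ennreal (?D u))) sphere_borel (wulff_normal h)"
  have nm: "wulff_normal h \<in> measurable (density sphere_measure (\<lambda>u. ennreal (?D u))) sphere_borel"
    using measurable_wulff_normal[OF hp] by simp
  have \<nu>int: "(\<integral>v. g v \<partial>\<nu>) = (\<integral>u. ?D u * g (wulff_normal h u) \<partial>sphere_measure)"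
    if g: "g \<in> borel_measurable sphere_borel" for g :: "'a \<Rightarrow> real"
  proof -
    have "(\<integral>v. g v \<partial>\<nu>) = (\<integral>u. g (wulff_normal h u) \<partial>density sphere_measure (\<lambda>u. ennreal (?D u)))"
      unfolding \<nu>_def by (rule integral_distr[OF nm g])
    also have "\<dots> = (\<integral>u. ?D u *\<^sub>R g (wulff_normal h u) \<partial>sphere_measure)"
      by (rule integral_density[OF measurable_compose[OF measurable_wulff_normal[OF hp] g] borel_measurable_integrable[OF Di]])
        (intro AE_I2 Dpos, simp)
    finally show ?thesis by simp
  qed
  have "finite_measure \<nu>"
  proof
    have "emeasure \<nu> (space \<nu>) = (\<integral>\<^sup>+u. ennreal (?D u) \<partial>sphere_measure)"
    proof -
      let ?L = "density sphere_measure (\<lambda>u. ennreal (?D u))"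
      have pre: "wulff_normal h -` space sphere_borel \<inter> space ?L = sphere 0 1"
        using wulff_normal_in_sphere[OF hp] by (auto simp: space_restrict_space)
      have "emeasure \<nu> (space \<nu>) = emeasure ?L (sphere 0 1)"
        unfolding \<nu>_def space_distr emeasure_distr[OF nm sets.top] pre ..
      also have "\<dots> = (\<integral>\<^sup>+u. ennreal (?D u) * indicator (sphere 0 1) u \<partial>sphere_measure)"
      proof (rule emeasure_density)
        show "(\<lambda>u. ennreal (?D u)) \<in> borel_measurable sphere_measure"
          using borel_measurable_integrable[OF Di] by (rule measurable_compose) simp
        show "sphere 0 1 \<in> sets (sphere_measure :: 'a measure)"
          using sets.top[of "sphere_measure :: 'a measure"] by simp
      qed
      also have "\<dots> = (\<integral>\<^sup>+u. ennreal (?D u) \<partial>sphere_measure)"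
        by (rule nn_integral_cong) (simp add: indicator_def)
      finally show ?thesis .
    qed
    also have "\<dots> = ennreal (\<integral>u. ?D u \<partial>sphere_measure)"
      by (rule nn_integral_eq_integral[OF Di]) (intro AE_I2 Dpos, simp)
    finally show "emeasure \<nu> (space \<nu>) \<noteq> \<infinity>" by simp
  qed
  moreover have "(\<integral>v. g v \<partial>\<mu>) = (\<integral>v. g v \<partial>\<nu>)" if g: "continuous_on (sphere 0 1) g" for g :: "'a \<Rightarrow> real"
  proof -
    have "(\<integral>v. g v \<partial>\<nu>) = (\<integral>u. l * (?w u * (\<omega> (wulff_normal h u) * g (wulff_normal h u))) \<partial>sphere_measure)"
      unfolding \<nu>int[OF continuous_sphere_measurable(1)[OF g]] by (simp only: mult.assoc)
    also have "\<dots> = l * C (\<lambda>v. \<omega> v * g v)" unfolding C_def by (rule integral_mult_right_zero)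
    finally show ?thesis using rep[OF g] by simp
  qed
  moreover have "sets \<nu> = sets sphere_borel" by (simp add: \<nu>_def)
  ultimately have \<mu>\<nu>: "\<mu> = \<nu>" by (intro sphere_measures_eqI \<mu>_finite \<mu>_sets)
  let ?n = "real DIM('a)"
  have S: "sphere 0 1 \<in> sets (sphere_borel :: 'a measure)" by (simp add: sets_sphere_borel)
  have C1': "dual_orlicz_curvature G (\<lambda>_. 1) K (sphere 0 1) = 1 / ?n * C (\<lambda>_. 1)"
    unfolding dual_orlicz_curvature_eq[OF K' continuous_on_const zero_less_one S] h_def[symmetric] C_def
    using wulff_normal_in_sphere[OF hp] by simp
  have \<tau>: "1 / dual_orlicz_curvature G (\<lambda>_. 1) K (sphere 0 1) * (\<integral>u. \<psi> (support_fun K u) \<partial>\<mu>) = ?n * l"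
    unfolding C1' l_def M_def h_def[symmetric] by simp
  show ?thesis
  proof (rule that[OF K(1)]; unfold \<tau>)
    show "0 < ?n * l" using l by simp
    show "\<forall>E\<in>sets \<mu>. measure \<mu> E = ?n * l * dual_orlicz_curvature G \<psi> K E"
    proof
      fix E assume E: "E \<in> sets \<mu>"
      then have E': "E \<in> sets sphere_borel" by (simp add: \<mu>_sets)
      have "measure \<mu> E = (\<integral>v. indicator E v \<partial>\<mu>)" using E by simp
      also have "\<dots> = (\<integral>u. ?D u * indicator E (wulff_normal h u) \<partial>sphere_measure)"
        using \<nu>int[OF borel_measurable_indicator[OF E']] \<mu>\<nu> by simp
      also have "\<dots> = (\<integral>u. l * (?w u * (indicator E (wulff_normal h u) * \<omega> (wulff_normal h u))) \<partial>sphere_measure)"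
        by (simp only: mult.assoc mult.commute[of "\<omega> _" "indicator E _"])
      also have "\<dots> = l * (\<integral>u. ?w u * (indicator E (wulff_normal h u) * \<omega> (wulff_normal h u)) \<partial>sphere_measure)"
        by (rule integral_mult_right_zero)
      also have "\<dots> = ?n * l * dual_orlicz_curvature G \<psi> K E"
        unfolding dual_orlicz_curvature_psi_eq[OF K' E'] h_def[symmetric] \<omega>_def by simp
      finally show "measure \<mu> E = ?n * l * dual_orlicz_curvature G \<psi> K E" .
    qed
  qed
qed

lemma (in dual_orlicz) solution_imp_even_not_concentrated:
  fixes \<mu> :: "'a measure"
  assumes fin: "finite_measure \<mu>" and sets: "sets \<mu> = sets sphere_borel"
    and K: "K \<in> convex_bodies_os" and \<tau>: "0 < \<tau>"
    and eq: "\<And>E. E \<in> sets \<mu> \<Longrightarrow> measure \<mu> E = \<tau> * dual_orlicz_curvature G \<psi> K E"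
  shows "even_measure \<mu>" "not_concentrated_on_hemisphere \<mu>"
proof -
  interpret finite_measure \<mu> by fact
  show "even_measure \<mu>"
    unfolding even_measure_def
  proof
    fix E assume E: "E \<in> sets \<mu>"
    then have E': "E \<in> sets sphere_borel" by (simp add: sets)
    have "uminus ` E \<in> sets \<mu>" unfolding sets by (rule uminus_sets_sphere_borel[OF E'])
    then have "measure \<mu> (uminus ` E) = measure \<mu> E"
      using eq[OF E] eq[of "uminus ` E"] curvature_even[OF K E'] by simp
    then show "emeasure \<mu> E = emeasure \<mu> (uminus ` E)" by (simp add: emeasure_eq_measure)
  qed
  show "not_concentrated_on_hemisphere \<mu>"
    unfolding not_concentrated_on_hemisphere_def
  proof
    fix v :: 'a assume v: "v \<in> sphere 0 1"
    let ?E = "{u \<in> sphere 0 1. 0 < u \<bullet> v}"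
    have int: "integrable \<mu> (\<lambda>u. max 0 (u \<bullet> v))"
      by (intro continuous_imp_integrable[OF fin sets] continuous_intros)
    have K': "K \<in> convex_bodies_o" using K by (simp add: convex_bodies_os_def)
    have E: "?E \<in> sets \<mu>" unfolding sets by (rule open_hemisphere_sets)
    have ne: "measure \<mu> ?E \<noteq> 0"
      unfolding eq[OF E] using \<tau> curvature_open_hemisphere_nonzero[OF K' v] by simp
    have "(\<integral>u. max 0 (u \<bullet> v) \<partial>\<mu>) \<noteq> 0"
    proof
      assume "(\<integral>u. max 0 (u \<bullet> v) \<partial>\<mu>) = 0"
      then have "AE u in \<mu>. max 0 (u \<bullet> v) = 0"
        using integral_nonneg_eq_0_iff_AE[OF int] by simp
      then have "AE u in \<mu>. u \<notin> ?E" by (rule AE_mp) (rule AE_I2, simp add: max_def)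
      then have "?E \<in> null_sets \<mu>" using AE_iff_null_sets[OF E] by blast
      then have "measure \<mu> ?E = 0" unfolding null_sets_def by (simp add: measure_def)
      then show False using ne by contradiction
    qed
    moreover have "0 \<le> (\<integral>u. max 0 (u \<bullet> v) \<partial>\<mu>)" by (intro Bochner_Integration.integral_nonneg) simp
    ultimately show "0 < (\<integral>u. max 0 (u \<bullet> v) \<partial>\<mu>)" by linarith
  qed
qed

theorem theorem7p1:
  fixes G :: "real \<Rightarrow> 'a::euclidean_space \<Rightarrow> real"
    and \<psi> :: "real \<Rightarrow> real"
    and \<mu> :: "'a measure"
  assumes "DIM('a) \<ge> 2"
    and "continuous_on ({0..} \<times> sphere 0 1) (\<lambda>(t, u). G t u)"
    and "\<And>t u. t \<ge> 0 \<Longrightarrow> u \<in> sphere 0 1 \<Longrightarrow> G t u \<ge> 0"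
    and "\<And>t u. t > 0 \<Longrightarrow> u \<in> sphere 0 1 \<Longrightarrow> (\<lambda>s. G s u) differentiable (at t)"
    and "continuous_on ({0<..} \<times> sphere 0 1) (\<lambda>(t, u). deriv (\<lambda>s. G s u) t)"
    and "\<And>t u. t > 0 \<Longrightarrow> u \<in> sphere 0 1 \<Longrightarrow> deriv (\<lambda>s. G s u) t > 0"
    and "\<And>t u. t > 0 \<Longrightarrow> u \<in> sphere 0 1 \<Longrightarrow>
           deriv (\<lambda>s. G s u) t = deriv (\<lambda>s. G s (- u)) t"
    and "continuous_on {0<..} \<psi>"
    and "\<And>s. s > 0 \<Longrightarrow> \<psi> s > 0"
    and "(\<integral>\<^sup>+ s\<in>{1..}. ennreal (\<psi> s / s) \<partial>lborel) = \<infinity>"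
    and "\<And>t. t > 0 \<Longrightarrow> (\<integral>\<^sup>+ s\<in>{0<..t}. ennreal (\<psi> s / s) \<partial>lborel) < \<infinity>"
    and "sets \<mu> = sets (restrict_space borel (sphere 0 1))"
    and "finite_measure \<mu>"
  shows "even_measure \<mu> \<and> not_concentrated_on_hemisphere \<mu> \<longleftrightarrow>
    (\<exists>K \<in> convex_bodies_os.
       let \<tau> = 1 / dual_orlicz_curvature G (\<lambda>_. 1) K (sphere 0 1)
                 * (LINT u|\<mu>. \<psi> (support_fun K u))
       in \<tau> > 0 \<and>
          (\<forall>E\<in>sets \<mu>. measure \<mu> E = \<tau> * dual_orlicz_curvature G \<psi> K E))"
proof -
  interpret dual_orlicz G \<psi>
  proof (rule dual_orlicz.intro)
  qed (rule assms(2), erule (1) assms(4), rule assms(5), erule (1) assms(6), erule (1) assms(7),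
      rule assms(8), erule assms(9), rule assms(10), erule assms(11))
  show ?thesis
  proof
    assume *: "even_measure \<mu> \<and> not_concentrated_on_hemisphere \<mu>"
    interpret dual_orlicz_minkowski G \<psi> \<mu>
      by (rule dual_orlicz_minkowski.intro[OF dual_orlicz_axioms
            dual_orlicz_minkowski_axioms.intro[OF assms(13,12) conjunct2[OF *]]])
    obtain K where K: "K \<in> convex_bodies_os"
      "0 < 1 / dual_orlicz_curvature G (\<lambda>_. 1) K (sphere 0 1) * (\<integral>u. \<psi> (support_fun K u) \<partial>\<mu>)"
      "\<forall>E\<in>sets \<mu>. measure \<mu> E =
         1 / dual_orlicz_curvature G (\<lambda>_. 1) K (sphere 0 1) * (\<integral>u. \<psi> (support_fun K u) \<partial>\<mu>) *
         dual_orlicz_curvature G \<psi> K E"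
      by (rule solution_exists[OF conjunct1[OF *]])
    show "\<exists>K \<in> convex_bodies_os.
       let \<tau> = 1 / dual_orlicz_curvature G (\<lambda>_. 1) K (sphere 0 1)
                 * (LINT u|\<mu>. \<psi> (support_fun K u))
       in \<tau> > 0 \<and>
          (\<forall>E\<in>sets \<mu>. measure \<mu> E = \<tau> * dual_orlicz_curvature G \<psi> K E)"
      unfolding Let_def by (rule bexI[OF _ K(1)], rule conjI[OF K(2,3)])
  next
    assume "\<exists>K \<in> convex_bodies_os.
       let \<tau> = 1 / dual_orlicz_curvature G (\<lambda>_. 1) K (sphere 0 1)
                 * (LINT u|\<mu>. \<psi> (support_fun K u))
       in \<tau> > 0 \<and>
          (\<forall>E\<in>sets \<mu>. measure \<mu> E = \<tau> * dual_orlicz_curvature G \<psi> K E)"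
    then obtain K where K: "K \<in> convex_bodies_os" and
      sol: "let \<tau> = 1 / dual_orlicz_curvature G (\<lambda>_. 1) K (sphere 0 1)
                 * (LINT u|\<mu>. \<psi> (support_fun K u))
       in \<tau> > 0 \<and>
          (\<forall>E\<in>sets \<mu>. measure \<mu> E = \<tau> * dual_orlicz_curvature G \<psi> K E)" ..
    note sol = sol[unfolded Let_def]
    show "even_measure \<mu> \<and> not_concentrated_on_hemisphere \<mu>"
      using solution_imp_even_not_concentrated[OF assms(13,12) K conjunct1[OF sol] bspec[OF conjunct2[OF sol]]]
      by (rule conjI)
  qed
qed

end
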